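(* Assume that $a>4L_F$ and that there is $\gamma\in(0,\frac a2)$ such that $$\frac{2c_2|\beta|}{\alpha}\left(\frac1\gamma+\frac1{a-2\gamma}\right)<1,$$ where $a=\frac\alpha2-\left|\frac\alpha2-\frac{\delta K\lambda_1}{\alpha}\right|$ and $L_F=\frac{2c_2|\beta|}{\alpha}$. Then the random attractor $\omega\mapsto A(\omega)\subset E$ of the random dynamical system $\phi$ generated by the second order stochastic system $d\dot u+\alpha\,du+KAu\,dt+\beta g(u)\,dt=f\,dt+dW(t)$ is a random horizontal curve.
   Context: Data. $N\ge2$, $d\ge1$ are integers, $\mathbb{Z}^d_N=\{j\in\mathbb{Z}^d:1\le j_1,\dots,j_d\le N\}$; $\alpha,K>0$, $\beta\in\mathbb{R}$, $\delta\in(0,1]$, and $f=(f_j)$, $(\epsilon_j)$ are constant vectors in $\mathbb{R}^{N^d}$ indexed by $\mathbb{Z}^d_N$. $A$ (in the equation) is an $N^d\times N^d$ nonnegative definite symmetric matrix with eigenvalues $0=\lambda_0<\lambda_1\le\dots\le\lambda_{N^d-1}$, with $\lambda_0=0$ algebraically simple and $(1,\dots,1)^\top$ an eigenvector for $\lambda_0$. $g\in C^1(\mathbb{R},\mathbb{R})$ satisfies $g(x+\kappa)=g(x)$, $|g(x)|\le c_1$, $|g'(x)|\le c_2$ for all $x$, where $c_1,c_2>0$ and $\kappa>0$ is the smallest positive period of $g$; $g(u)=(g(u_j))_j$ for $u\in\mathbb{R}^{N^d}$. Noise. $\Omega_0=\{\omega_0\in C(\mathbb{R},\mathbb{R}):\omega_0(0)=0\}$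 with the compact-open topology, Borel $\sigma$-algebra and (two-sided) Wiener measure; $(\Omega,\mathcal{F},\mathbb{P})$ is the product of copies of this space over $j\in\mathbb{Z}^d_N$; $\theta_t\omega(\cdot)=\omega(\cdot+t)-\omega(t)$. $W(t)=(\epsilon_jW_j(t))_j$ with $W_j(t)(\omega)=\omega_j(t)$. $z(\theta_t\omega)=(z_j(\theta_t\omega))_j$ is the unique stationary solution of $dz+z\,dt=dW(t)$ in $\mathbb{R}^{N^d}$ (explicitly $z_j(\omega)=-\epsilon_j\int_{-\infty}^0e^s\omega_j(s)\,ds$). $\Omega$ is replaced, without change of notation, by a $\theta_t$-invariant full-measure subset on which every $t\mapsto z_j(\theta_t\omega)$ is continuous and $\lim_{|t|\to\infty}e^{-\epsilon|t|}|z_j(\theta_t\omega)|=0$ for every $\epsilon>0$. System and spaces. $E=\mathbb{R}^{N^d}\times\mathbb{R}^{N^d}$. With $v=\dot u-z(\theta_t\omega)$ the stochastic system becomes $\dot u=v+z(\theta_t\omega)$, $\dot v=-KAu-\alpha v+f-\beta g(u)+(1-\alpha)z(\theta_t\omega)$; $Y(t,\omega,Y_0)$, $t\ge0$, is its solution $(u,v)^\top$ with $Y(0,\omega,Y_0)=Y_0\in E$. For $\phi_0=(u_0,u_1)^\top\in E$, $\phi(t,\omega,\phi_0)=Y(t,\omega,(u_0,u_1-z(\omega))^\top)+(0,z(\theta_t\omega))^\top$. $\eta_0=(1,\dots,1,0,\dots,0)^\top$, $\eta_{-1}=(1,\dots,1,-\alpha,\dots,-\alpha)^\top\in E$; $E_1=\mathrm{span}\{\eta_0\}$,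 $E_{-1}=\mathrm{span}\{\eta_{-1}\}$, $E_{11}=E_1+E_{-1}$, $E_{22}=E_{11}^\perp$ (Euclidean orthogonal complement in $E$), $E_2=E_{-1}\oplus E_{22}$, so $E=E_1\oplus E_2$; $P$ and $Q=I-P$ are the corresponding projections onto $E_1$ and $E_2$. $p_0=\kappa\eta_0$. Norm. With $\langle\cdot,\cdot\rangle$, $\|\cdot\|$ Euclidean and $Y_i=(u_i,v_i)^\top$: on $E_{11}$, $\langle Y_1,Y_2\rangle_{E_{11}}=\frac{\alpha^2}4\langle u_1,u_2\rangle+\langle\frac\alpha2u_1+v_1,\frac\alpha2u_2+v_2\rangle$; on $E_{22}$, $\langle Y_1,Y_2\rangle_{E_{22}}=\langle KAu_1,u_2\rangle+(\frac{\alpha^2}4-\delta K\lambda_1)\langle u_1,u_2\rangle+\langle\frac\alpha2u_1+v_1,\frac\alpha2u_2+v_2\rangle$; $\langle\cdot,\cdot\rangle_E$ on $E=E_{11}\oplus E_{22}$ is the sum of the two forms evaluated on components. It is an inner product with norm $\|\cdot\|_E$ equivalent to the Euclidean norm; $E_1\perp E_2$ for it, and $L_F$ is the Lipschitz constant in $Y=(u,v)$, with respect to $\|\cdot\|_E$, of $(z(\theta_t\omega),f-\beta g(u)+(1-\alpha)z(\theta_t\omega))^\top$. Attractor. $Y$ and $\phi$ commute with translation by $kp_0$, $k\in\mathbb{Z}$, and induce random dynamical systems $\mathbf{Y}$, $\mathbf{\Phi}$ on $\mathbf{E}=(E_1/p_0\mathbb{Z})\times E_2$ by reduction mod $p_0$.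 The global random attractor of $\mathbf{Y}$ (random compact invariant set attracting all tempered random sets in the pullback sense) is $$\mathbf{A_0}(\omega)=\bigcap_{t>0}\overline{\bigcup_{\tau\ge t}\mathbf{Y}(\tau,\theta_{-\tau}\omega,\mathbf{B_0}(\theta_{-\tau}\omega))},$$ where $\mathbf{B_0}(\omega)=\{Y\ (\mathrm{mod}\,p_0):Y\in E,\ \|QY\|_E\le R_0(\omega)\}$, $R_0(\omega)=\frac{4a_1}{a}\tilde r(\omega)+\frac{2a_2}{a}$, $a_1=M_1\sqrt{3\alpha^2-6\alpha+4}$, $a_2=M_1\sqrt{3\|f\|^2+3\beta^2c_1^2N^d}$, $M_1>0$ is a constant with $\|\cdot\|_E\le M_1\|\cdot\|$ on $E$, and $\tilde r>0$ is a tempered random variable with $\|z(\theta_t\omega)\|\le e^{\frac a2|t|}\tilde r(\omega)$ and $e^{-\frac a2|t|}\tilde r(\omega)\le\tilde r(\theta_t\omega)\le e^{\frac a2|t|}\tilde r(\omega)$ for all $t\in\mathbb{R}$, $\omega\in\Omega$ (such $\tilde r$ exists; a random variable $r>0$ is tempered if $e^{-bt}r(\theta_{-t}\omega)\to0$ as $t\to\infty$ for all $b>0$, $\mathbb{P}$-a.s.). The global random attractor of $\mathbf{\Phi}$ is $\mathbf{A}(\omega)=\mathbf{A_0}(\omega)+(0,z(\omega))^\top\ (\mathrm{mod}\,p_0)$, and the random attractor of $\phi$ is the lift $A(\omega)=\{x\in E:x\ (\mathrm{mod}\,p_0)\in\mathbf{A}(\omega)\}$. Random horizontal curve. A random set $\omega\mapsto\ell(\omega)\subset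 E$ (i.e. $\omega\mapsto\inf_{y\in\ell(\omega)}\|x-y\|_E$ is measurable for each $x\in E$) is a random horizontal curve if $\ell(\omega)=\{(p,\Phi^\omega(p)):p\in E_1\}$ (that is, $\{p+\Phi^\omega(p):p\in E_1\}$) for maps $\Phi^\omega:E_1\to E_2$ with $\|\Phi^\omega(p_1)-\Phi^\omega(p_2)\|_E\le\|p_1-p_2\|_E$ and $\Phi^\omega(p+p_0)=\Phi^\omega(p)$ for all $p,p_1,p_2\in E_1$, $\omega\in\Omega$. *)

theory Defs
  imports "HOL-Probability.Probability"
begin

section \<open>Two-sided Wiener noise\<close>

definition C0 :: "(real \<Rightarrow> real) set" where
  "C0 = {w. continuous_on UNIV w \<and> w 0 = 0}"

definition compact_open_C0 :: "(real \<Rightarrow> real) topology" where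
  "compact_open_C0 = topology_generated_by
     {{w \<in> C0. w ` C \<subseteq> U} | C U. compact C \<and> open U}"

text \<open>The two-sided Wiener measure is the unique measure with independent, centred Gaussian
  increments of variance \<^term>\<open>t - s\<close> over the whole time axis; the normalisation
  \<^term>\<open>w 0 = 0\<close> is built into \<^const>\<open>C0\<close>.\<close>

definition two_sided_wiener :: "(real \<Rightarrow> real) measure \<Rightarrow> bool" where
  "two_sided_wiener M \<longleftrightarrow>
     prob_space M \<and>
     space M = C0 \<and>
     sets M = sigma_sets C0 {U. openin compact_open_C0 U} \<and>
     (\<forall>s t. s < t \<longrightarrow>
        distributed M lborel (\<lambda>w. w t - w s) (normal_density 0 (sqrt (t - s)))) \<and>
     (\<forall>(n::nat) (t :: nat \<Rightarrow> real). (\<forall>i<n. t i < t (Suc i)) \<longrightarrow>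
        prob_space.indep_vars M (\<lambda>_. borel) (\<lambda>i w. w (t (Suc i)) - w (t i)) {..<n})"

definition theta :: "real \<Rightarrow> ('i \<Rightarrow> real \<Rightarrow> real) \<Rightarrow> 'i \<Rightarrow> real \<Rightarrow> real" where
  "theta t \<omega> = (\<lambda>j s. \<omega> j (s + t) - \<omega> j t)"

definition ou :: "real ^ 'i \<Rightarrow> ('i \<Rightarrow> real \<Rightarrow> real) \<Rightarrow> real ^ 'i::finite" where
  "ou \<epsilon> \<omega> = (\<chi> j. - (\<epsilon> $ j) * (LINT s:{..0}|lborel. exp s * \<omega> j s))"

text \<open>A \<^term>\<open>theta\<close>-invariant set of full measure on which the stationary solution
  \<^term>\<open>\<lambda>t. ou \<epsilon> (theta t \<omega>)\<close> is given by a convergent integral, is continuous in \<^term>\<open>t\<close>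
  and grows subexponentially. Integrability is listed because a divergent
  Lebesgue integral has the value 0 by convention.\<close>

definition good_noise_set ::
  "('i \<Rightarrow> real \<Rightarrow> real) measure \<Rightarrow> real ^ 'i \<Rightarrow> ('i::finite \<Rightarrow> real \<Rightarrow> real) set \<Rightarrow> bool" where
  "good_noise_set F \<epsilon> \<Omega> \<longleftrightarrow>
     \<Omega> \<in> sets F \<and> measure F \<Omega> = 1 \<and>
     (\<forall>t. theta t ` \<Omega> = \<Omega>) \<and>
     (\<forall>\<omega>\<in>\<Omega>. \<forall>j.
        set_integrable lborel {..0} (\<lambda>s. exp s * \<omega> j s) \<and>
        continuous_on UNIV (\<lambda>t. ou \<epsilon> (theta t \<omega>) $ j) \<and>
        (\<forall>e>0. ((\<lambda>t. exp (- e * \<bar>t\<bar>) * \<bar>ou \<epsilon> (theta t \<omega>) $ j\<bar>) \<longlongrightarrow> 0) at_infinity))"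

definition tempered ::
  "('i \<Rightarrow> real \<Rightarrow> real) measure \<Rightarrow> (('i \<Rightarrow> real \<Rightarrow> real) \<Rightarrow> real) \<Rightarrow> bool" where
  "tempered M r \<longleftrightarrow>
     r \<in> borel_measurable M \<and> (\<forall>\<omega>\<in>space M. r \<omega> > 0) \<and>
     (AE \<omega> in M. \<forall>b>0. ((\<lambda>t. exp (- b * t) * r (theta (- t) \<omega>)) \<longlongrightarrow> 0) at_top)"


section \<open>The coupling matrix\<close>

text \<open>The eigenvalues, repeated according to algebraic multiplicity, are read off from
  the characteristic polynomial.\<close>

definition eigenvalue_list :: "real ^ 'i ^ 'i \<Rightarrow> (nat \<Rightarrow> real) \<Rightarrow> bool" where
  "eigenvalue_list A lam \<longleftrightarrow>
     (\<forall>x. det (mat x - A) = (\<Prod>k<CARD('i). x - lam k))"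

definition coupling_matrix :: "real ^ 'i ^ 'i \<Rightarrow> (nat \<Rightarrow> real) \<Rightarrow> bool" where
  "coupling_matrix A lam \<longleftrightarrow>
     transpose A = A \<and> (\<forall>x. 0 \<le> x \<bullet> (A *v x)) \<and>
     eigenvalue_list A lam \<and>
     lam 0 = 0 \<and> 0 < lam 1 \<and>
     (\<forall>k l. 1 \<le> k \<and> k \<le> l \<and> l < CARD('i) \<longrightarrow> lam k \<le> lam l) \<and>
     A *v vec 1 = 0"


section \<open>Decomposition of the phase space and the norm\<close>

type_synonym 'i phase = "(real ^ 'i) \<times> (real ^ 'i)"

definition eta0 :: "'i::finite phase" where
  "eta0 = (vec 1, vec 0)"

definition eta_m1 :: "real \<Rightarrow> 'i::finite phase" where
  "eta_m1 \<alpha> = (vec 1, vec (- \<alpha>))"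

definition E1 :: "'i::finite phase set" where
  "E1 = span {eta0}"

definition E_m1 :: "real \<Rightarrow> 'i::finite phase set" where
  "E_m1 \<alpha> = span {eta_m1 \<alpha>}"

definition E11 :: "real \<Rightarrow> 'i::finite phase set" where
  "E11 \<alpha> = {x + y | x y. x \<in> E1 \<and> y \<in> E_m1 \<alpha>}"

definition E22 :: "real \<Rightarrow> 'i::finite phase set" where
  "E22 \<alpha> = orthogonal_comp (E11 \<alpha>)"

definition E2 :: "real \<Rightarrow> 'i::finite phase set" where
  "E2 \<alpha> = {x + y | x y. x \<in> E_m1 \<alpha> \<and> y \<in> E22 \<alpha>}"

definition projP :: "real \<Rightarrow> 'i phase \<Rightarrow> 'i::finite phase" where
  "projP \<alpha> Y = (THE p. p \<in> E1 \<and> Y - p \<in> E2 \<alpha>)"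

definition projQ :: "real \<Rightarrow> 'i phase \<Rightarrow> 'i::finite phase" where
  "projQ \<alpha> Y = Y - projP \<alpha> Y"

definition comp11 :: "real \<Rightarrow> 'i phase \<Rightarrow> 'i::finite phase" where
  "comp11 \<alpha> Y = (THE y. y \<in> E11 \<alpha> \<and> Y - y \<in> E22 \<alpha>)"

definition comp22 :: "real \<Rightarrow> 'i phase \<Rightarrow> 'i::finite phase" where
  "comp22 \<alpha> Y = Y - comp11 \<alpha> Y"

definition form11 :: "real \<Rightarrow> 'i phase \<Rightarrow> 'i::finite phase \<Rightarrow> real" where
  "form11 \<alpha> Y1 Y2 =
     \<alpha>\<^sup>2 / 4 * (fst Y1 \<bullet> fst Y2)
     + ((\<alpha> / 2) *\<^sub>R fst Y1 + snd Y1) \<bullet> ((\<alpha> / 2) *\<^sub>R fst Y2 + snd Y2)"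

definition form22 ::
  "real ^ 'i ^ 'i \<Rightarrow> real \<Rightarrow> real \<Rightarrow> real \<Rightarrow> real \<Rightarrow> 'i phase \<Rightarrow> 'i::finite phase \<Rightarrow> real" where
  "form22 A K \<alpha> \<delta> lam1 Y1 Y2 =
     (K *\<^sub>R (A *v fst Y1)) \<bullet> fst Y2
     + (\<alpha>\<^sup>2 / 4 - \<delta> * K * lam1) * (fst Y1 \<bullet> fst Y2)
     + ((\<alpha> / 2) *\<^sub>R fst Y1 + snd Y1) \<bullet> ((\<alpha> / 2) *\<^sub>R fst Y2 + snd Y2)"

definition innerE ::
  "real ^ 'i ^ 'i \<Rightarrow> real \<Rightarrow> real \<Rightarrow> real \<Rightarrow> real \<Rightarrow> 'i phase \<Rightarrow> 'i::finite phase \<Rightarrow> real" where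
  "innerE A K \<alpha> \<delta> lam1 Y1 Y2 =
     form11 \<alpha> (comp11 \<alpha> Y1) (comp11 \<alpha> Y2)
     + form22 A K \<alpha> \<delta> lam1 (comp22 \<alpha> Y1) (comp22 \<alpha> Y2)"

definition normE ::
  "real ^ 'i ^ 'i \<Rightarrow> real \<Rightarrow> real \<Rightarrow> real \<Rightarrow> real \<Rightarrow> 'i::finite phase \<Rightarrow> real" where
  "normE A K \<alpha> \<delta> lam1 Y = sqrt (innerE A K \<alpha> \<delta> lam1 Y Y)"


section \<open>The random system\<close>

text \<open>The equation for \<^term>\<open>(u, v)\<close>, where \<^term>\<open>v\<close> is the velocity minus
  the stationary process; \<^term>\<open>z\<close> is the current value of that process.\<close>

definition vfield ::
  "real ^ 'i ^ 'i \<Rightarrow> real \<Rightarrow> real \<Rightarrow> real \<Rightarrow> real ^ 'i \<Rightarrow> (real \<Rightarrow> real)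
    \<Rightarrow> real ^ 'i \<Rightarrow> 'i phase \<Rightarrow> 'i::finite phase" where
  "vfield A K \<alpha> \<beta> f g z Y =
     (let u = fst Y; v = snd Y in
       (v + z,
        - (K *\<^sub>R (A *v u)) - \<alpha> *\<^sub>R v + f - \<beta> *\<^sub>R (\<chi> j. g (u $ j)) + (1 - \<alpha>) *\<^sub>R z))"

definition is_solution_map ::
  "('i \<Rightarrow> real \<Rightarrow> real) set \<Rightarrow> real ^ 'i ^ 'i \<Rightarrow> real \<Rightarrow> real \<Rightarrow> real \<Rightarrow> real ^ 'i \<Rightarrow> real ^ 'i
    \<Rightarrow> (real \<Rightarrow> real) \<Rightarrow> (real \<Rightarrow> ('i \<Rightarrow> real \<Rightarrow> real) \<Rightarrow> 'i phase \<Rightarrow> 'i::finite phase) \<Rightarrow> bool" where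
  "is_solution_map \<Omega> A K \<alpha> \<beta> f \<epsilon> g Y \<longleftrightarrow>
     (\<forall>\<omega>\<in>\<Omega>. \<forall>Y0. Y 0 \<omega> Y0 = Y0 \<and>
        (\<forall>t\<ge>0. ((\<lambda>s. Y s \<omega> Y0) has_vector_derivative
                  vfield A K \<alpha> \<beta> f g (ou \<epsilon> (theta t \<omega>)) (Y t \<omega> Y0)) (at t within {0..})))"

definition phi ::
  "real ^ 'i \<Rightarrow> (real \<Rightarrow> ('i \<Rightarrow> real \<Rightarrow> real) \<Rightarrow> 'i phase \<Rightarrow> 'i phase)
    \<Rightarrow> real \<Rightarrow> ('i \<Rightarrow> real \<Rightarrow> real) \<Rightarrow> 'i phase \<Rightarrow> 'i::finite phase" where
  "phi \<epsilon> Y t \<omega> \<phi>0 = Y t \<omega> (fst \<phi>0, snd \<phi>0 - ou \<epsilon> \<omega>) + (0, ou \<epsilon> (theta t \<omega>))"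

text \<open>Adding \<^term>\<open>(0, ou \<epsilon> \<omega>)\<close> conjugates \<^term>\<open>Y\<close> to \<^term>\<open>phi \<epsilon> Y\<close>; this is why
  the attractor of the latter is the translate of the attractor of the former.\<close>

lemma phi_conjugate:
  "phi \<epsilon> Y t \<omega> (x + (0, ou \<epsilon> \<omega>)) = Y t \<omega> x + (0, ou \<epsilon> (theta t \<omega>))"
  by (cases x) (simp add: phi_def)


section \<open>Reduction modulo the period\<close>

definition p0 :: "real \<Rightarrow> 'i::finite phase" where
  "p0 \<kappa> = \<kappa> *\<^sub>R eta0"

definition coset :: "real \<Rightarrow> 'i phase \<Rightarrow> 'i::finite phase set" where
  "coset \<kappa> x = {x + of_int k *\<^sub>R p0 \<kappa> | k :: int. True}"

text \<open>The quotient of \<^const>\<open>E1\<close> by the translations, with the quotient topology.\<close>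

definition circle_top :: "real \<Rightarrow> 'i::finite phase set topology" where
  "circle_top \<kappa> = topology (\<lambda>U. U \<subseteq> coset \<kappa> ` E1 \<and>
     openin (top_of_set E1) {x \<in> E1. coset \<kappa> x \<in> U})"

lemma openin_circle_top:
  fixes U :: "'i::finite phase set set"
  shows "openin (circle_top \<kappa>) U \<longleftrightarrow>
     U \<subseteq> coset \<kappa> ` E1 \<and> openin (top_of_set E1) {x \<in> E1. coset \<kappa> x \<in> U}"
proof -
  have "istopology (\<lambda>U :: 'i phase set set. U \<subseteq> coset \<kappa> ` E1 \<and>
     openin (top_of_set E1) {x \<in> E1. coset \<kappa> x \<in> U})" (is "istopology ?L")
    unfolding istopology_def
  proof (intro conjI allI impI)
    fix S T assume S: "?L S" and T: "?L T"
    have eq: "{x \<in> E1. coset \<kappa> x \<in> S \<inter> T} =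
        {x \<in> E1. coset \<kappa> x \<in> S} \<inter> {x \<in> E1. coset \<kappa> x \<in> T}" by auto
    show "S \<inter> T \<subseteq> coset \<kappa> ` E1" using S by auto
    show "openin (top_of_set E1) {x \<in> E1. coset \<kappa> x \<in> S \<inter> T}"
      unfolding eq using S T by (intro openin_Int) auto
  next
    fix \<K> assume K: "\<forall>S\<in>\<K>. ?L S"
    have eq: "{x \<in> E1. coset \<kappa> x \<in> \<Union>\<K>} = (\<Union>S\<in>\<K>. {x \<in> E1. coset \<kappa> x \<in> S})" by auto
    show "\<Union>\<K> \<subseteq> coset \<kappa> ` E1" using K by blast
    show "openin (top_of_set E1) {x \<in> E1. coset \<kappa> x \<in> \<Union>\<K>}"
      unfolding eq using K by (intro openin_Union) auto
  qed
  then show ?thesis by (simp add: circle_top_def)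
qed

lemma topspace_circle_top:
  "topspace (circle_top \<kappa>) = coset \<kappa> ` (E1 :: 'i::finite phase set)"
proof -
  have "{x \<in> E1. coset \<kappa> x \<in> coset \<kappa> ` E1} = (E1 :: 'i phase set)" by auto
  then have "openin (circle_top \<kappa>) (coset \<kappa> ` (E1 :: 'i phase set))"
    by (simp add: openin_circle_top)
  moreover have "topspace (circle_top \<kappa> :: 'i phase set topology) \<subseteq> coset \<kappa> ` E1"
    by (metis openin_circle_top openin_topspace)
  ultimately show ?thesis by (simp add: openin_subset subset_antisym)
qed

lemma quotient_map_coset: "quotient_map (top_of_set E1) (circle_top \<kappa>) (coset \<kappa>)"
  by (auto simp: quotient_map_def topspace_circle_top openin_circle_top)

definition Emod_top ::
  "real \<Rightarrow> real \<Rightarrow> ('i::finite phase set \<times> 'i phase) topology" where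
  "Emod_top \<alpha> \<kappa> = prod_topology (circle_top \<kappa>) (top_of_set (E2 \<alpha>))"

definition modp :: "real \<Rightarrow> real \<Rightarrow> 'i phase \<Rightarrow> 'i::finite phase set \<times> 'i phase" where
  "modp \<alpha> \<kappa> Y = (coset \<kappa> (projP \<alpha> Y), projQ \<alpha> Y)"

text \<open>The map induced on the quotient by a map commuting with the translations, evaluated on
  an arbitrary representative.\<close>

definition induced ::
  "real \<Rightarrow> real \<Rightarrow> ('i phase \<Rightarrow> 'i phase)
    \<Rightarrow> 'i phase set \<times> 'i phase \<Rightarrow> 'i::finite phase set \<times> 'i phase" where
  "induced \<alpha> \<kappa> F c = modp \<alpha> \<kappa> (F (SOME Y. modp \<alpha> \<kappa> Y = c))"


section \<open>The attractors\<close>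

definition absorbing ::
  "real \<Rightarrow> real \<Rightarrow> ('i phase \<Rightarrow> real) \<Rightarrow> (('i \<Rightarrow> real \<Rightarrow> real) \<Rightarrow> real)
    \<Rightarrow> ('i \<Rightarrow> real \<Rightarrow> real) \<Rightarrow> ('i::finite phase set \<times> 'i phase) set" where
  "absorbing \<alpha> \<kappa> nrm R0 \<omega> = modp \<alpha> \<kappa> ` {Y. nrm (projQ \<alpha> Y) \<le> R0 \<omega>}"

definition attractor_Y ::
  "real \<Rightarrow> real \<Rightarrow> (real \<Rightarrow> ('i \<Rightarrow> real \<Rightarrow> real) \<Rightarrow> 'i phase \<Rightarrow> 'i phase)
    \<Rightarrow> (('i \<Rightarrow> real \<Rightarrow> real) \<Rightarrow> ('i phase set \<times> 'i phase) set)
    \<Rightarrow> ('i \<Rightarrow> real \<Rightarrow> real) \<Rightarrow> ('i::finite phase set \<times> 'i phase) set" where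
  "attractor_Y \<alpha> \<kappa> Y B0 \<omega> =
     (\<Inter>t\<in>{0<..}. Emod_top \<alpha> \<kappa> closure_of
        (\<Union>\<tau>\<in>{t..}. induced \<alpha> \<kappa> (Y \<tau> (theta (- \<tau>) \<omega>)) ` B0 (theta (- \<tau>) \<omega>)))"

definition attractor_Phi ::
  "real \<Rightarrow> real \<Rightarrow> real ^ 'i \<Rightarrow> (real \<Rightarrow> ('i \<Rightarrow> real \<Rightarrow> real) \<Rightarrow> 'i phase \<Rightarrow> 'i phase)
    \<Rightarrow> (('i \<Rightarrow> real \<Rightarrow> real) \<Rightarrow> ('i phase set \<times> 'i phase) set)
    \<Rightarrow> ('i \<Rightarrow> real \<Rightarrow> real) \<Rightarrow> ('i::finite phase set \<times> 'i phase) set" where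
  "attractor_Phi \<alpha> \<kappa> \<epsilon> Y B0 \<omega> =
     {modp \<alpha> \<kappa> (x + (0, ou \<epsilon> \<omega>)) | x. modp \<alpha> \<kappa> x \<in> attractor_Y \<alpha> \<kappa> Y B0 \<omega>}"

definition attractor_phi ::
  "real \<Rightarrow> real \<Rightarrow> real ^ 'i \<Rightarrow> (real \<Rightarrow> ('i \<Rightarrow> real \<Rightarrow> real) \<Rightarrow> 'i phase \<Rightarrow> 'i phase)
    \<Rightarrow> (('i \<Rightarrow> real \<Rightarrow> real) \<Rightarrow> ('i phase set \<times> 'i phase) set)
    \<Rightarrow> ('i \<Rightarrow> real \<Rightarrow> real) \<Rightarrow> 'i::finite phase set" where
  "attractor_phi \<alpha> \<kappa> \<epsilon> Y B0 \<omega> = {x. modp \<alpha> \<kappa> x \<in> attractor_Phi \<alpha> \<kappa> \<epsilon> Y B0 \<omega>}"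


section \<open>Random horizontal curves\<close>

definition random_set ::
  "('i \<Rightarrow> real \<Rightarrow> real) measure \<Rightarrow> ('i phase \<Rightarrow> real)
    \<Rightarrow> (('i \<Rightarrow> real \<Rightarrow> real) \<Rightarrow> 'i::finite phase set) \<Rightarrow> bool" where
  "random_set M nrm l \<longleftrightarrow> (\<forall>x. (\<lambda>\<omega>. INF y\<in>l \<omega>. nrm (x - y)) \<in> borel_measurable M)"

definition random_horizontal_curve ::
  "('i \<Rightarrow> real \<Rightarrow> real) measure \<Rightarrow> ('i phase \<Rightarrow> real) \<Rightarrow> real \<Rightarrow> real
    \<Rightarrow> (('i \<Rightarrow> real \<Rightarrow> real) \<Rightarrow> 'i::finite phase set) \<Rightarrow> bool" where
  "random_horizontal_curve M nrm \<alpha> \<kappa> l \<longleftrightarrow>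
     random_set M nrm l \<and>
     (\<exists>\<Phi>. \<forall>\<omega>\<in>space M.
        \<Phi> \<omega> \<in> E1 \<rightarrow> E2 \<alpha> \<and>
        l \<omega> = {p + \<Phi> \<omega> p | p. p \<in> E1} \<and>
        (\<forall>p1\<in>E1. \<forall>p2\<in>E1. nrm (\<Phi> \<omega> p1 - \<Phi> \<omega> p2) \<le> nrm (p1 - p2)) \<and>
        (\<forall>p\<in>E1. \<Phi> \<omega> (p + p0 \<kappa>) = \<Phi> \<omega> p))"

end

theory Submission
  imports Defs
begin


text \<open>The idea of the proof. Write \<^term>\<open>a\<close> for the dissipation rate and \<^term>\<open>L\<close> for the
  Lipschitz constant of the nonlinearity, both with respect to the adapted norm, so that
  \<^term>\<open>a > 4 * L\<close>. Let \<^term>\<open>D\<close> be the difference of two solutions of the equation driven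
  by the same noise path, with components \<open>P D\<close> along the neutral direction and \<open>Q D\<close> along its
  complement. The indefinite form \<open>V(D) = |Q D|\<^sup>2 - |P D|\<^sup>2\<close> satisfies \<open>V' \<le> - 2 (a - L) V\<close>,
  without any restriction on the sign of \<open>V\<close> (\<open>cone_gen_le\<close>, \<open>solves_cone_decay\<close>). On the other
  hand the absorbing slab \<open>{|Q y| \<le> R0}\<close> is carried by the flow into the slab
  of any later time (\<open>solves_absorbed\<close>), and its squared width at time \<open>- T\<close> grows at most like \<open>exp (a T)\<close>.
  Since \<open>2 (a - L) > a\<close>, the decay wins: two points that both lie in images at the present time
  of slabs started at time \<open>- T\<close> or earlier have a difference with \<open>V \<le> err T\<close>, where \<open>err T\<close>
  tends to \<open>0\<close> (\<open>img_cone\<close>).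

  Everything follows from this estimate. In the limit, differences of points of the attractor
  satisfy \<open>V \<le> 0\<close>, which says that the attractor is the graph of a nonexpansive map over a subset
  of \<^const>\<open>E1\<close> (\<open>att_cone\<close>, \<open>cone_set_is_graph\<close>). It lies over all of \<^const>\<open>E1\<close>, because
  the image of the neutral line meets every fibre by the intermediate value theorem
  (\<open>Y_line_surj\<close>), and a subsequence of such points converges (\<open>att_exists\<close>). Finally the images
  of the neutral line converge to the attractor at the rate \<open>sqrt (err T)\<close>
  (\<open>dist_att_approx\<close>), so distances to the attractor are limits of countable infima of
  distances to solution values; these are measurable because solutions are limits of Euler
  polygons (\<open>Y_measurable\<close>). The quotient by the period disappears once one knows that the
  projection onto it is continuous and open (\<open>closure_of_modp_image\<close>).\<close>


section \<open>The spectral gap of the coupling matrix\<close>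

lemma symmetric_matrix_inner:
  fixes A :: "real ^ 'i::finite ^ 'i"
  assumes "transpose A = A"
  shows "(A *v x) \<bullet> y = x \<bullet> (A *v y)"
  using assms by (metis dot_lmul_matrix vector_transpose_matrix)

lemma char_matrix_vector_mult:
  fixes A :: "real ^ 'i::finite ^ 'i"
  shows "(mat x - A) *v y = x *\<^sub>R y - A *v y"
proof -
  have "mat x *v y = x *\<^sub>R y"
    by (simp add: vec_eq_iff matrix_vector_mult_def mat_def if_distrib[of "\<lambda>t. t * _"] cong: if_cong)
  then show ?thesis by (simp add: matrix_vector_mult_diff_rdistrib)
qed

text \<open>The Rayleigh quotient attains its minimum on the hyperplane orthogonal to a kernel vector
  \<^term>\<open>w\<close>, and the minimiser is an eigenvector: symmetry of \<^term>\<open>A\<close> keeps the gradient in the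
  hyperplane.\<close>

lemma constrained_minimiser_eigenvector:
  fixes A :: "real ^ 'i::finite ^ 'i" and w :: "real ^ 'i"
  assumes sym: "transpose A = A" and w: "A *v w = 0"
    and ex: "\<exists>x. x \<noteq> 0 \<and> x \<bullet> w = 0"
  obtains \<mu> u where "u \<noteq> 0" "u \<bullet> w = 0" "A *v u = \<mu> *\<^sub>R u"
    "\<And>x. x \<bullet> w = 0 \<Longrightarrow> \<mu> * (x \<bullet> x) \<le> x \<bullet> (A *v x)"
proof -
  define S where "S = {x. norm x = 1 \<and> x \<bullet> w = 0}"
  have "S = sphere 0 1 \<inter> {x. w \<bullet> x = 0}"
    by (auto simp: S_def inner_commute)
  then have "compact S"
    by (simp add: compact_Int_closed closed_hyperplane)
  moreover have "S \<noteq> {}"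
  proof -
    obtain x where "x \<noteq> 0" "x \<bullet> w = 0" using ex by blast
    then have "(1 / norm x) *\<^sub>R x \<in> S" by (simp add: S_def)
    then show ?thesis by blast
  qed
  moreover have "continuous_on S (\<lambda>x. x \<bullet> (A *v x))"
    by (intro continuous_intros matrix_vector_mult_linear_continuous_on)
  ultimately obtain u where u: "u \<in> S" and min: "\<And>x. x \<in> S \<Longrightarrow> u \<bullet> (A *v u) \<le> x \<bullet> (A *v x)"
    using continuous_attains_inf by metis
  define \<mu> where "\<mu> = u \<bullet> (A *v u)"
  have uu: "u \<bullet> u = 1" using u by (simp add: S_def norm_eq_1)
  have bound: "\<mu> * (x \<bullet> x) \<le> x \<bullet> (A *v x)" if x: "x \<bullet> w = 0" for x
  proof (cases "x = 0")
    case False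
    have "(1 / norm x) *\<^sub>R x \<in> S" using x False by (simp add: S_def)
    from min[OF this] have "\<mu> \<le> (x \<bullet> (A *v x)) / (norm x)\<^sup>2"
      by (simp add: \<mu>_def matrix_vector_mult_scaleR power2_eq_square)
    then show ?thesis using False by (simp add: field_simps power2_norm_eq_inner)
  qed simp
  have quad: "0 \<le> 2 * t * (y \<bullet> (A *v u) - \<mu> * (y \<bullet> u)) + t\<^sup>2 * (y \<bullet> (A *v y) - \<mu> * (y \<bullet> y))"
    if y: "y \<bullet> w = 0" for y t
  proof -
    have "(u + t *\<^sub>R y) \<bullet> w = 0" using u y by (simp add: S_def inner_add_left)
    from bound[OF this] show ?thesis
      using symmetric_matrix_inner[OF sym, of u y] uu
      by (simp add: inner_add_left inner_add_right matrix_vector_right_distrib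
          matrix_vector_mult_scaleR algebra_simps power2_eq_square \<mu>_def inner_commute)
  qed
  have stat: "y \<bullet> (A *v u) = \<mu> * (y \<bullet> u)" if y: "y \<bullet> w = 0" for y
  proof (rule ccontr)
    define b where "b = y \<bullet> (A *v u) - \<mu> * (y \<bullet> u)"
    define c where "c = y \<bullet> (A *v y) - \<mu> * (y \<bullet> y)"
    assume "y \<bullet> (A *v u) \<noteq> \<mu> * (y \<bullet> u)"
    then have b: "b \<noteq> 0" by (simp add: b_def)
    have c: "0 \<le> c" using bound[OF y] by (simp add: c_def)
    have *: "0 \<le> 2 * t * b + t\<^sup>2 * c" for t using quad[OF y, of t] by (simp add: b_def c_def)
    \<comment> \<open>At \<^term>\<open>t = - b / (c + 1)\<close> the quadratic polynomial is negative.\<close>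
    define e where "e = b / (c + 1)"
    have "b = e * (c + 1)" using c by (simp add: e_def)
    with *[of "- e"] have "0 \<le> - (e\<^sup>2 * (c + 2))"
      by (simp add: algebra_simps power2_eq_square)
    moreover have "e \<noteq> 0" using b c by (simp add: e_def)
    ultimately have "e\<^sup>2 * (c + 2) \<le> 0" "e\<^sup>2 > 0" by auto
    then show False using c by (simp add: mult_le_0_iff)
  qed
  define e where "e = A *v u - \<mu> *\<^sub>R u"
  have uw: "u \<bullet> w = 0" using u by (simp add: S_def)
  have "(A *v u) \<bullet> w = 0" using symmetric_matrix_inner[OF sym, of u w] w by simp
  then have "e \<bullet> w = 0" using uw by (simp add: e_def inner_diff_left)
  from stat[OF this] have "e \<bullet> e = 0" by (simp add: e_def inner_diff_right)
  then have "A *v u = \<mu> *\<^sub>R u" by (simp add: e_def)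
  with uu uw bound show ?thesis by (intro that[of u \<mu>]) auto
qed

text \<open>A kernel vector \<^term>\<open>u\<close> that is not constant makes \<^term>\<open>0\<close> at least a double root of the
  characteristic polynomial: let \<^term>\<open>P\<close> be the matrix whose rows are the standard basis vectors,
  two of them replaced by the two independent kernel vectors. Then two rows of
  \<^term>\<open>P ** (mat x - A)\<close> are multiples of \<^term>\<open>x\<close>.\<close>

lemma charpoly_double_root:
  fixes A :: "real ^ 'i::finite ^ 'i"
  assumes sym: "transpose A = A" and one: "A *v vec 1 = 0"
    and u: "A *v u = 0" "u $ i \<noteq> u $ j"
  obtains h where "continuous_on UNIV h" "\<And>x::real. det (mat x - A) = x\<^sup>2 * h x"
proof -
  define P :: "real ^ 'i ^ 'i" where
    "P = (\<chi> k. if k = i then vec 1 else if k = j then u else axis k 1)"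
  have ij: "i \<noteq> j" using u by auto
  have "det P \<noteq> 0"
  proof -
    have "x = 0" if x: "transpose P *v x = 0" for x
    proof -
      have row: "x \<bullet> (\<chi> k. P $ k $ l) = 0" for l
        using x by (simp add: vec_eq_iff matrix_vector_mult_def transpose_def inner_vec_def mult.commute)
      have val: "x $ i + x $ j * u $ l + (if l = i \<or> l = j then 0 else x $ l) = 0" for l
      proof -
        have "(\<Sum>k\<in>UNIV. x $ k * P $ k $ l)
            = (\<Sum>k\<in>UNIV. (if k = i then x $ i else 0) + (if k = j then x $ j * u $ l else 0)
                 + (if k = l then (if l = i \<or> l = j then 0 else x $ l) else 0))"
          by (intro sum.cong) (use ij in \<open>auto simp: P_def axis_def\<close>)
        also have "\<dots> = x $ i + x $ j * u $ l + (if l = i \<or> l = j then 0 else x $ l)"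
          by (simp only: sum.distrib sum.delta finite UNIV_I if_True)
        finally show ?thesis using row[of l] by (simp add: inner_vec_def)
      qed
        have "x $ j * u $ i = x $ j * u $ j" using val[of i, simplified] val[of j, simplified] by linarith
      then have "x $ j = 0" using u by simp
      moreover from this have "x $ i = 0" using val[of i] by simp
      ultimately have "x $ l = 0" for l using val[of l] by (auto split: if_splits)
      then show "x = 0" by (simp add: vec_eq_iff)
    qed
    then have "\<exists>B. B ** transpose P = mat 1" using matrix_left_invertible_ker by blast
    then have "invertible (transpose P)" using invertible_left_inverse by blast
    then show ?thesis by (simp add: invertible_det_nz det_transpose)
  qed
  define R :: "real \<Rightarrow> real ^ 'i ^ 'i" where
    "R = (\<lambda>x. \<chi> k. if k = i then vec 1 else if k = j then u else (mat x - A) $ k)"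
  define c where "c = (\<lambda>x k. if k = i \<or> k = j then x else (1::real))"
  have symx: "(mat x - A) $ l $ k = (mat x - A) $ k $ l" for x :: real and k l
    using sym by (auto simp: vec_eq_iff transpose_def mat_def)
  have row: "(P ** (mat x - A)) $ k = (mat x - A) *v (P $ k)" for x k
    by (auto simp: vec_eq_iff matrix_matrix_mult_def matrix_vector_mult_def mult.commute
        simp del: vector_minus_component intro!: sum.cong) (metis symx)
  have "P ** (mat x - A) = (\<chi> k. c x k *s R x $ k)" for x
  proof -
    have "(P ** (mat x - A)) $ k = c x k *s R x $ k" for k
    proof -
      consider "k = i" | "k = j" "k \<noteq> i" | "k \<noteq> i" "k \<noteq> j" by blast
      then show ?thesis
      proof cases
        case 3
        have "(mat x - A) *v axis k 1 = (mat x - A) $ k"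
          using symx[of x _ k] by (simp add: matrix_vector_mul_component inner_axis' vec_eq_iff
              matrix_vector_mult_basis column_def)
        then show ?thesis using 3 by (simp only: row) (simp add: P_def c_def R_def)
      qed (use one u(1) in \<open>simp_all only: row char_matrix_vector_mult,
            simp_all add: P_def c_def R_def scalar_mult_eq_scaleR\<close>)
    qed
    then show ?thesis by (simp add: vec_eq_iff)
  qed
  then have "det P * det (mat x - A) = det (\<chi> k. c x k *s R x $ k)" for x
    by (metis det_mul)
  also have "\<dots> x = (\<Prod>k\<in>UNIV. c x k) * det (R x)" for x
    by (simp add: det_rows_mul)
  also have "(\<Prod>k\<in>UNIV. c x k) = x\<^sup>2" for x
    using prod.mono_neutral_right[of UNIV "{i, j}" "c x"] ij by (auto simp: c_def power2_eq_square)
  finally have eq: "det P * det (mat x - A) = x\<^sup>2 * det (R x)" for x .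
  have "continuous_on UNIV (\<lambda>x. R x $ k $ l)" for k l
    unfolding R_def mat_def by (cases "k = i"; cases "k = j"; cases "k = l") (auto intro!: continuous_intros)
  then have "continuous_on UNIV (\<lambda>x. det (R x) / det P)"
    unfolding det_def[of "R _"] using \<open>det P \<noteq> 0\<close>
    by (intro continuous_on_divide continuous_on_sum continuous_on_mult continuous_on_prod
        continuous_on_const) auto
  moreover have "det (mat x - A) = x\<^sup>2 * (det (R x) / det P)" for x
    using eq[of x] \<open>det P \<noteq> 0\<close> by (simp add: field_simps)
  ultimately show thesis by (rule that)
qed

text \<open>Coercivity of the coupling on the vectors of mean zero.\<close>

lemma coupling_spectral_gap:
  fixes A :: "real ^ 'i::finite ^ 'i"
  assumes A: "coupling_matrix A lam" and card: "CARD('i) \<ge> 2"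
    and x: "x \<bullet> vec 1 = 0"
  shows "lam 1 * (x \<bullet> x) \<le> x \<bullet> (A *v x)"
proof -
  have sym: "transpose A = A" and one: "A *v vec 1 = 0"
    and ev: "\<And>x. det (mat x - A) = (\<Prod>k<CARD('i). x - lam k)"
    and lam: "lam 0 = 0" "0 < lam 1" "\<And>k. 1 \<le> k \<Longrightarrow> k < CARD('i) \<Longrightarrow> lam 1 \<le> lam k"
    using A by (auto simp: coupling_matrix_def eigenvalue_list_def)
  obtain i j :: 'i where ij: "i \<noteq> j"
    using card by (metis card_1_singletonE One_nat_def UNIV_I Suc_1 card_le_Suc0_iff_eq finite not_less_eq_eq)
  have "\<exists>x::real^'i. x \<noteq> 0 \<and> x \<bullet> vec 1 = 0"
  proof (intro exI conjI)
    have "(axis i 1 - axis j 1 :: real^'i) $ i = 1" using ij by (simp add: axis_def)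
    then show "(axis i 1 - axis j 1 :: real^'i) \<noteq> 0" by (metis zero_index zero_neq_one)
    show "(axis i 1 - axis j 1 :: real^'i) \<bullet> vec 1 = 0"
      by (simp add: inner_diff_left inner_axis')
  qed
  then obtain \<mu> u where u: "u \<noteq> 0" "u \<bullet> vec 1 = 0" "A *v u = \<mu> *\<^sub>R u"
    and min: "\<And>x. x \<bullet> vec 1 = 0 \<Longrightarrow> \<mu> * (x \<bullet> x) \<le> x \<bullet> (A *v x)"
    using constrained_minimiser_eigenvector[OF sym one] by metis
  have "(mat \<mu> - A) *v u = 0"
    using u(3) by (simp add: char_matrix_vector_mult)
  then have "det (mat \<mu> - A) = 0"
    using u(1) by (metis invertible_det_nz invertible_def matrix_left_invertible_ker)
  then obtain k where k: "k < CARD('i)" "\<mu> = lam k" using ev[of \<mu>] by auto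
  \<comment> \<open>Otherwise \<^term>\<open>u\<close> would be a second kernel vector, although \<^term>\<open>0\<close> is a simple root.\<close>
  have "\<mu> \<noteq> 0"
  proof
    assume "\<mu> = 0"
    have "\<exists>i j. u $ i \<noteq> u $ j"
    proof (rule ccontr)
      assume "\<not> ?thesis"
      then have "u = u $ i *\<^sub>R vec 1" by (simp add: vec_eq_iff)
      with u(1,2) show False
        by (metis inner_eq_zero_iff inner_scaleR_right scaleR_eq_0_iff mult_eq_0_iff)
    qed
    then obtain i j where uij: "u $ i \<noteq> u $ j" by blast
    have "A *v u = 0" using u(3) \<open>\<mu> = 0\<close> by simp
    from charpoly_double_root[OF sym one this uij] obtain h
      where h: "continuous_on UNIV h" "\<And>x. det (mat x - A) = x\<^sup>2 * h x" by blast
    define p where "p = (\<lambda>x. \<Prod>k=1..<CARD('i). x - lam k)"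
    have split: "{..<CARD('i)} = insert 0 {1..<CARD('i)}" using card by auto
    have "x\<^sup>2 * h x = x * p x" for x
      using ev[of x] h(2)[of x] lam(1) by (simp add: split p_def)
    then have eq: "x * h x = p x" if "x \<noteq> 0" for x
      using that by (simp add: power2_eq_square) (metis mult.assoc mult_cancel_left)
    have "((\<lambda>x. x * h x) \<longlongrightarrow> 0 * h 0) (at 0)"
      using h(1) by (intro tendsto_intros) (auto simp: continuous_on_def)
    then have "(p \<longlongrightarrow> 0) (at 0)"
      using Lim_transform_eventually[of "\<lambda>x. x * h x" "0 * h 0" "at 0" p]
      by (simp add: eventually_at_filter eq)
    moreover have "(p \<longlongrightarrow> p 0) (at 0)"
      unfolding p_def by (intro tendsto_intros)
    ultimately have "p 0 = 0" using tendsto_unique[of "at (0::real)"] by (metis trivial_limit_at)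
    then obtain k where "1 \<le> k" "k < CARD('i)" "lam k = 0" by (auto simp: p_def)
    then show False using lam by fastforce
  qed
  then have "lam 1 \<le> \<mu>" using k lam by (cases "k = 0") auto
  then show ?thesis using min[OF x] by (meson inner_ge_zero mult_right_mono order_trans)
qed


section \<open>The adapted inner product and the cone form\<close>

text \<open>The average of the entries of a vector.\<close>

definition mean :: "real ^ 'i::finite \<Rightarrow> real" where
  "mean u = (u \<bullet> 1) / real CARD('i)"

text \<open>The component of a vector orthogonal to the constant vectors.\<close>

definition centre :: "real ^ 'i::finite \<Rightarrow> real ^ 'i" where
  "centre u = u - mean u *\<^sub>R 1"

lemma vec_eq_scaleR_one: "(vec c :: real ^ 'i) = c *\<^sub>R 1"
  by (simp add: vec_eq_iff)

lemma inner_vec_one [simp]: "(1 :: real ^ 'i::finite) \<bullet> 1 = real CARD('i)"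
  by (simp add: inner_vec_def one_vec_def)

lemma mean_simps [simp]:
  "mean (u + v) = mean u + mean v" "mean (u - v) = mean u - mean v" "mean (c *\<^sub>R u) = c * mean u"
  "mean (- u) = - mean u" "mean (1 :: real ^ 'i::finite) = 1" "mean (0 :: real ^ 'i) = 0"
  by (simp_all add: mean_def inner_add_left inner_diff_left add_divide_distrib diff_divide_distrib)

lemma centre_simps [simp]:
  "centre (u + v) = centre u + centre v" "centre (u - v) = centre u - centre v"
  "centre (c *\<^sub>R u) = c *\<^sub>R centre u" "centre (- u) = - centre u"
  by (simp_all add: centre_def algebra_simps)

lemma inner_vec_one_eq_mean: "u \<bullet> 1 = real CARD('i) * mean (u :: real ^ 'i::finite)"
  by (simp add: mean_def)

lemma centre_inner_one [simp]: "centre u \<bullet> 1 = 0" "1 \<bullet> centre u = 0"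
  by (simp_all add: centre_def inner_diff_left inner_diff_right inner_vec_one_eq_mean inner_commute[of "1"])

lemma inner_centre_mean:
  "(u :: real ^ 'i::finite) \<bullet> v = centre u \<bullet> centre v + real CARD('i) * mean u * mean v"
proof -
  have "u \<bullet> v = (centre u + mean u *\<^sub>R 1) \<bullet> (centre v + mean v *\<^sub>R 1)"
    by (simp add: centre_def)
  also have "\<dots> = centre u \<bullet> centre v + real CARD('i) * mean u * mean v"
    by (simp add: inner_add_left inner_add_right)
  finally show ?thesis .
qed

lemma centre_norm_le: "centre u \<bullet> centre u \<le> u \<bullet> u"
  using inner_centre_mean[of u u] by (simp add: mult.assoc)

text \<open>The coordinate of \<^term>\<open>projP \<alpha> Y\<close> with respect to \<^term>\<open>eta0\<close>.\<close>

definition hcoord :: "real \<Rightarrow> 'i::finite phase \<Rightarrow> real" where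
  "hcoord \<alpha> Y = mean (fst Y) + mean (snd Y) / \<alpha>"

lemma hcoord_simps [simp]:
  "hcoord \<alpha> (X + Y) = hcoord \<alpha> X + hcoord \<alpha> Y" "hcoord \<alpha> (X - Y) = hcoord \<alpha> X - hcoord \<alpha> Y"
  "hcoord \<alpha> (c *\<^sub>R Y) = c * hcoord \<alpha> Y" "hcoord \<alpha> (eta0 :: 'i::finite phase) = 1"
  "hcoord \<alpha> (0 :: 'i phase) = 0" "hcoord \<alpha> (- Y) = - hcoord \<alpha> Y"
  by (simp_all add: hcoord_def eta0_def add_divide_distrib diff_divide_distrib distrib_left)

lemma bounded_linear_hcoord: "bounded_linear (hcoord \<alpha>)"
  by (intro linear_conv_bounded_linear[THEN iffD1] linearI) auto

lemma E1_eq: "E1 = range (\<lambda>s. s *\<^sub>R eta0)"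
  by (simp add: E1_def span_singleton)

lemma eta0_in_E1 [simp]: "s *\<^sub>R eta0 \<in> E1"
  unfolding E1_eq by (rule rangeI)

lemma E1_hcoord: "p \<in> E1 \<Longrightarrow> p = hcoord \<alpha> p *\<^sub>R eta0"
  by (auto simp: E1_eq)

text \<open>The subspaces and projections of the decomposition, described through means of the two
  components.\<close>

lemma E11_eq: "\<alpha> > 0 \<Longrightarrow> E11 \<alpha> = {(s *\<^sub>R 1, t *\<^sub>R 1) | s t. True}"
proof (intro equalityI subsetI)
  fix Y :: "'i::finite phase" assume \<alpha>: "\<alpha> > 0" and "Y \<in> {(s *\<^sub>R 1, t *\<^sub>R 1) | s t. True}"
  then obtain s t where Y: "Y = (s *\<^sub>R 1, t *\<^sub>R 1)" by blast
  have "Y = (s + t / \<alpha>) *\<^sub>R eta0 + (- t / \<alpha>) *\<^sub>R eta_m1 \<alpha>"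
    using \<alpha> by (simp add: Y eta0_def eta_m1_def vec_eq_iff field_simps)
  then show "Y \<in> E11 \<alpha>" unfolding E11_def E1_def E_m1_def span_singleton by blast
next
  fix Y :: "'i::finite phase" assume "Y \<in> E11 \<alpha>"
  then obtain s t where "Y = s *\<^sub>R eta0 + t *\<^sub>R eta_m1 \<alpha>"
    unfolding E11_def E1_def E_m1_def span_singleton by blast
  then have "Y = ((s + t) *\<^sub>R 1, (- \<alpha> * t) *\<^sub>R 1)"
    by (simp add: eta0_def eta_m1_def vec_eq_iff algebra_simps)
  then show "Y \<in> {(s *\<^sub>R 1, t *\<^sub>R 1) | s t. True}" by blast
qed

lemma E22_eq: "\<alpha> > 0 \<Longrightarrow> E22 \<alpha> = {Y. mean (fst Y) = 0 \<and> mean (snd Y) = 0}"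
proof (intro equalityI subsetI)
  fix Y :: "'i::finite phase" assume \<alpha>: "\<alpha> > 0" and Y: "Y \<in> E22 \<alpha>"
  have "X \<bullet> Y = 0" if "X \<in> E11 \<alpha>" for X
    using Y that by (auto simp: E22_def orthogonal_comp_def orthogonal_def)
  from this[of "(1 *\<^sub>R 1, 0 *\<^sub>R 1)"] this[of "(0 *\<^sub>R 1, 1 *\<^sub>R 1)"]
  show "Y \<in> {Y. mean (fst Y) = 0 \<and> mean (snd Y) = 0}"
    unfolding E11_eq[OF \<alpha>] by (simp add: inner_prod_def mean_def inner_commute) (metis scaleR_one scaleR_zero_left)
next
  fix Y :: "'i::finite phase" assume "\<alpha> > 0" "Y \<in> {Y. mean (fst Y) = 0 \<and> mean (snd Y) = 0}"
  then show "Y \<in> E22 \<alpha>"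
    by (auto simp: E22_def orthogonal_comp_def orthogonal_def E11_eq inner_prod_def mean_def
        inner_commute[of "1"])
qed

lemma E2_eq: "\<alpha> > 0 \<Longrightarrow> E2 \<alpha> = {Y. hcoord \<alpha> Y = 0}"
proof (intro equalityI subsetI)
  fix Y :: "'i::finite phase" assume \<alpha>: "\<alpha> > 0" and Y: "Y \<in> {Y. hcoord \<alpha> Y = 0}"
  define k where "k = mean (fst Y)"
  have "mean (snd Y) = - \<alpha> * k" using Y \<alpha> by (simp add: hcoord_def k_def field_simps)
  then have "Y - k *\<^sub>R eta_m1 \<alpha> \<in> E22 \<alpha>"
    using \<alpha> by (simp add: E22_eq eta_m1_def k_def vec_eq_scaleR_one)
  moreover have "k *\<^sub>R eta_m1 \<alpha> \<in> (E_m1 \<alpha> :: 'i phase set)" by (auto simp: E_m1_def span_singleton)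
  ultimately show "Y \<in> E2 \<alpha>" unfolding E2_def
    by (smt (verit) add_diff_cancel_left' add_diff_eq mem_Collect_eq)
next
  fix Y :: "'i::finite phase" assume \<alpha>: "\<alpha> > 0" and "Y \<in> E2 \<alpha>"
  then obtain k y where "Y = k *\<^sub>R eta_m1 \<alpha> + y" "y \<in> E22 \<alpha>"
    unfolding E2_def E_m1_def span_singleton by blast
  moreover have "hcoord \<alpha> (eta_m1 \<alpha> :: 'i phase) = 0"
    using \<alpha> by (simp add: hcoord_def eta_m1_def vec_eq_scaleR_one)
  moreover have "hcoord \<alpha> y = 0" using \<open>y \<in> E22 \<alpha>\<close> \<alpha> by (simp add: E22_eq hcoord_def)
  ultimately show "Y \<in> {Y. hcoord \<alpha> Y = 0}" by simp
qed

lemma projP_eq: "\<alpha> > 0 \<Longrightarrow> projP \<alpha> Y = hcoord \<alpha> Y *\<^sub>R eta0"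
  unfolding projP_def
  by (rule the_equality) (auto simp: E2_eq E1_eq)

lemma projQ_eq: "\<alpha> > 0 \<Longrightarrow> projQ \<alpha> Y = Y - hcoord \<alpha> Y *\<^sub>R eta0"
  by (simp add: projQ_def projP_eq)

lemma comp11_eq: "\<alpha> > 0 \<Longrightarrow> comp11 \<alpha> Y = (mean (fst Y) *\<^sub>R 1, mean (snd Y) *\<^sub>R 1)"
  unfolding comp11_def
  by (rule the_equality) (auto simp: E22_eq E11_eq)

lemma comp22_eq: "\<alpha> > 0 \<Longrightarrow> comp22 \<alpha> Y = (centre (fst Y), centre (snd Y))"
  by (simp add: comp22_def comp11_eq centre_def prod_eq_iff)

text \<open>The data of the linear damped system; \<^term>\<open>lam1\<close> is a lower bound for the coupling on
  the vectors of mean zero.\<close>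

locale phase_norm =
  fixes A :: "real ^ 'i::finite ^ 'i" and K \<alpha> \<delta> lam1 :: real
  assumes A_sym: "(A *v x) \<bullet> y = x \<bullet> (A *v y)"
    and A_one: "A *v 1 = 0"
    and gap: "x \<bullet> 1 = 0 \<Longrightarrow> lam1 * (x \<bullet> x) \<le> x \<bullet> (A *v x)"
    and lam1_pos: "lam1 > 0"
    and pos: "\<alpha> > 0" "K > 0" "0 < \<delta>" "\<delta> \<le> 1"
begin

abbreviation B :: "'i phase \<Rightarrow> 'i phase \<Rightarrow> real" where
  "B \<equiv> innerE A K \<alpha> \<delta> lam1"

abbreviation nrm :: "'i phase \<Rightarrow> real" where
  "nrm \<equiv> normE A K \<alpha> \<delta> lam1"

abbreviation P :: "'i phase \<Rightarrow> 'i phase" where "P \<equiv> projP \<alpha>"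
abbreviation Q :: "'i phase \<Rightarrow> 'i phase" where "Q \<equiv> projQ \<alpha>"

text \<open>The sheared velocity occurring in the inner product.\<close>

definition shear :: "'i phase \<Rightarrow> real ^ 'i" where
  "shear Y = (\<alpha> / 2) *\<^sub>R fst Y + snd Y"

lemma A_centre: "A *v centre x = A *v x"
  by (simp add: centre_def matrix_vector_mult_diff_distrib matrix_vector_mult_scaleR A_one)

lemma mean_A: "mean (A *v x) = 0"
  by (simp add: mean_def A_sym A_one)

text \<open>Both component forms are one formula on the whole phase space, in which the splitting is
  visible only through the centred first components.\<close>

lemma B_eq:
  "B X Y = K * ((A *v fst X) \<bullet> fst Y) + \<alpha>\<^sup>2 / 4 * (fst X \<bullet> fst Y)
     - \<delta> * K * lam1 * (centre (fst X) \<bullet> centre (fst Y)) + shear X \<bullet> shear Y"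
proof -
  have 1: "(A *v u) \<bullet> v = (A *v u) \<bullet> centre v" for u v
    by (metis A_sym A_centre)
  have sh: "shear X \<bullet> shear Y = ((\<alpha> / 2) *\<^sub>R centre (fst X) + centre (snd X)) \<bullet> ((\<alpha> / 2) *\<^sub>R centre (fst Y) + centre (snd Y))
      + real CARD('i) * (\<alpha> / 2 * mean (fst X) + mean (snd X)) * (\<alpha> / 2 * mean (fst Y) + mean (snd Y))"
    unfolding shear_def by (subst inner_centre_mean) simp
  show ?thesis
    unfolding innerE_def form11_def form22_def comp11_eq[OF pos(1)] comp22_eq[OF pos(1)] sh
      1[of "fst X" "fst Y"] inner_centre_mean[of "fst X" "fst Y"] fst_conv snd_conv A_centre
      scaleR_scaleR[symmetric] scaleR_left_distrib[symmetric]
    by (simp add: algebra_simps)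
qed

lemma shear_simps [simp]:
  "shear (X + Y) = shear X + shear Y" "shear (c *\<^sub>R X) = c *\<^sub>R shear X"
  by (simp_all add: shear_def algebra_simps)

lemma bounded_bilinear_B: "bounded_bilinear B"
  unfolding bilinear_conv_bounded_bilinear[symmetric] bilinear_def
  by (intro conjI allI linearI)
     (simp_all add: B_eq inner_add_left inner_add_right matrix_vector_right_distrib
       matrix_vector_mult_scaleR algebra_simps)

sublocale B: bounded_bilinear B
  by (rule bounded_bilinear_B)

lemma B_sym: "B X Y = B Y X"
  unfolding B_eq by (metis A_sym inner_commute)

text \<open>Coercivity: \<^term>\<open>\<delta> \<le> 1\<close> and the spectral gap make the coupling term absorb the negative
  one.\<close>

lemma B_lower: "\<alpha>\<^sup>2 / 4 * (fst Y \<bullet> fst Y) + shear Y \<bullet> shear Y \<le> B Y Y"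
proof -
  define c where "c = centre (fst Y) \<bullet> centre (fst Y)"
  have "lam1 * c \<le> centre (fst Y) \<bullet> (A *v centre (fst Y))"
    unfolding c_def by (rule gap) simp
  also have "\<dots> = (A *v fst Y) \<bullet> fst Y"
    by (metis A_sym A_centre)
  finally have "K * (lam1 * c) \<le> K * ((A *v fst Y) \<bullet> fst Y)"
    using pos by simp
  moreover have "\<delta> * (K * lam1 * c) \<le> 1 * (K * lam1 * c)"
    using pos lam1_pos by (intro mult_right_mono) (auto simp: c_def)
  ultimately show ?thesis unfolding B_eq c_def[symmetric] by (simp add: mult_ac)
qed

lemma norm_le_B: "(norm Y)\<^sup>2 \<le> (4 / \<alpha>\<^sup>2 + 4) * B Y Y"
proof -
  define u w where "u = fst Y" and "w = shear Y"
  have v: "snd Y = w - (\<alpha> / 2) *\<^sub>R u" by (simp add: w_def u_def shear_def)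
  have "0 \<le> (norm (w + (\<alpha> / 2) *\<^sub>R u))\<^sup>2" by simp
  then have "snd Y \<bullet> snd Y \<le> 2 * (w \<bullet> w) + \<alpha>\<^sup>2 / 2 * (u \<bullet> u)"
    unfolding v power2_norm_eq_inner
    by (simp add: inner_add_left inner_add_right inner_diff_left inner_diff_right power2_eq_square
        inner_commute algebra_simps)
  then have "(norm Y)\<^sup>2 \<le> (u \<bullet> u) + 2 * (w \<bullet> w) + \<alpha>\<^sup>2 / 2 * (u \<bullet> u)"
    by (simp add: power2_norm_eq_inner inner_prod_def u_def)
  also have "\<dots> \<le> (4 / \<alpha>\<^sup>2 + 4) * (\<alpha>\<^sup>2 / 4 * (u \<bullet> u) + w \<bullet> w)"
  proof -
    have "(4 / \<alpha>\<^sup>2 + 4) * (\<alpha>\<^sup>2 / 4 * (u \<bullet> u) + w \<bullet> w)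
      = u \<bullet> u + \<alpha>\<^sup>2 * (u \<bullet> u) + 4 / \<alpha>\<^sup>2 * (w \<bullet> w) + 4 * (w \<bullet> w)"
      using pos by (simp add: field_simps)
    moreover have "0 \<le> 4 / \<alpha>\<^sup>2 * (w \<bullet> w)" "0 \<le> \<alpha>\<^sup>2 * (u \<bullet> u)" "0 \<le> w \<bullet> w" by simp_all
    ultimately show ?thesis by (simp add: algebra_simps)
  qed
  also have "\<dots> \<le> (4 / \<alpha>\<^sup>2 + 4) * B Y Y"
    using B_lower[of Y] by (intro mult_left_mono) (simp_all add: u_def w_def)
  finally show ?thesis .
qed

lemma B_nonneg [simp]: "0 \<le> B Y Y"
  using B_lower[of Y] by (meson add_nonneg_nonneg divide_nonneg_nonneg inner_ge_zero mult_nonneg_nonneg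
      order_trans zero_le_numeral zero_le_power2)

lemma B_pos: "Y \<noteq> 0 \<Longrightarrow> 0 < B Y Y"
  using norm_le_B[of Y] by (metis B_nonneg antisym_conv2 mult_zero_right norm_le_zero_iff power2_less_eq_zero_iff)

lemma nrm_nonneg [simp]: "0 \<le> nrm Y"
  by (simp add: normE_def)

lemma nrm_sq: "(nrm Y)\<^sup>2 = B Y Y"
  by (simp add: normE_def)

lemma B_le_nrm: "B X Y \<le> nrm X * nrm Y"
proof (cases "X = 0 \<or> Y = 0")
  case True
  then show ?thesis by (auto simp: B.zero_left B.zero_right)
next
  case False
  define a b where "a = nrm X" and "b = nrm Y"
  have ab: "a > 0" "b > 0" using False B_pos by (auto simp: normE_def a_def b_def)
  have "0 \<le> B (b *\<^sub>R X - a *\<^sub>R Y) (b *\<^sub>R X - a *\<^sub>R Y)" by simp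
  also have "\<dots> = b\<^sup>2 * B X X - 2 * (a * b) * B X Y + a\<^sup>2 * B Y Y"
    by (simp add: B.diff_left B.diff_right B.scaleR_left B.scaleR_right B_sym[of Y X]
        power2_eq_square algebra_simps)
  also have "\<dots> = 2 * (a * b) * (a * b - B X Y)"
    by (simp add: a_def b_def nrm_sq[symmetric] power2_eq_square algebra_simps)
  finally have "0 \<le> a * b - B X Y" using mult_pos_pos[OF ab] by (simp add: zero_le_mult_iff)
  then show ?thesis by (simp add: a_def b_def)
qed

lemma nrm_triangle: "nrm (X + Y) \<le> nrm X + nrm Y"
proof (rule power2_le_imp_le)
  show "(nrm (X + Y))\<^sup>2 \<le> (nrm X + nrm Y)\<^sup>2"
    using B_le_nrm[of X Y]
    by (simp add: nrm_sq B.add_left B.add_right B_sym[of Y X] power2_sum)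
qed simp

lemma nrm_minus [simp]: "nrm (- X) = nrm X"
  by (simp add: normE_def B.minus_left B.minus_right)

lemma nrm_minus_commute: "nrm (X - Y) = nrm (Y - X)"
  by (metis minus_diff_eq nrm_minus)

lemma nrm_diff_triangle: "nrm (X - Z) \<le> nrm (X - Y) + nrm (Y - Z)"
  using nrm_triangle[of "X - Y" "Y - Z"] by simp

lemma nrm_diff_le: "nrm (X - Y) \<le> nrm X + nrm Y"
  using nrm_triangle[of X "- Y"] by simp

lemma continuous_nrm [continuous_intros]:
  "continuous_on S f \<Longrightarrow> continuous_on S (\<lambda>x. nrm (f x))"
  unfolding normE_def by (intro continuous_intros B.continuous_on)

lemma nrm_zero [simp]: "nrm 0 = 0"
  by (simp add: normE_def B.zero_left)

lemma P_eq: "P Y = hcoord \<alpha> Y *\<^sub>R eta0"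
  using pos by (simp add: projP_eq)

lemma Q_eq: "Q Y = Y - hcoord \<alpha> Y *\<^sub>R eta0"
  using pos by (simp add: projQ_eq)

lemma P_plus_Q: "P Y + Q Y = Y"
  by (simp add: P_eq Q_eq)

lemma bounded_linear_Q: "bounded_linear Q"
  unfolding Q_eq
  by (intro bounded_linear_sub bounded_linear_ident bounded_linear_scaleR_const bounded_linear_hcoord)

lemma PQ_diff: "P (X - Y) = P X - P Y" "Q (X - Y) = Q X - Q Y"
  by (simp_all add: P_eq Q_eq algebra_simps)

lemma hcoord_Q [simp]: "hcoord \<alpha> (Q Y) = 0"
  by (simp add: Q_eq)

text \<open>The neutral direction is orthogonal to \<^const>\<open>E2\<close> for the adapted inner product.\<close>

lemma B_eta0: "B eta0 Y = real CARD('i) * \<alpha>\<^sup>2 / 2 * hcoord \<alpha> Y"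
proof -
  have "B eta0 Y = \<alpha>\<^sup>2 / 4 * (1 \<bullet> fst Y) + (\<alpha> / 2) * (1 \<bullet> shear Y)"
    by (simp add: B_eq eta0_def shear_def A_one centre_def)
  also have "1 \<bullet> shear Y = (\<alpha> / 2) * (1 \<bullet> fst Y) + 1 \<bullet> snd Y"
    by (simp add: shear_def inner_add_right)
  finally have "B eta0 Y = real CARD('i) / 2 * (\<alpha>\<^sup>2 * mean (fst Y) + \<alpha> * mean (snd Y))"
    by (simp add: inner_vec_one_eq_mean inner_commute[of 1] power2_eq_square algebra_simps)
  also have "\<alpha>\<^sup>2 * mean (fst Y) + \<alpha> * mean (snd Y) = \<alpha>\<^sup>2 * hcoord \<alpha> Y"
    using pos by (simp add: hcoord_def power2_eq_square algebra_simps)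
  finally show ?thesis by simp
qed

lemma B_P_Q: "B (P X) (Q Y) = 0" "B (Q Y) (P X) = 0"
  by (simp_all add: P_eq B.scaleR_left B.scaleR_right B_eta0 B_sym[of _ eta0])

lemma pythagoras: "B Y Y = B (P Y) (P Y) + B (Q Y) (Q Y)"
  by (subst (1 2) P_plus_Q[of Y, symmetric]) (simp add: B.add_left B.add_right B_P_Q)

lemma nrm_Q_le: "nrm (Q Y) \<le> nrm Y"
  unfolding normE_def using pythagoras[of Y] by simp

text \<open>The linear part of the vector field.\<close>

definition gen :: "'i phase \<Rightarrow> 'i phase" where
  "gen Y = (snd Y, - (K *\<^sub>R (A *v fst Y)) - \<alpha> *\<^sub>R snd Y)"

lemma gen_diff: "gen (X - Y) = gen X - gen Y"
  by (simp add: gen_def matrix_vector_mult_diff_distrib algebra_simps)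

lemma gen_Q: "gen (Q Y) = gen Y"
  by (simp add: Q_eq gen_def eta0_def matrix_vector_mult_diff_distrib matrix_vector_mult_scaleR A_one)

lemma hcoord_gen [simp]: "hcoord \<alpha> (gen Y) = 0"
  using pos by (simp add: hcoord_def gen_def mean_A)

text \<open>On the complement of the neutral direction the linear part is dissipative for the adapted
  inner product. Besides a multiple of the form itself only mixed terms in
  \<^term>\<open>fst Y\<close> and \<^term>\<open>shear Y\<close> remain, and their mean part has the good sign.\<close>

lemma gen_dissipative:
  assumes h: "hcoord \<alpha> Y = 0"
  shows "B Y (gen Y) \<le> - (\<alpha> / 2 - \<bar>\<alpha> / 2 - \<delta> * K * lam1 / \<alpha>\<bar>) * B Y Y"
proof -
  define u w where "u = fst Y" and "w = shear Y"
  define \<mu> where "\<mu> = \<delta> * K * lam1"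
  define cu cw where "cu = centre u" and "cw = centre w"
  have v: "snd Y = w - (\<alpha> / 2) *\<^sub>R u" by (simp add: w_def u_def shear_def)
  have gw: "shear (gen Y) = - (\<alpha> / 2) *\<^sub>R snd Y - K *\<^sub>R (A *v u)"
    by (simp add: shear_def gen_def u_def vec_eq_iff)
  have "B Y (gen Y) = - (\<alpha> / 2) * B Y Y + \<alpha>\<^sup>2 / 2 * (u \<bullet> w) - \<mu> * (cu \<bullet> cw)"
    unfolding B_eq gw
    unfolding gen_def fst_conv v w_def[symmetric] u_def[symmetric] \<mu>_def[symmetric]
    by (simp add: inner_diff_left inner_diff_right inner_add_left inner_add_right cu_def cw_def
        A_sym inner_commute[of w u] inner_commute[of w "A *v u"] power2_eq_square algebra_simps)
  also have "u \<bullet> w = cu \<bullet> cw - \<alpha> / 2 * (real CARD('i) * (mean u)\<^sup>2)"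
  proof -
    have "mean w = - (\<alpha> / 2) * mean u"
      using h pos by (simp add: w_def shear_def u_def hcoord_def field_simps)
    then show ?thesis
      by (simp add: inner_centre_mean[of u w] cu_def cw_def power2_eq_square)
  qed
  finally have "B Y (gen Y) = - (\<alpha> / 2) * B Y Y + (\<alpha>\<^sup>2 / 2 - \<mu>) * (cu \<bullet> cw)
      - \<alpha>\<^sup>2 / 2 * (\<alpha> / 2 * (real CARD('i) * (mean u)\<^sup>2))"
    by (simp add: algebra_simps)
  also have "\<dots> \<le> - (\<alpha> / 2) * B Y Y + (\<alpha>\<^sup>2 / 2 - \<mu>) * (cu \<bullet> cw)"
    using pos by simp
  also have "\<dots> \<le> - (\<alpha> / 2) * B Y Y + \<bar>\<alpha>\<^sup>2 / 2 - \<mu>\<bar> * (B Y Y / \<alpha>)"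
  proof -
    have "\<alpha> * \<bar>cu \<bullet> cw\<bar> \<le> \<alpha> * (norm cu * norm cw)"
      using pos by (intro mult_left_mono Cauchy_Schwarz_ineq2) auto
    also have "\<dots> \<le> \<alpha>\<^sup>2 / 4 * (norm cu)\<^sup>2 + (norm cw)\<^sup>2"
      using sum_squares_bound[of "\<alpha> / 2 * norm cu" "norm cw"]
      by (simp add: power_mult_distrib power2_eq_square algebra_simps)
    also have "\<dots> \<le> \<alpha>\<^sup>2 / 4 * (u \<bullet> u) + w \<bullet> w"
      unfolding power2_norm_eq_inner cu_def cw_def
      by (intro add_mono mult_left_mono centre_norm_le) auto
    also have "\<dots> \<le> B Y Y" using B_lower[of Y] by (simp add: u_def w_def)
    finally have "\<bar>cu \<bullet> cw\<bar> \<le> B Y Y / \<alpha>" using pos by (simp add: field_simps)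
    then have "\<bar>\<alpha>\<^sup>2 / 2 - \<mu>\<bar> * \<bar>cu \<bullet> cw\<bar> \<le> \<bar>\<alpha>\<^sup>2 / 2 - \<mu>\<bar> * (B Y Y / \<alpha>)"
      by (intro mult_left_mono) auto
    then have "\<bar>(\<alpha>\<^sup>2 / 2 - \<mu>) * (cu \<bullet> cw)\<bar> \<le> \<bar>\<alpha>\<^sup>2 / 2 - \<mu>\<bar> * (B Y Y / \<alpha>)"
      by (simp only: abs_mult)
    then show ?thesis by linarith
  qed
  also have "\<dots> = - (\<alpha> / 2 - \<bar>\<alpha> / 2 - \<delta> * K * lam1 / \<alpha>\<bar>) * B Y Y"
  proof -
    have "\<bar>\<alpha>\<^sup>2 / 2 - \<mu>\<bar> = \<alpha> * \<bar>\<alpha> / 2 - \<mu> / \<alpha>\<bar>"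
    proof -
      have "\<alpha>\<^sup>2 / 2 - \<mu> = \<alpha> * (\<alpha> / 2 - \<mu> / \<alpha>)"
        using pos by (simp add: field_simps power2_eq_square)
      then show ?thesis using pos by (simp add: abs_mult)
    qed
    then show ?thesis using pos by (simp add: \<mu>_def algebra_simps)
  qed
  finally show ?thesis by simp
qed

text \<open>The indefinite form measuring how far a difference vector is from being horizontal: it is
  nonpositive exactly on the cone of the vectors whose component along \<^const>\<open>E2\<close> is at most
  as long as the one along \<^const>\<open>E1\<close>.\<close>

definition cone :: "'i phase \<Rightarrow> 'i phase \<Rightarrow> real" where
  "cone X Y = B (Q X) (Q Y) - B (P X) (P Y)"

lemma bounded_bilinear_cone: "bounded_bilinear cone"
  unfolding bilinear_conv_bounded_bilinear[symmetric] bilinear_def cone_def P_eq Q_eq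
  by (intro conjI allI linearI)
     (simp_all add: B.add_left B.add_right B.diff_left B.diff_right B.scaleR_left B.scaleR_right
       algebra_simps)

sublocale cone: bounded_bilinear cone
  by (rule bounded_bilinear_cone)

lemma cone_sym: "cone X Y = cone Y X"
  by (simp add: cone_def B_sym)

lemma cone_le: "cone Y Y \<le> (nrm (Q Y))\<^sup>2"
  by (simp add: cone_def nrm_sq)

text \<open>The decisive differential inequality. For \<^term>\<open>D' = gen D + G\<close> the form \<^term>\<open>cone D D\<close>
  has derivative \<^term>\<open>2 * cone D D'\<close>. The contribution of \<^term>\<open>G\<close> is at most
  \<^term>\<open>L * B D D\<close>, since \<^term>\<open>Q D - P D\<close> is as long as \<^term>\<open>D\<close>, and the linear part acts on
  \<^term>\<open>Q D\<close> only.\<close>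

lemma cone_gen_le:
  assumes G: "nrm G \<le> L * nrm D"
    and aL: "2 * L \<le> \<alpha> / 2 - \<bar>\<alpha> / 2 - \<delta> * K * lam1 / \<alpha>\<bar>" and "0 \<le> L"
  shows "2 * cone D (gen D + G) \<le>
    - (2 * (\<alpha> / 2 - \<bar>\<alpha> / 2 - \<delta> * K * lam1 / \<alpha>\<bar>) - 2 * L) * cone D D"
proof -
  define a where "a = \<alpha> / 2 - \<bar>\<alpha> / 2 - \<delta> * K * lam1 / \<alpha>\<bar>"
  define p q where "p = B (P D) (P D)" and "q = B (Q D) (Q D)"
  have split: "cone D (gen D + G) = B (Q D) (gen (Q D)) + (B (Q D) (Q G) - B (P D) (P G))"
    by (simp add: cone_def Q_eq P_eq B.add_right B.diff_right B.scaleR_right gen_Q[unfolded Q_eq] algebra_simps)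
  have "B (Q D) (Q G) - B (P D) (P G) = B (Q D - P D) G"
    by (subst (3) P_plus_Q[of G, symmetric]) (simp add: B.add_right B.diff_left B_P_Q)
  also have "\<dots> \<le> nrm (Q D - P D) * nrm G" by (rule B_le_nrm)
  also have "nrm (Q D - P D) = nrm D"
    unfolding normE_def pythagoras[of D]
    by (simp add: B.diff_left B.diff_right B_P_Q add.commute)
  also have "nrm D * nrm G \<le> nrm D * (L * nrm D)" by (intro mult_left_mono G) simp
  also have "\<dots> = L * (p + q)"
    using pythagoras[of D] nrm_sq[of D] by (simp add: p_def q_def power2_eq_square)
  finally have 1: "B (Q D) (Q G) - B (P D) (P G) \<le> L * (p + q)" .
  have 2: "B (Q D) (gen (Q D)) \<le> - a * q"
    unfolding a_def q_def by (rule gen_dissipative) simp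
  have "0 \<le> (a - 2 * L) * p" using aL by (simp add: a_def p_def)
  then have "- a * q + L * (p + q) \<le> - (a - L) * (q - p)" by (simp add: algebra_simps)
  then have "cone D (gen D + G) \<le> - (a - L) * (q - p)"
    using 1 2 unfolding split by linarith
  then have "2 * cone D (gen D + G) \<le> 2 * (- (a - L) * (q - p))"
    by (intro mult_left_mono) auto
  also have "\<dots> = - (2 * a - 2 * L) * cone D D"
    by (simp add: cone_def p_def q_def algebra_simps)
  finally show ?thesis unfolding a_def .
qed

end


section \<open>Energy estimates along solutions\<close>

lemma gronwall_decay:
  fixes h h' :: "real \<Rightarrow> real"
  assumes T: "0 \<le> T"
    and der: "\<And>t. t \<in> {0..T} \<Longrightarrow> (h has_vector_derivative h' t) (at t within {0..T})"
    and le: "\<And>t. t \<in> {0..T} \<Longrightarrow> h' t \<le> - m * h t"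
  shows "h T \<le> exp (- m * T) * h 0"
proof -
  have cont: "continuous_on {0..T} h"
    unfolding continuous_on_eq_continuous_within by (intro ballI has_vector_derivative_continuous[OF der])
  have "exp (m * T) * h T \<le> exp (m * 0) * h 0"
  proof (rule DERIV_nonpos_imp_decreasing_open[OF T])
    fix t assume t: "0 < t" "t < T"
    have "(h has_real_derivative h' t) (at t)"
      using der[of t] t
      by (simp add: has_real_derivative_iff_has_vector_derivative at_within_Icc_at)
    then have "((\<lambda>t. exp (m * t) * h t) has_real_derivative exp (m * t) * (h' t + m * h t)) (at t)"
      by (auto intro!: derivative_eq_intros simp: algebra_simps)
    moreover have "exp (m * t) * (h' t + m * h t) \<le> 0"
      using le[of t] t by (simp add: mult_le_0_iff)
    ultimately show "\<exists>y. ((\<lambda>t. exp (m * t) * h t) has_real_derivative y) (at t) \<and> y \<le> 0" by blast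
  qed (intro continuous_intros cont)
  then show ?thesis by (simp add: exp_minus field_simps)
qed

text \<open>The damped system with its periodic nonlinearity \<^term>\<open>g\<close> and constant force \<^term>\<open>f\<close>.
  The last assumption is the requirement that the dissipation rate exceed four times the
  Lipschitz constant.\<close>

locale damped_system = phase_norm A K \<alpha> \<delta> lam1
  for A :: "real ^ 'i::finite ^ 'i" and K \<alpha> \<delta> lam1 +
  fixes \<beta> :: real and f :: "real ^ 'i" and g :: "real \<Rightarrow> real" and c1 c2 M1 \<kappa> :: real
  assumes g_lipschitz: "\<bar>g x - g y\<bar> \<le> c2 * \<bar>x - y\<bar>" and c2: "0 \<le> c2"
    and g_bound: "\<bar>g x\<bar> \<le> c1" and g_periodic: "g (x + \<kappa>) = g x" and kappa: "\<kappa> > 0"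
    and M1: "M1 > 0" "nrm Y \<le> M1 * norm Y"
    and rate_gap: "4 * (2 * c2 * \<bar>\<beta>\<bar> / \<alpha>) < \<alpha> / 2 - \<bar>\<alpha> / 2 - \<delta> * K * lam1 / \<alpha>\<bar>"
begin

text \<open>The dissipation rate of the linear part, the Lipschitz constant of the nonlinearity, and
  the coefficients of the bound for the inhomogeneous term (all in the adapted norm).\<close>

definition "rate = \<alpha> / 2 - \<bar>\<alpha> / 2 - \<delta> * K * lam1 / \<alpha>\<bar>"

definition "Lip = 2 * c2 * \<bar>\<beta>\<bar> / \<alpha>"

definition "a1 = M1 * sqrt (3 * \<alpha>\<^sup>2 - 6 * \<alpha> + 4)"

definition "a2 = M1 * sqrt (3 * (norm f)\<^sup>2 + 3 * \<beta>\<^sup>2 * c1\<^sup>2 * real CARD('i))"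

abbreviation vf :: "real ^ 'i \<Rightarrow> 'i phase \<Rightarrow> 'i phase" where
  "vf \<equiv> vfield A K \<alpha> \<beta> f g"

lemma Lip_nonneg: "0 \<le> Lip" and rate_Lip: "4 * Lip < rate" and rate_pos: "0 < rate"
proof -
  show 1: "0 \<le> Lip" using c2 pos by (simp add: Lip_def)
  show 2: "4 * Lip < rate" using rate_gap by (simp add: Lip_def rate_def)
  show "0 < rate" using 1 2 by simp
qed

lemma sqrt_arg_nonneg: "0 \<le> 3 * \<alpha>\<^sup>2 - 6 * \<alpha> + 4"
proof -
  have "0 \<le> 3 * (\<alpha> - 1)\<^sup>2 + 1" by simp
  then show ?thesis by (simp add: power2_eq_square algebra_simps)
qed

lemma a1_nonneg: "0 \<le> a1" and a2_nonneg: "0 \<le> a2"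
  using M1(1) sqrt_arg_nonneg by (simp_all add: a1_def a2_def)

text \<open>The nonlinearity acts on the velocity only.\<close>

definition nonlin :: "real ^ 'i \<Rightarrow> 'i phase" where
  "nonlin u = (0, - (\<beta> *\<^sub>R (\<chi> j. g (u $ j))))"

lemma vf_eq: "vf z Y = gen Y + (z, f - \<beta> *\<^sub>R (\<chi> j. g (fst Y $ j)) + (1 - \<alpha>) *\<^sub>R z)"
  by (simp add: vfield_def gen_def Let_def algebra_simps)

lemma vf_diff: "vf z X - vf z Y = gen (X - Y) + (nonlin (fst X) - nonlin (fst Y))"
  by (simp add: vf_eq gen_diff nonlin_def)

lemma g_field_lipschitz: "norm ((\<chi> j. g (u $ j)) - (\<chi> j. g (v $ j)) :: real ^ 'i) \<le> c2 * norm (u - v)"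
proof -
  have "norm ((\<chi> j. g (u $ j)) - (\<chi> j. g (v $ j)) :: real ^ 'i) \<le> norm (c2 *\<^sub>R (u - v))"
    by (rule norm_le_componentwise_cart) (use g_lipschitz c2 in \<open>simp add: abs_mult\<close>)
  then show ?thesis using c2 by simp
qed

lemma norm_nonlin_diff: "norm (nonlin u - nonlin v) \<le> \<bar>\<beta>\<bar> * c2 * norm (u - v)"
proof -
  have "norm (nonlin u - nonlin v) = \<bar>\<beta>\<bar> * norm ((\<chi> j. g (u $ j)) - (\<chi> j. g (v $ j)) :: real ^ 'i)"
    by (simp add: nonlin_def norm_Pair norm_minus_commute flip: scaleR_diff_right)
  also have "\<dots> \<le> \<bar>\<beta>\<bar> * (c2 * norm (u - v))"
    by (intro mult_left_mono g_field_lipschitz) simp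
  finally show ?thesis by (simp add: mult.assoc)
qed

lemma nrm_velocity: "nrm (0, w) = norm w"
  by (simp add: normE_def B_eq shear_def centre_def norm_eq_sqrt_inner)

lemma norm_fst_le: "\<alpha> / 2 * norm (fst Y) \<le> nrm Y"
proof (rule power2_le_imp_le)
  have "\<alpha>\<^sup>2 / 4 * (fst Y \<bullet> fst Y) \<le> B Y Y" using B_lower[of Y] inner_ge_zero[of "shear Y"] by linarith
  then show "(\<alpha> / 2 * norm (fst Y))\<^sup>2 \<le> (nrm Y)\<^sup>2"
    by (simp add: nrm_sq power_mult_distrib power2_norm_eq_inner power_divide)
qed simp

lemma nrm_nonlin_diff: "nrm (nonlin (fst X) - nonlin (fst Y)) \<le> Lip * nrm (X - Y)"
proof -
  have "nrm (nonlin (fst X) - nonlin (fst Y)) = norm (nonlin (fst X) - nonlin (fst Y))"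
    by (simp add: nonlin_def nrm_velocity norm_Pair)
  also have "\<dots> \<le> \<bar>\<beta>\<bar> * c2 * norm (fst (X - Y))" using norm_nonlin_diff by simp
  also have "\<dots> \<le> \<bar>\<beta>\<bar> * c2 * (2 / \<alpha> * nrm (X - Y))"
    using norm_fst_le[of "X - Y"] pos c2 by (intro mult_left_mono) (simp_all add: field_simps)
  finally show ?thesis by (simp add: Lip_def mult_ac)
qed

text \<open>The bound of the inhomogeneous term; the nonlinearity enters through its supremum only.\<close>

lemma nrm_forcing:
  "nrm (z, f - \<beta> *\<^sub>R (\<chi> j. g (u $ j)) + (1 - \<alpha>) *\<^sub>R z) \<le> a1 * norm z + a2"
proof -
  define G :: "real ^ 'i" where "G = (\<chi> j. g (u $ j))"
  have "norm G ^ 2 = (\<Sum>j\<in>UNIV. (g (u $ j))\<^sup>2)"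
    by (simp add: norm_vec_def L2_set_def G_def sum_nonneg)
  also have "\<dots> \<le> (\<Sum>j\<in>(UNIV :: 'i set). c1\<^sup>2)"
    using g_bound by (intro sum_mono) (metis abs_ge_zero power2_abs power_mono)
  finally have G: "(norm G)\<^sup>2 \<le> c1\<^sup>2 * real CARD('i)" by (simp add: mult.commute)
  have three: "(x + y + w)\<^sup>2 \<le> 3 * x\<^sup>2 + 3 * y\<^sup>2 + 3 * w\<^sup>2" for x y w :: real
    using sum_squares_bound[of x y] sum_squares_bound[of x w] sum_squares_bound[of y w]
    by (simp add: power2_eq_square algebra_simps)
  have "norm (f - \<beta> *\<^sub>R G + (1 - \<alpha>) *\<^sub>R z) \<le> norm f + \<bar>\<beta>\<bar> * norm G + \<bar>1 - \<alpha>\<bar> * norm z"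
    using norm_triangle_ineq[of "f - \<beta> *\<^sub>R G" "(1 - \<alpha>) *\<^sub>R z"] norm_triangle_ineq4[of f "\<beta> *\<^sub>R G"]
    by simp
  then have "(norm (f - \<beta> *\<^sub>R G + (1 - \<alpha>) *\<^sub>R z))\<^sup>2 \<le> (norm f + \<bar>\<beta>\<bar> * norm G + \<bar>1 - \<alpha>\<bar> * norm z)\<^sup>2"
    by (intro power_mono) auto
  also have "\<dots> \<le> 3 * (norm f)\<^sup>2 + 3 * (\<beta>\<^sup>2 * (norm G)\<^sup>2) + 3 * ((1 - \<alpha>)\<^sup>2 * (norm z)\<^sup>2)"
    using three[of "norm f" "\<bar>\<beta>\<bar> * norm G" "\<bar>1 - \<alpha>\<bar> * norm z"] by (simp add: power_mult_distrib)
  also have "\<dots> \<le> 3 * (norm f)\<^sup>2 + 3 * (\<beta>\<^sup>2 * (c1\<^sup>2 * real CARD('i))) + 3 * ((1 - \<alpha>)\<^sup>2 * (norm z)\<^sup>2)"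
    using G by (intro add_mono mult_left_mono order_refl) auto
  finally have "(norm z)\<^sup>2 + (norm (f - \<beta> *\<^sub>R G + (1 - \<alpha>) *\<^sub>R z))\<^sup>2
      \<le> (3 * \<alpha>\<^sup>2 - 6 * \<alpha> + 4) * (norm z)\<^sup>2 + (3 * (norm f)\<^sup>2 + 3 * \<beta>\<^sup>2 * c1\<^sup>2 * real CARD('i))"
    by (simp add: power2_eq_square algebra_simps)
  then have "norm (z, f - \<beta> *\<^sub>R G + (1 - \<alpha>) *\<^sub>R z)
      \<le> sqrt ((3 * \<alpha>\<^sup>2 - 6 * \<alpha> + 4) * (norm z)\<^sup>2 + (3 * (norm f)\<^sup>2 + 3 * \<beta>\<^sup>2 * c1\<^sup>2 * real CARD('i)))"
    unfolding norm_Pair by (rule real_sqrt_le_mono)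
  also have "\<dots> \<le> sqrt ((3 * \<alpha>\<^sup>2 - 6 * \<alpha> + 4) * (norm z)\<^sup>2) + sqrt (3 * (norm f)\<^sup>2 + 3 * \<beta>\<^sup>2 * c1\<^sup>2 * real CARD('i))"
    by (rule sqrt_add_le_add_sqrt) (use sqrt_arg_nonneg in auto)
  finally have "M1 * norm (z, f - \<beta> *\<^sub>R G + (1 - \<alpha>) *\<^sub>R z)
      \<le> M1 * (sqrt ((3 * \<alpha>\<^sup>2 - 6 * \<alpha> + 4) * (norm z)\<^sup>2) + sqrt (3 * (norm f)\<^sup>2 + 3 * \<beta>\<^sup>2 * c1\<^sup>2 * real CARD('i)))"
    using M1(1) by (intro mult_left_mono) auto
  also have "\<dots> = a1 * norm z + a2"
    by (simp only: a1_def a2_def real_sqrt_mult[of _ "(norm z)\<^sup>2"] real_sqrt_abs abs_norm_cancel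
        distrib_left mult.assoc)
  finally have "M1 * norm (z, f - \<beta> *\<^sub>R G + (1 - \<alpha>) *\<^sub>R z) \<le> a1 * norm z + a2" .
  with M1(2) show ?thesis unfolding G_def by (rule order_trans)
qed

text \<open>Solutions of the equation on \<^term>\<open>{0..T}\<close> with forcing path \<^term>\<open>\<zeta>\<close>.\<close>

definition solves :: "(real \<Rightarrow> real ^ 'i) \<Rightarrow> real \<Rightarrow> (real \<Rightarrow> 'i phase) \<Rightarrow> bool" where
  "solves \<zeta> T X \<longleftrightarrow>
     (\<forall>t\<in>{0..T}. (X has_vector_derivative vf (\<zeta> t) (X t)) (at t within {0..T}))"

lemma solves_cone_decay:
  assumes T: "0 \<le> T" and X: "solves \<zeta> T X" and Y: "solves \<zeta> T Y"
  shows "cone (X T - Y T) (X T - Y T)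
    \<le> exp (- (2 * rate - 2 * Lip) * T) * cone (X 0 - Y 0) (X 0 - Y 0)"
proof (rule gronwall_decay[OF T])
  fix t assume t: "t \<in> {0..T}"
  define D where "D = (\<lambda>t. X t - Y t)"
  define D' where "D' = gen (D t) + (nonlin (fst (X t)) - nonlin (fst (Y t)))"
  have "(D has_vector_derivative D') (at t within {0..T})"
    using has_vector_derivative_diff[OF X[unfolded solves_def, rule_format, OF t]
        Y[unfolded solves_def, rule_format, OF t]]
    by (simp add: D_def D'_def vf_diff)
  from cone.has_vector_derivative[OF this this]
  show "((\<lambda>t. cone (X t - Y t) (X t - Y t)) has_vector_derivative
      2 * cone (X t - Y t) (gen (X t - Y t) + (nonlin (fst (X t)) - nonlin (fst (Y t)))))
      (at t within {0..T})"
    by (simp add: cone_sym[of D' "D t"]) (simp add: D_def D'_def)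
  show "2 * cone (X t - Y t) (gen (X t - Y t) + (nonlin (fst (X t)) - nonlin (fst (Y t))))
    \<le> - (2 * rate - 2 * Lip) * cone (X t - Y t) (X t - Y t)"
    unfolding rate_def
    by (rule cone_gen_le[OF nrm_nonlin_diff _ Lip_nonneg]) (use rate_Lip Lip_nonneg in \<open>simp add: rate_def\<close>)
qed

text \<open>The linear semigroup does not expand the adapted norm, so solutions diverge at most at the
  rate given by the Lipschitz constant. This yields uniqueness and continuous dependence.\<close>

lemma gen_nonexpansive: "B Y (gen Y) \<le> 0"
proof -
  have "B Y (gen Y) = B (Q Y) (gen (Q Y))"
    by (simp add: gen_Q) (simp add: Q_eq B.diff_left B.scaleR_left B_eta0)
  also have "\<dots> \<le> - rate * B (Q Y) (Q Y)" unfolding rate_def by (rule gen_dissipative) simp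
  also have "\<dots> \<le> 0" using rate_pos by simp
  finally show ?thesis .
qed

lemma solves_dependence:
  assumes T: "0 \<le> T" and X: "solves \<zeta> T X" and Y: "solves \<zeta> T Y"
  shows "nrm (X T - Y T) \<le> exp (Lip * T) * nrm (X 0 - Y 0)"
proof (rule power2_le_imp_le)
  have "B (X T - Y T) (X T - Y T) \<le> exp (- (- (2 * Lip)) * T) * B (X 0 - Y 0) (X 0 - Y 0)"
  proof (rule gronwall_decay[OF T])
    fix t assume t: "t \<in> {0..T}"
    define D where "D = (\<lambda>t. X t - Y t)"
    define G where "G = nonlin (fst (X t)) - nonlin (fst (Y t))"
    have "(D has_vector_derivative gen (D t) + G) (at t within {0..T})"
      using has_vector_derivative_diff[OF X[unfolded solves_def, rule_format, OF t]
          Y[unfolded solves_def, rule_format, OF t]]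
      by (simp add: D_def G_def vf_diff)
    from B.has_vector_derivative[OF this this]
    show "((\<lambda>t. B (X t - Y t) (X t - Y t)) has_vector_derivative
        2 * B (X t - Y t) (gen (X t - Y t) + (nonlin (fst (X t)) - nonlin (fst (Y t)))))
        (at t within {0..T})"
      by (simp add: B_sym[of "gen (D t) + G" "D t"]) (simp add: D_def G_def)
    have "B (D t) (gen (D t) + G) = B (D t) (gen (D t)) + B (D t) G" by (rule B.add_right)
    also have "\<dots> \<le> 0 + nrm (D t) * nrm G" by (intro add_mono gen_nonexpansive B_le_nrm)
    also have "\<dots> \<le> nrm (D t) * (Lip * nrm (D t))"
      using nrm_nonlin_diff[of "X t" "Y t"] by (simp add: D_def G_def mult_left_mono)
    also have "\<dots> = Lip * B (D t) (D t)" by (simp add: nrm_sq[symmetric] power2_eq_square)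
    finally show "2 * B (X t - Y t) (gen (X t - Y t) + (nonlin (fst (X t)) - nonlin (fst (Y t))))
        \<le> - (- (2 * Lip)) * B (X t - Y t) (X t - Y t)"
      by (simp add: D_def G_def)
  qed
  then show "(nrm (X T - Y T))\<^sup>2 \<le> (exp (Lip * T) * nrm (X 0 - Y 0))\<^sup>2"
    by (simp add: nrm_sq power_mult_distrib mult_ac flip: exp_double)
qed simp

text \<open>A nonnegative function \<^term>\<open>\<sigma>\<close> that decays at most at half the dissipation rate and
  is at least \<^term>\<open>2 / rate\<close> times the bound of the inhomogeneous term is a barrier for the
  component along \<^const>\<open>E2\<close>: the difference of the squares obeys a linear differential
  inequality.\<close>

lemma solves_barrier:
  assumes T: "0 \<le> T" and X: "solves \<zeta> T X"
    and \<sigma>: "\<And>t. (\<sigma> has_real_derivative \<sigma>' t) (at t)" "\<And>t. 0 \<le> \<sigma> t"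
      "\<And>t. - (rate / 2) * \<sigma> t \<le> \<sigma>' t"
      "\<And>t. t \<in> {0..T} \<Longrightarrow> a1 * norm (\<zeta> t) + a2 \<le> rate / 2 * \<sigma> t"
    and init: "nrm (Q (X 0)) \<le> \<sigma> 0"
  shows "nrm (Q (X T)) \<le> \<sigma> T"
proof (rule power2_le_imp_le)
  define h where "h = (\<lambda>t. B (Q (X t)) (Q (X t)) - \<sigma> t * \<sigma> t)"
  have "h T \<le> exp (- (3 / 2 * rate) * T) * h 0"
  proof (rule gronwall_decay[OF T])
    fix t assume t: "t \<in> {0..T}"
    define q where "q = Q (X t)"
    define G where "G = (\<zeta> t, f - \<beta> *\<^sub>R (\<chi> j. g (fst (X t) $ j)) + (1 - \<alpha>) *\<^sub>R \<zeta> t)"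
    have Qgen: "Q (gen Y) = gen Y" for Y by (simp add: Q_eq)
    have "((\<lambda>t. Q (X t)) has_vector_derivative gen q + Q G) (at t within {0..T})"
      using bounded_linear.has_vector_derivative[OF bounded_linear_Q X[unfolded solves_def, rule_format, OF t]]
      by (simp add: vf_eq G_def q_def gen_Q linear_add[OF bounded_linear.linear[OF bounded_linear_Q]] Qgen)
    from B.has_vector_derivative[OF this this]
    have 1: "((\<lambda>t. B (Q (X t)) (Q (X t))) has_vector_derivative 2 * B q (gen q + Q G)) (at t within {0..T})"
      by (simp add: B_sym[of "gen q + Q G"] q_def[symmetric])
    have "(\<sigma> has_vector_derivative \<sigma>' t) (at t within {0..T})"
      using \<sigma>(1)[of t] by (metis DERIV_subset has_real_derivative_iff_has_vector_derivative subset_UNIV)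
    from has_vector_derivative_diff[OF 1 has_vector_derivative_mult[OF this this]]
    show "(h has_vector_derivative 2 * B q (gen q + Q G) - 2 * \<sigma> t * \<sigma>' t) (at t within {0..T})"
      by (simp add: h_def mult_ac)
    have "B q (gen q) \<le> - rate * B q q" unfolding rate_def q_def by (rule gen_dissipative) simp
    moreover have "2 * B q (Q G) \<le> rate / 2 * (B q q + (\<sigma> t)\<^sup>2)"
    proof -
      have "B q (Q G) \<le> nrm q * nrm (Q G)" by (rule B_le_nrm)
      also have "\<dots> \<le> nrm q * (rate / 2 * \<sigma> t)"
      proof (intro mult_left_mono)
        have "nrm (Q G) \<le> nrm G" by (rule nrm_Q_le)
        also have "\<dots> \<le> a1 * norm (\<zeta> t) + a2" unfolding G_def by (rule nrm_forcing)
        also have "\<dots> \<le> rate / 2 * \<sigma> t" by (rule \<sigma>(4)[OF t])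
        finally show "nrm (Q G) \<le> rate / 2 * \<sigma> t" .
      qed simp
      finally have "2 * B q (Q G) \<le> rate / 2 * (2 * nrm q * \<sigma> t)" by (simp add: mult_ac)
      also have "\<dots> \<le> rate / 2 * ((nrm q)\<^sup>2 + (\<sigma> t)\<^sup>2)"
        using rate_pos by (intro mult_left_mono sum_squares_bound) auto
      finally show ?thesis by (simp add: nrm_sq)
    qed
    moreover have "- rate * (\<sigma> t)\<^sup>2 \<le> 2 * \<sigma> t * \<sigma>' t"
      using mult_left_mono[OF \<sigma>(3)[of t], of "2 * \<sigma> t"] \<sigma>(2)[of t]
      by (simp add: power2_eq_square algebra_simps)
    ultimately show "2 * B q (gen q + Q G) - 2 * \<sigma> t * \<sigma>' t \<le> - (3 / 2 * rate) * h t"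
      by (simp add: h_def B.add_right q_def[symmetric] power2_eq_square algebra_simps)
  qed
  also have "\<dots> \<le> 0"
  proof -
    have "h 0 \<le> 0"
      using power_mono[OF init, of 2] nrm_sq[of "Q (X 0)"] by (simp add: h_def power2_eq_square)
    then show ?thesis by (simp add: mult_le_0_iff)
  qed
  finally show "(nrm (Q (X T)))\<^sup>2 \<le> (\<sigma> T)\<^sup>2"
    unfolding nrm_sq by (simp add: h_def power2_eq_square)
qed (rule \<sigma>)

text \<open>Absorption: with forcing that grows backwards in time at half the dissipation rate, the
  slab belonging to the initial time is mapped into the slab belonging to the final time.\<close>

lemma solves_absorbed:
  assumes T: "0 \<le> T" and X: "solves \<zeta> T X" and r: "0 \<le> r"
    and \<zeta>: "\<And>t. t \<in> {0..T} \<Longrightarrow> norm (\<zeta> t) \<le> exp (rate / 2 * (T - t)) * r"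
    and init: "nrm (Q (X 0)) \<le> 4 * a1 / rate * (exp (rate / 2 * T) * r) + 2 * a2 / rate"
  shows "nrm (Q (X T)) \<le> 4 * a1 / rate * r + 2 * a2 / rate"
proof -
  define \<sigma> where "\<sigma> = (\<lambda>t. 4 * a1 / rate * (exp (rate / 2 * (T - t)) * r) + 2 * a2 / rate)"
  define E where "E = (\<lambda>t. a1 * (exp (rate / 2 * (T - t)) * r))"
  have E: "0 \<le> E t" for t using a1_nonneg r by (simp add: E_def)
  have \<sigma>_E: "rate / 2 * \<sigma> t = 2 * E t + a2" for t
    using rate_pos by (simp add: \<sigma>_def E_def distrib_left)
  have "nrm (Q (X T)) \<le> \<sigma> T"
  proof (rule solves_barrier[OF T X])
    fix t
    show "(\<sigma> has_real_derivative - 2 * E t) (at t)"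
      unfolding \<sigma>_def E_def using rate_pos by (auto intro!: derivative_eq_intros)
    show "0 \<le> \<sigma> t" using a1_nonneg a2_nonneg rate_pos r by (simp add: \<sigma>_def)
    show "- (rate / 2) * \<sigma> t \<le> - 2 * E t"
      using \<sigma>_E[of t] a2_nonneg by simp
  next
    fix t assume "t \<in> {0..T}"
    then have "a1 * norm (\<zeta> t) \<le> E t"
      unfolding E_def using \<zeta> a1_nonneg by (intro mult_left_mono) auto
    then show "a1 * norm (\<zeta> t) + a2 \<le> rate / 2 * \<sigma> t"
      using E[of t] unfolding \<sigma>_E by linarith
  next
    show "nrm (Q (X 0)) \<le> \<sigma> 0" using init by (simp add: \<sigma>_def)
  qed
  then show ?thesis by (simp add: \<sigma>_def)
qed

end


section \<open>The pullback attractor as a graph\<close>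

lemma theta_theta: "theta s (theta t \<omega>) = theta (s + t) \<omega>"
  by (simp add: theta_def fun_eq_iff add.assoc add.commute add.left_commute)

lemma theta_zero: "(\<And>j. \<omega> j 0 = 0) \<Longrightarrow> theta 0 \<omega> = \<omega>"
  by (simp add: theta_def fun_eq_iff)

text \<open>The system driven by noise paths from an invariant set \<^term>\<open>\<Omega>\<close>, with the backward growth
  of the stationary process controlled by \<^term>\<open>r\<close>.\<close>

locale noise_system = damped_system A K \<alpha> \<delta> lam1 \<beta> f g c1 c2 M1 \<kappa>
  for A :: "real ^ 'i::finite ^ 'i" and K \<alpha> \<delta> lam1 \<beta> f g c1 c2 M1 \<kappa> +
  fixes \<Omega> :: "('i \<Rightarrow> real \<Rightarrow> real) set" and \<epsilon> :: "real ^ 'i"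
    and Y :: "real \<Rightarrow> ('i \<Rightarrow> real \<Rightarrow> real) \<Rightarrow> 'i phase \<Rightarrow> 'i phase"
    and r :: "('i \<Rightarrow> real \<Rightarrow> real) \<Rightarrow> real"
  assumes theta_mem: "\<omega> \<in> \<Omega> \<Longrightarrow> theta t \<omega> \<in> \<Omega>"
    and omega_zero: "\<omega> \<in> \<Omega> \<Longrightarrow> \<omega> j 0 = 0"
    and solution: "is_solution_map \<Omega> A K \<alpha> \<beta> f \<epsilon> g Y"
    and r_nonneg: "\<omega> \<in> \<Omega> \<Longrightarrow> 0 \<le> r \<omega>"
    and ou_bound: "\<omega> \<in> \<Omega> \<Longrightarrow> norm (ou \<epsilon> (theta t \<omega>)) \<le> exp (rate / 2 * \<bar>t\<bar>) * r \<omega>"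
    and r_growth: "\<omega> \<in> \<Omega> \<Longrightarrow> r (theta t \<omega>) \<le> exp (rate / 2 * \<bar>t\<bar>) * r \<omega>"
begin

lemma norm_le_nrm: "norm X \<le> sqrt (4 / \<alpha>\<^sup>2 + 4) * nrm X"
  using real_sqrt_le_mono[OF norm_le_B[of X]] by (simp add: real_sqrt_mult normE_def)

lemma nrm_le_zero: "nrm X \<le> 0 \<longleftrightarrow> X = 0"
proof
  assume "nrm X \<le> 0"
  then have "nrm X = 0" by (simp add: antisym)
  then show "X = 0" using norm_le_nrm[of X] by simp
qed simp

text \<open>The radius of the absorbing slab.\<close>

definition R0 :: "('i \<Rightarrow> real \<Rightarrow> real) \<Rightarrow> real" where
  "R0 \<omega> = 4 * a1 / rate * r \<omega> + 2 * a2 / rate"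

text \<open>The forcing seen by a solution on \<^term>\<open>{0..T}\<close> that ends at the present time.\<close>

definition past :: "('i \<Rightarrow> real \<Rightarrow> real) \<Rightarrow> real \<Rightarrow> real \<Rightarrow> real ^ 'i" where
  "past \<omega> T t = ou \<epsilon> (theta (t - T) \<omega>)"

text \<open>The lift to the phase space of the absorbing set.\<close>

definition slab :: "('i \<Rightarrow> real \<Rightarrow> real) \<Rightarrow> 'i phase set" where
  "slab \<omega> = {y. nrm (Q y) \<le> R0 \<omega>}"

text \<open>The image at the present time of the slab at time \<^term>\<open>- \<tau>\<close>, and the union of the
  images of all slabs at time \<^term>\<open>- t\<close> or earlier.\<close>

definition img :: "('i \<Rightarrow> real \<Rightarrow> real) \<Rightarrow> real \<Rightarrow> 'i phase set" where
  "img \<omega> \<tau> = Y \<tau> (theta (- \<tau>) \<omega>) ` slab (theta (- \<tau>) \<omega>)"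

definition tail :: "('i \<Rightarrow> real \<Rightarrow> real) \<Rightarrow> real \<Rightarrow> 'i phase set" where
  "tail \<omega> t = (\<Union>\<tau>\<in>{t..}. img \<omega> \<tau>)"

text \<open>The lift to the phase space of the attractor of \<^term>\<open>Y\<close>.\<close>

definition att :: "('i \<Rightarrow> real \<Rightarrow> real) \<Rightarrow> 'i phase set" where
  "att \<omega> = (\<Inter>t\<in>{0<..}. closure (tail \<omega> t))"

lemma Y_zero: "\<omega> \<in> \<Omega> \<Longrightarrow> Y 0 \<omega> y = y"
  using solution unfolding is_solution_map_def by blast

lemma Y_solves:
  assumes \<omega>: "\<omega> \<in> \<Omega>" and T: "0 \<le> T" "T \<le> S"
  shows "solves (past \<omega> T) T (\<lambda>t. Y (S - T + t) (theta (- S) \<omega>) y)"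
  unfolding solves_def
proof
  fix t assume t: "t \<in> {0..T}"
  have t': "0 \<le> S - T + t" using t T by simp
  have "theta (- S) \<omega> \<in> \<Omega>" by (rule theta_mem[OF \<omega>])
  then have "((\<lambda>s. Y s (theta (- S) \<omega>) y) has_vector_derivative
      vf (ou \<epsilon> (theta (S - T + t) (theta (- S) \<omega>))) (Y (S - T + t) (theta (- S) \<omega>) y))
      (at (S - T + t) within {0..})"
    using solution t' unfolding is_solution_map_def by blast
  then have "((\<lambda>s. Y s (theta (- S) \<omega>) y) has_vector_derivative
      vf (past \<omega> T t) (Y (S - T + t) (theta (- S) \<omega>) y))
      (at (S - T + t) within (\<lambda>t. S - T + t) ` {0..T})"
    using T by (auto simp: theta_theta past_def algebra_simps intro: has_vector_derivative_within_subset)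
  moreover have "((\<lambda>t. S - T + t) has_vector_derivative 1) (at t within {0..T})"
    by (auto intro!: derivative_eq_intros)
  ultimately show "((\<lambda>t. Y (S - T + t) (theta (- S) \<omega>) y) has_vector_derivative
      vf (past \<omega> T t) (Y (S - T + t) (theta (- S) \<omega>) y)) (at t within {0..T})"
    using vector_diff_chain_within[of "\<lambda>t. S - T + t" 1 t "{0..T}" "\<lambda>s. Y s (theta (- S) \<omega>) y"]
    by (simp add: o_def)
qed

lemma Y_solves_full:
  assumes "\<omega> \<in> \<Omega>" "0 \<le> T"
  shows "solves (past \<omega> T) T (\<lambda>t. Y t (theta (- T) \<omega>) y)"
  using Y_solves[OF assms order_refl] by simp

lemma R0_nonneg: "\<omega> \<in> \<Omega> \<Longrightarrow> 0 \<le> R0 \<omega>"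
  using a1_nonneg a2_nonneg rate_pos r_nonneg by (simp add: R0_def)

lemma R0_theta_le_sharp:
  assumes "\<omega> \<in> \<Omega>" "0 \<le> T"
  shows "R0 (theta (- T) \<omega>) \<le> 4 * a1 / rate * (exp (rate / 2 * T) * r \<omega>) + 2 * a2 / rate"
  using r_growth[OF assms(1), of "- T"] assms(2) a1_nonneg rate_pos
  unfolding R0_def by (intro add_right_mono mult_left_mono) auto

lemma R0_theta_le:
  assumes \<omega>: "\<omega> \<in> \<Omega>" and T: "0 \<le> T"
  shows "R0 (theta (- T) \<omega>) \<le> exp (rate / 2 * T) * R0 \<omega>"
proof -
  have "1 * (2 * a2 / rate) \<le> exp (rate / 2 * T) * (2 * a2 / rate)"
    using rate_pos a2_nonneg T by (intro mult_right_mono) auto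
  then show ?thesis using R0_theta_le_sharp[OF assms] by (simp add: R0_def algebra_simps)
qed

lemma img_absorbed:
  assumes \<omega>: "\<omega> \<in> \<Omega>" and T: "0 \<le> T" and x: "x \<in> img \<omega> T"
  shows "nrm (Q x) \<le> R0 \<omega>"
proof -
  obtain y where y: "nrm (Q y) \<le> R0 (theta (- T) \<omega>)" "x = Y T (theta (- T) \<omega>) y"
    using x by (auto simp: img_def slab_def)
  have "nrm (Q (Y T (theta (- T) \<omega>) y)) \<le> 4 * a1 / rate * r \<omega> + 2 * a2 / rate"
  proof (rule solves_absorbed[OF T Y_solves_full[OF \<omega> T] r_nonneg[OF \<omega>]])
    show "norm (past \<omega> T t) \<le> exp (rate / 2 * (T - t)) * r \<omega>" if "t \<in> {0..T}" for t
      using ou_bound[OF \<omega>, of "t - T"] that by (simp add: past_def)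
    show "nrm (Q (Y 0 (theta (- T) \<omega>) y)) \<le> 4 * a1 / rate * (exp (rate / 2 * T) * r \<omega>) + 2 * a2 / rate"
      using y(1) R0_theta_le_sharp[OF \<omega> T] by (simp add: Y_zero[OF theta_mem[OF \<omega>]])
  qed
  then show ?thesis by (simp add: y(2) R0_def)
qed

text \<open>A point reached from the slab at time \<^term>\<open>- S\<close> has passed through the slab at every later
  time \<^term>\<open>- T\<close>. Thus points with different starting times can be compared along solutions
  on a common time interval.\<close>

lemma img_history:
  assumes \<omega>: "\<omega> \<in> \<Omega>" and T: "0 \<le> T" "T \<le> S" and x: "x \<in> img \<omega> S"
  obtains X where "solves (past \<omega> T) T X" "X T = x" "nrm (Q (X 0)) \<le> R0 (theta (- T) \<omega>)"
proof -
  obtain y where y: "y \<in> slab (theta (- S) \<omega>)" "x = Y S (theta (- S) \<omega>) y"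
    using x by (auto simp: img_def)
  have "theta (- (S - T)) (theta (- T) \<omega>) = theta (- S) \<omega>" by (simp add: theta_theta)
  then have "Y (S - T) (theta (- S) \<omega>) y \<in> img (theta (- T) \<omega>) (S - T)"
    using y(1) by (auto simp: img_def)
  then have "nrm (Q (Y (S - T) (theta (- S) \<omega>) y)) \<le> R0 (theta (- T) \<omega>)"
    using T by (intro img_absorbed[OF theta_mem[OF \<omega>]]) auto
  then show thesis
    using that[OF Y_solves[OF \<omega> T, of y]] y(2) by simp
qed

text \<open>The bound for the cone form on differences at the present time, obtained from solutions
  that were in the slab at time \<^term>\<open>- T\<close>: the squared width of that slab, growing like
  \<^term>\<open>exp (rate * T)\<close>, times the decay factor of the cone form.\<close>

definition err :: "('i \<Rightarrow> real \<Rightarrow> real) \<Rightarrow> real \<Rightarrow> real" where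
  "err \<omega> T = 4 * (R0 \<omega>)\<^sup>2 * exp (- (rate - 2 * Lip) * T)"

lemma err_tendsto: "(err \<omega> \<longlongrightarrow> 0) at_top"
proof -
  have "filterlim (\<lambda>T. (rate - 2 * Lip) * T) at_top at_top"
    using rate_Lip Lip_nonneg
    by (intro filterlim_tendsto_pos_mult_at_top[OF tendsto_const]) (auto intro: filterlim_ident)
  then have "((\<lambda>T. exp (- ((rate - 2 * Lip) * T))) \<longlongrightarrow> 0) at_top"
    by (intro filterlim_compose[OF exp_at_bot]) (simp add: filterlim_uminus_at_bot)
  from tendsto_mult[OF tendsto_const this, of "4 * (R0 \<omega>)\<^sup>2"]
  show ?thesis unfolding err_def[abs_def] mult_minus_left by (simp only: mult_zero_right)
qed

lemma img_cone:
  assumes \<omega>: "\<omega> \<in> \<Omega>" and T: "0 \<le> T" "T \<le> S1" "T \<le> S2"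
    and x: "x \<in> img \<omega> S1" and y: "y \<in> img \<omega> S2"
  shows "cone (x - y) (x - y) \<le> err \<omega> T"
proof -
  obtain X where X: "solves (past \<omega> T) T X" "X T = x" "nrm (Q (X 0)) \<le> R0 (theta (- T) \<omega>)"
    using img_history[OF \<omega> T(1,2) x] .
  obtain Z where Z: "solves (past \<omega> T) T Z" "Z T = y" "nrm (Q (Z 0)) \<le> R0 (theta (- T) \<omega>)"
    using img_history[OF \<omega> T(1,3) y] .
  have "nrm (Q (X 0 - Z 0)) \<le> nrm (Q (X 0)) + nrm (Q (Z 0))"
    unfolding PQ_diff by (rule nrm_diff_le)
  also have "\<dots> \<le> 2 * (exp (rate / 2 * T) * R0 \<omega>)"
    using X(3) Z(3) R0_theta_le[OF \<omega> T(1)] by simp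
  finally have "(nrm (Q (X 0 - Z 0)))\<^sup>2 \<le> (2 * (exp (rate / 2 * T) * R0 \<omega>))\<^sup>2"
    by (rule power_mono) simp
  also have "\<dots> = 4 * (R0 \<omega>)\<^sup>2 * exp (rate * T)"
    by (simp add: power_mult_distrib flip: exp_double)
  finally have "cone (X 0 - Z 0) (X 0 - Z 0) \<le> 4 * (R0 \<omega>)\<^sup>2 * exp (rate * T)"
    using cone_le order_trans by blast
  then have "exp (- (2 * rate - 2 * Lip) * T) * cone (X 0 - Z 0) (X 0 - Z 0)
      \<le> exp (- (2 * rate - 2 * Lip) * T) * (4 * (R0 \<omega>)\<^sup>2 * exp (rate * T))"
    by (intro mult_left_mono) auto
  also have "\<dots> = err \<omega> T"
  proof -
    have "exp (- (2 * rate - 2 * Lip) * T) * exp (rate * T) = exp (- (rate - 2 * Lip) * T)"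
      by (simp add: algebra_simps flip: exp_add)
    then show ?thesis by (simp add: err_def mult_ac)
  qed
  finally show ?thesis
    using solves_cone_decay[OF T(1) X(1) Z(1)] X(2) Z(2) by simp
qed

lemma closure_tail_cone:
  assumes \<omega>: "\<omega> \<in> \<Omega>" and T: "0 \<le> T" and x: "x \<in> closure (tail \<omega> T)" and y: "y \<in> closure (tail \<omega> T)"
  shows "cone (x - y) (x - y) \<le> err \<omega> T"
proof -
  obtain xs ys where xs: "\<And>n. xs n \<in> tail \<omega> T" "xs \<longlonglongrightarrow> x" and ys: "\<And>n. ys n \<in> tail \<omega> T" "ys \<longlonglongrightarrow> y"
    using x y by (auto simp: closure_sequential)
  have "(\<lambda>n. cone (xs n - ys n) (xs n - ys n)) \<longlonglongrightarrow> cone (x - y) (x - y)"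
    by (intro cone.tendsto tendsto_diff xs ys)
  moreover have "cone (xs n - ys n) (xs n - ys n) \<le> err \<omega> T" for n
  proof -
    obtain S1 S2 where "T \<le> S1" "xs n \<in> img \<omega> S1" "T \<le> S2" "ys n \<in> img \<omega> S2"
      using xs(1)[of n] ys(1)[of n] unfolding tail_def by auto
    then show ?thesis using img_cone[OF \<omega> T] by blast
  qed
  ultimately show ?thesis by (intro LIMSEQ_le_const2) auto
qed

lemma att_cone:
  assumes \<omega>: "\<omega> \<in> \<Omega>" and "x \<in> att \<omega>" "y \<in> att \<omega>"
  shows "cone (x - y) (x - y) \<le> 0"
proof (rule tendsto_lowerbound[OF err_tendsto])
  show "\<forall>\<^sub>F T in at_top. cone (x - y) (x - y) \<le> err \<omega> T"
    using eventually_gt_at_top[of 0]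
    by eventually_elim (use assms closure_tail_cone in \<open>auto simp: att_def\<close>)
qed simp

lemma g_periodic_int: "g (x + of_int k * \<kappa>) = g x"
proof -
  have nat: "g (x + of_nat n * \<kappa>) = g x" for x n
    by (induction n) (use g_periodic in \<open>auto simp: algebra_simps\<close>, metis add.assoc add.commute g_periodic)
  show ?thesis
  proof (cases k)
    case (nonneg n)
    then show ?thesis using nat by simp
  next
    case (neg n)
    then have e: "x + of_int k * \<kappa> + of_nat (Suc n) * \<kappa> = x" by (simp del: of_nat_Suc)
    show ?thesis using nat[of "x + of_int k * \<kappa>" "Suc n", unfolded e] by (rule sym)
  qed
qed

lemma vf_translate: "vf z (X + of_int k *\<^sub>R p0 \<kappa>) = vf z X"
proof -
  have "g (fst X $ j + of_int k * \<kappa>) = g (fst X $ j)" for j by (rule g_periodic_int)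
  then show ?thesis
    by (simp add: vfield_def Let_def p0_def eta0_def matrix_vector_right_distrib
        matrix_vector_mult_scaleR A_one)
qed

lemma Y_lipschitz:
  assumes "\<omega> \<in> \<Omega>" "0 \<le> T"
  shows "nrm (Y T (theta (- T) \<omega>) x - Y T (theta (- T) \<omega>) y) \<le> exp (Lip * T) * nrm (x - y)"
  using solves_dependence[OF assms(2) Y_solves_full[OF assms, of x] Y_solves_full[OF assms, of y]]
  by (simp add: Y_zero[OF theta_mem[OF assms(1)]])

lemma Y_translate:
  assumes "\<omega> \<in> \<Omega>" "0 \<le> T"
  shows "Y T (theta (- T) \<omega>) (x + of_int k *\<^sub>R p0 \<kappa>) = Y T (theta (- T) \<omega>) x + of_int k *\<^sub>R p0 \<kappa>"
proof -
  have "solves (past \<omega> T) T (\<lambda>t. Y t (theta (- T) \<omega>) x + of_int k *\<^sub>R p0 \<kappa>)"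
    using Y_solves_full[OF assms, of x]
    by (auto simp: solves_def vf_translate intro!: derivative_eq_intros)
  from solves_dependence[OF assms(2) Y_solves_full[OF assms, of "x + of_int k *\<^sub>R p0 \<kappa>"] this]
  have "nrm (Y T (theta (- T) \<omega>) (x + of_int k *\<^sub>R p0 \<kappa>) - (Y T (theta (- T) \<omega>) x + of_int k *\<^sub>R p0 \<kappa>)) \<le> 0"
    by (simp add: Y_zero[OF theta_mem[OF assms(1)]])
  then show ?thesis by (simp add: nrm_le_zero)
qed

lemma continuous_Y:
  assumes "\<omega> \<in> \<Omega>" "0 \<le> T"
  shows "continuous_on UNIV (Y T (theta (- T) \<omega>))"
proof (rule lipschitz_on_continuous_on[OF lipschitz_onI])
  let ?c = "sqrt (4 / \<alpha>\<^sup>2 + 4)"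
  show "0 \<le> ?c * exp (Lip * T) * M1" using M1 by simp
  fix x y :: "'i phase"
  have "norm (Y T (theta (- T) \<omega>) x - Y T (theta (- T) \<omega>) y)
      \<le> ?c * nrm (Y T (theta (- T) \<omega>) x - Y T (theta (- T) \<omega>) y)" by (rule norm_le_nrm)
  also have "\<dots> \<le> ?c * (exp (Lip * T) * nrm (x - y))"
    by (intro mult_left_mono Y_lipschitz assms) simp
  also have "\<dots> \<le> ?c * (exp (Lip * T) * (M1 * norm (x - y)))"
    by (intro mult_left_mono M1) simp_all
  finally show "dist (Y T (theta (- T) \<omega>) x) (Y T (theta (- T) \<omega>) y) \<le> ?c * exp (Lip * T) * M1 * dist x y"
    by (simp add: dist_norm mult.assoc)
qed

lemma eta0_in_slab: "\<omega> \<in> \<Omega> \<Longrightarrow> s *\<^sub>R eta0 \<in> slab \<omega>"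
  using R0_nonneg by (simp add: slab_def Q_eq)

text \<open>The image of the neutral line meets every fibre of the projection onto \<^const>\<open>E1\<close>: its
  horizontal coordinate is continuous and advances by \<^term>\<open>\<kappa>\<close> with every period.\<close>

lemma Y_line_surj:
  assumes \<omega>: "\<omega> \<in> \<Omega>" and T: "0 \<le> T"
  obtains s' where "hcoord \<alpha> (Y T (theta (- T) \<omega>) (s' *\<^sub>R eta0)) = s"
proof -
  define h where "h = (\<lambda>s'. hcoord \<alpha> (Y T (theta (- T) \<omega>) (s' *\<^sub>R eta0)))"
  have cont: "continuous_on UNIV h"
    unfolding h_def
    by (intro bounded_linear.continuous_on[OF bounded_linear_hcoord]
        continuous_on_compose2[OF continuous_Y[OF assms]] continuous_intros) auto
  have shift: "h (of_int k * \<kappa>) = h 0 + of_int k * \<kappa>" for k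
    using Y_translate[OF assms, of 0 k] by (simp add: h_def p0_def)
  obtain k :: int where k: "\<bar>(s - h 0) / \<kappa>\<bar> \<le> of_int k" using le_of_int_ceiling by blast
  have bound: "h (of_int (- k) * \<kappa>) \<le> s" "s \<le> h (of_int k * \<kappa>)"
  proof -
    have "\<bar>s - h 0\<bar> \<le> of_int k * \<kappa>" using k kappa by (simp add: abs_divide field_simps)
    then show "h (of_int (- k) * \<kappa>) \<le> s" "s \<le> h (of_int k * \<kappa>)" unfolding shift by auto
  qed
  have "0 \<le> k" using k by (meson abs_ge_zero of_int_0_le_iff order_trans)
  then have "of_int (- k) * \<kappa> \<le> of_int k * \<kappa>" using kappa by simp
  from IVT'[OF bound this] obtain s' where "h s' = s"
    using continuous_on_subset[OF cont] by auto
  then show thesis using that by (simp add: h_def)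
qed

lemma att_exists:
  assumes \<omega>: "\<omega> \<in> \<Omega>"
  obtains x where "x \<in> att \<omega>" "hcoord \<alpha> x = s"
proof -
  have "\<exists>x. x \<in> img \<omega> (real n) \<and> hcoord \<alpha> x = s" for n
    using Y_line_surj[OF \<omega>, of "real n" s] eta0_in_slab[OF theta_mem[OF \<omega>]]
    unfolding img_def by (metis imageI of_nat_0_le_iff)
  then obtain X where X: "\<And>n. X n \<in> img \<omega> (real n)" "\<And>n. hcoord \<alpha> (X n) = s" by metis
  let ?c = "sqrt (4 / \<alpha>\<^sup>2 + 4)"
  have "norm (X n) \<le> norm (s *\<^sub>R (eta0 :: 'i phase)) + ?c * R0 \<omega>" for n
  proof -
    have "X n = s *\<^sub>R eta0 + Q (X n)" by (simp add: Q_eq X(2))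
    then have "norm (X n) \<le> norm (s *\<^sub>R (eta0 :: 'i phase)) + norm (Q (X n))"
      by (metis norm_triangle_ineq)
    also have "norm (Q (X n)) \<le> ?c * nrm (Q (X n))" by (rule norm_le_nrm)
    also have "\<dots> \<le> ?c * R0 \<omega>"
      by (intro mult_left_mono img_absorbed[OF \<omega> _ X(1)]) simp_all
    finally show ?thesis by simp
  qed
  then have "X n \<in> cball 0 (norm (s *\<^sub>R (eta0 :: 'i phase)) + ?c * R0 \<omega>)" for n by simp
  moreover have "seq_compact (cball (0 :: 'i phase) (norm (s *\<^sub>R (eta0 :: 'i phase)) + ?c * R0 \<omega>))"
    by (simp add: compact_imp_seq_compact)
  ultimately obtain x \<rho> where x: "strict_mono \<rho>" "(X \<circ> \<rho>) \<longlonglongrightarrow> x"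
    unfolding seq_compact_def by metis
  show thesis
  proof
    show "x \<in> att \<omega>" unfolding att_def
    proof
      fix t :: real
      obtain N :: nat where N: "t \<le> real N" using real_arch_simple by blast
      have "(X \<circ> \<rho>) (n + N) \<in> tail \<omega> t" for n
      proof -
        have "N \<le> \<rho> (n + N)" using seq_suble[OF x(1), of "n + N"] by simp
        then have "t \<le> real (\<rho> (n + N))" using N by (meson of_nat_le_iff order_trans)
        then show ?thesis using X(1)[of "\<rho> (n + N)"] unfolding tail_def by auto
      qed
      then show "x \<in> closure (tail \<omega> t)"
        using LIMSEQ_ignore_initial_segment[OF x(2), of N] unfolding closure_sequential
        by (intro exI[of _ "\<lambda>n. (X \<circ> \<rho>) (n + N)"] conjI) auto
    qed
    have "(\<lambda>n. hcoord \<alpha> ((X \<circ> \<rho>) n)) \<longlonglongrightarrow> hcoord \<alpha> x"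
      by (intro bounded_linear.tendsto[OF bounded_linear_hcoord] x)
    then show "hcoord \<alpha> x = s" by (simp add: X(2) LIMSEQ_const_iff)
  qed
qed

lemma slab_translate: "x + of_int k *\<^sub>R p0 \<kappa> \<in> slab \<omega> \<longleftrightarrow> x \<in> slab \<omega>"
  by (simp add: slab_def Q_eq p0_def algebra_simps)

lemma tail_translate:
  assumes \<omega>: "\<omega> \<in> \<Omega>" and t: "0 \<le> t" and x: "x \<in> tail \<omega> t"
  shows "x + of_int k *\<^sub>R p0 \<kappa> \<in> tail \<omega> t"
proof -
  obtain \<tau> y where y: "t \<le> \<tau>" "y \<in> slab (theta (- \<tau>) \<omega>)" "x = Y \<tau> (theta (- \<tau>) \<omega>) y"
    using x by (auto simp: tail_def img_def)
  have "x + of_int k *\<^sub>R p0 \<kappa> = Y \<tau> (theta (- \<tau>) \<omega>) (y + of_int k *\<^sub>R p0 \<kappa>)"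
    using y(1,3) t by (simp add: Y_translate[OF \<omega>])
  moreover have "y + of_int k *\<^sub>R p0 \<kappa> \<in> slab (theta (- \<tau>) \<omega>)"
    using y(2) by (simp only: slab_translate)
  ultimately show ?thesis
    using y(1) unfolding tail_def img_def by blast
qed

lemma att_translate:
  assumes \<omega>: "\<omega> \<in> \<Omega>" and x: "x \<in> att \<omega>"
  shows "x + of_int k *\<^sub>R p0 \<kappa> \<in> att \<omega>"
  unfolding att_def
proof
  fix t :: real assume t: "t \<in> {0<..}"
  then obtain xs where "\<And>n. xs n \<in> tail \<omega> t" "xs \<longlonglongrightarrow> x"
    using x by (auto simp: att_def closure_sequential)
  then have "\<forall>n. xs n + of_int k *\<^sub>R p0 \<kappa> \<in> tail \<omega> t"
    "(\<lambda>n. xs n + of_int k *\<^sub>R p0 \<kappa>) \<longlonglongrightarrow> x + of_int k *\<^sub>R p0 \<kappa>"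
    using tail_translate[OF \<omega>] t by (auto intro!: tendsto_intros)
  then show "x + of_int k *\<^sub>R p0 \<kappa> \<in> closure (tail \<omega> t)"
    unfolding closure_sequential
    by (intro exI[of _ "\<lambda>n. xs n + of_int k *\<^sub>R p0 \<kappa>"] conjI)
qed

text \<open>A set meeting every fibre over \<^const>\<open>E1\<close> all of whose secants lie in the cone is the
  graph of a nonexpansive function, which is periodic if the set is invariant under \<^term>\<open>p0 \<kappa>\<close>.\<close>

lemma cone_set_is_graph:
  fixes S :: "'i phase set"
  assumes cone: "\<And>x y. x \<in> S \<Longrightarrow> y \<in> S \<Longrightarrow> cone (x - y) (x - y) \<le> 0"
    and ex: "\<And>s. \<exists>x\<in>S. hcoord \<alpha> x = s"
    and per: "\<And>x. x \<in> S \<Longrightarrow> x + p0 \<kappa> \<in> S"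
  obtains \<Phi> :: "'i phase \<Rightarrow> 'i phase" where "\<Phi> \<in> E1 \<rightarrow> E2 \<alpha>" "S = {p + \<Phi> p | p. p \<in> E1}"
    "\<forall>p1\<in>E1. \<forall>p2\<in>E1. nrm (\<Phi> p1 - \<Phi> p2) \<le> nrm (p1 - p2)"
    "\<forall>p\<in>E1. \<Phi> (p + p0 \<kappa>) = \<Phi> p"
proof -
  obtain F where F: "\<And>s. F s \<in> S" "\<And>s. hcoord \<alpha> (F s) = s" using ex by metis
  have uniq: "x = y" if "x \<in> S" "y \<in> S" "hcoord \<alpha> x = hcoord \<alpha> y" for x y
  proof -
    have "P (x - y) = 0" "Q (x - y) = x - y" using that(3) by (simp_all add: P_eq Q_eq)
    then have "B (x - y) (x - y) \<le> 0"
      using cone[OF that(1,2)] by (simp add: cone_def B.zero_left)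
    then show ?thesis using B_pos[of "x - y"] by force
  qed
  define \<Phi> where "\<Phi> = (\<lambda>p :: 'i phase. Q (F (hcoord \<alpha> p)))"
  have rep: "p + \<Phi> p = F (hcoord \<alpha> p)" if "p \<in> E1" for p :: "'i phase"
    using E1_hcoord[OF that, of \<alpha>] by (simp add: \<Phi>_def Q_eq F(2))
  show thesis
  proof
    show "\<Phi> \<in> E1 \<rightarrow> E2 \<alpha>" using pos by (simp add: \<Phi>_def E2_eq)
    show "S = {p + \<Phi> p | p. p \<in> E1}"
    proof (intro equalityI subsetI)
      fix x assume "x \<in> S"
      then have "x = F (hcoord \<alpha> x)" by (intro uniq) (simp_all add: F)
      then have "x = hcoord \<alpha> x *\<^sub>R eta0 + \<Phi> (hcoord \<alpha> x *\<^sub>R eta0)"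
        by (simp add: rep)
      then show "x \<in> {p + \<Phi> p | p. p \<in> E1}" using eta0_in_E1 by blast
    next
      fix x assume "x \<in> {p + \<Phi> p | p. p \<in> E1}"
      then show "x \<in> S" using rep F(1) by auto
    qed
    show "\<forall>p1\<in>E1. \<forall>p2\<in>E1. nrm (\<Phi> p1 - \<Phi> p2) \<le> nrm (p1 - p2)"
    proof (intro ballI)
      fix p1 p2 :: "'i phase" assume p: "p1 \<in> E1" "p2 \<in> E1"
      let ?x = "F (hcoord \<alpha> p1)" and ?y = "F (hcoord \<alpha> p2)"
      have "Q (?x - ?y) = \<Phi> p1 - \<Phi> p2" by (simp add: \<Phi>_def PQ_diff)
      moreover have "P (?x - ?y) = p1 - p2"
        unfolding PQ_diff using E1_hcoord[OF p(1), of \<alpha>] E1_hcoord[OF p(2), of \<alpha>] by (simp add: P_eq F(2))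
      ultimately show "nrm (\<Phi> p1 - \<Phi> p2) \<le> nrm (p1 - p2)"
        using cone[OF F(1) F(1), of "hcoord \<alpha> p1" "hcoord \<alpha> p2"] by (simp add: cone_def normE_def)
    qed
    show "\<forall>p\<in>E1. \<Phi> (p + p0 \<kappa>) = \<Phi> p"
    proof
      fix p :: "'i phase"
      have "F (hcoord \<alpha> p + \<kappa>) = F (hcoord \<alpha> p) + p0 \<kappa>"
        by (rule uniq) (simp_all add: F per, simp add: p0_def F)
      then show "\<Phi> (p + p0 \<kappa>) = \<Phi> p" by (simp add: \<Phi>_def p0_def Q_eq algebra_simps)
    qed
  qed
qed

end


section \<open>Passage to the quotient by the period\<close>

lemma coset_eq_iff:
  "coset \<kappa> p = coset \<kappa> q \<longleftrightarrow> (\<exists>k::int. q = p + of_int k *\<^sub>R p0 \<kappa>)"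
proof
  assume "coset \<kappa> p = coset \<kappa> q"
  moreover have "q + of_int 0 *\<^sub>R p0 \<kappa> \<in> coset \<kappa> q" unfolding coset_def by blast
  ultimately show "\<exists>k::int. q = p + of_int k *\<^sub>R p0 \<kappa>" unfolding coset_def by auto
next
  assume "\<exists>k::int. q = p + of_int k *\<^sub>R p0 \<kappa>"
  then obtain k :: int where k: "q = p + of_int k *\<^sub>R p0 \<kappa>" by blast
  show "coset \<kappa> p = coset \<kappa> q"
  proof (intro equalityI subsetI)
    fix x assume "x \<in> coset \<kappa> p"
    then obtain l :: int where "x = p + of_int l *\<^sub>R p0 \<kappa>" unfolding coset_def by blast
    then have "x = q + of_int (l - k) *\<^sub>R p0 \<kappa>" by (simp add: k algebra_simps)
    then show "x \<in> coset \<kappa> q" unfolding coset_def by blast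
  next
    fix x assume "x \<in> coset \<kappa> q"
    then obtain l :: int where "x = q + of_int l *\<^sub>R p0 \<kappa>" unfolding coset_def by blast
    then have "x = p + of_int (k + l) *\<^sub>R p0 \<kappa>" by (simp add: k algebra_simps)
    then show "x \<in> coset \<kappa> p" unfolding coset_def by blast
  qed
qed

lemma modp_eq_iff:
  assumes "\<alpha> > 0"
  shows "modp \<alpha> \<kappa> X = modp \<alpha> \<kappa> Z \<longleftrightarrow> (\<exists>k::int. Z = X + of_int k *\<^sub>R p0 \<kappa>)"
proof
  assume "modp \<alpha> \<kappa> X = modp \<alpha> \<kappa> Z"
  then obtain k :: int where k: "projP \<alpha> Z = projP \<alpha> X + of_int k *\<^sub>R p0 \<kappa>" and "projQ \<alpha> X = projQ \<alpha> Z"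
    by (auto simp: modp_def coset_eq_iff)
  then have "Z = X + of_int k *\<^sub>R p0 \<kappa>" unfolding projQ_def by (simp add: algebra_simps)
  then show "\<exists>k::int. Z = X + of_int k *\<^sub>R p0 \<kappa>" by blast
next
  assume "\<exists>k::int. Z = X + of_int k *\<^sub>R p0 \<kappa>"
  then obtain k :: int where "Z = X + of_int k *\<^sub>R p0 \<kappa>" by blast
  then have "projP \<alpha> Z = projP \<alpha> X + of_int k *\<^sub>R p0 \<kappa>" "projQ \<alpha> X = projQ \<alpha> Z"
    using assms by (simp_all add: projP_eq projQ_eq p0_def algebra_simps)
  then show "modp \<alpha> \<kappa> X = modp \<alpha> \<kappa> Z" by (auto simp: modp_def coset_eq_iff)
qed

lemma induced_modp:
  assumes "\<alpha> > 0" and F: "\<And>x (k::int). F (x + of_int k *\<^sub>R p0 \<kappa>) = F x + of_int k *\<^sub>R p0 \<kappa>"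
  shows "induced \<alpha> \<kappa> F (modp \<alpha> \<kappa> y) = modp \<alpha> \<kappa> (F y)"
proof -
  define Z where "Z = (SOME Z. modp \<alpha> \<kappa> Z = modp \<alpha> \<kappa> y)"
  have "modp \<alpha> \<kappa> Z = modp \<alpha> \<kappa> y" unfolding Z_def by (rule someI) (rule refl)
  then obtain k :: int where "y = Z + of_int k *\<^sub>R p0 \<kappa>" using modp_eq_iff[OF assms(1)] by metis
  then have "F y = F Z + of_int k *\<^sub>R p0 \<kappa>" by (simp add: F)
  then have "modp \<alpha> \<kappa> (F Z) = modp \<alpha> \<kappa> (F y)" using modp_eq_iff[OF assms(1)] by metis
  then show ?thesis by (simp add: induced_def Z_def)
qed

lemma continuous_on_projP:
  assumes "\<alpha> > 0"
  shows "continuous_on UNIV (projP \<alpha> :: 'i::finite phase \<Rightarrow> 'i phase)"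
proof -
  have "projP \<alpha> = (\<lambda>Y :: 'i phase. hcoord \<alpha> Y *\<^sub>R eta0)"
    using assms by (intro ext projP_eq)
  then show ?thesis
    by (simp only: linear_continuous_on[OF bounded_linear_scaleR_const[OF bounded_linear_hcoord]])
qed

lemma continuous_map_modp:
  assumes "\<alpha> > 0"
  shows "continuous_map euclidean (Emod_top \<alpha> \<kappa>) (modp \<alpha> \<kappa>)"
  unfolding Emod_top_def continuous_map_pairwise
proof
  have "continuous_map euclidean (top_of_set E1) (projP \<alpha>)"
    using continuous_on_projP[OF assms] assms
    by (intro continuous_map_into_subtopology) (simp_all add: projP_eq Pi_def)
  from continuous_map_compose[OF this quotient_imp_continuous_map[OF quotient_map_coset]]
  show "continuous_map euclidean (circle_top \<kappa>) (fst \<circ> modp \<alpha> \<kappa>)"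
    by (simp add: modp_def o_def)
  have "continuous_on UNIV (projQ \<alpha>)"
    unfolding projQ_def[abs_def] by (intro continuous_intros continuous_on_projP assms)
  then have "continuous_map euclidean (top_of_set (E2 \<alpha>)) (projQ \<alpha>)"
    using assms by (intro continuous_map_into_subtopology) (auto simp: projQ_eq E2_eq)
  then show "continuous_map euclidean (top_of_set (E2 \<alpha>)) (snd \<circ> modp \<alpha> \<kappa>)"
    by (simp add: modp_def o_def)
qed

lemma openin_coset_image:
  assumes "open U"
  shows "openin (circle_top \<kappa>) (coset \<kappa> ` (E1 \<inter> U))"
  unfolding openin_circle_top
proof
  have "{x \<in> E1. coset \<kappa> x \<in> coset \<kappa> ` (E1 \<inter> U)} = E1 \<inter> (\<Union>k::int. {x. x + of_int k *\<^sub>R p0 \<kappa> \<in> U})"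
  proof (intro equalityI subsetI)
    fix x assume "x \<in> {x \<in> E1. coset \<kappa> x \<in> coset \<kappa> ` (E1 \<inter> U)}"
    then obtain y where "x \<in> E1" "y \<in> U" "coset \<kappa> x = coset \<kappa> y" by auto
    then show "x \<in> E1 \<inter> (\<Union>k::int. {x. x + of_int k *\<^sub>R p0 \<kappa> \<in> U})" by (auto simp: coset_eq_iff)
  next
    fix x assume "x \<in> E1 \<inter> (\<Union>k::int. {x. x + of_int k *\<^sub>R p0 \<kappa> \<in> U})"
    then obtain k :: int where k: "x \<in> E1" "x + of_int k *\<^sub>R p0 \<kappa> \<in> U" by auto
    have "x + of_int k *\<^sub>R p0 \<kappa> \<in> E1"
      using k(1) by (auto simp: E1_eq p0_def simp flip: scaleR_left_distrib)
    moreover have "coset \<kappa> x = coset \<kappa> (x + of_int k *\<^sub>R p0 \<kappa>)" unfolding coset_eq_iff by blast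
    ultimately show "x \<in> {x \<in> E1. coset \<kappa> x \<in> coset \<kappa> ` (E1 \<inter> U)}" using k by blast
  qed
  moreover have "open (\<Union>k::int. {x. x + of_int k *\<^sub>R p0 \<kappa> \<in> U})"
    by (intro open_UN ballI open_vimage[OF assms, unfolded vimage_def] continuous_intros)
  ultimately show "openin (top_of_set E1) {x \<in> E1. coset \<kappa> x \<in> coset \<kappa> ` (E1 \<inter> U)}"
    by (auto simp: openin_open)
qed auto

text \<open>Closures of periodic sets may be computed upstairs, because \<^term>\<open>modp \<alpha> \<kappa>\<close> is continuous and open.\<close>

lemma closure_of_modp_image:
  fixes S :: "'i::finite phase set"
  assumes \<alpha>: "\<alpha> > 0" and inv: "\<And>x (k::int). x \<in> S \<Longrightarrow> x + of_int k *\<^sub>R p0 \<kappa> \<in> S"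
  shows "modp \<alpha> \<kappa> X \<in> Emod_top \<alpha> \<kappa> closure_of (modp \<alpha> \<kappa> ` S) \<longleftrightarrow> X \<in> closure S"
proof
  assume "X \<in> closure S"
  then show "modp \<alpha> \<kappa> X \<in> Emod_top \<alpha> \<kappa> closure_of (modp \<alpha> \<kappa> ` S)"
    using continuous_map_image_closure_subset[OF continuous_map_modp[OF \<alpha>], of \<kappa> S] by auto
next
  assume X: "modp \<alpha> \<kappa> X \<in> Emod_top \<alpha> \<kappa> closure_of (modp \<alpha> \<kappa> ` S)"
  show "X \<in> closure S"
    unfolding closure_approachable
  proof (intro allI impI)
    fix e :: real assume e: "e > 0"
    define V where "V = coset \<kappa> ` (E1 \<inter> ball (projP \<alpha> X) (e / 2)) \<times> (E2 \<alpha> \<inter> ball (projQ \<alpha> X) (e / 2))"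
    have "openin (Emod_top \<alpha> \<kappa>) V"
      unfolding V_def Emod_top_def openin_prod_Times_iff
      by (auto intro!: disjI2 openin_coset_image openin_open_Int)
    moreover have "modp \<alpha> \<kappa> X \<in> V"
      using e \<alpha> by (auto simp: V_def modp_def projP_eq projQ_eq E2_eq)
    ultimately obtain y where y: "y \<in> S" "modp \<alpha> \<kappa> y \<in> V"
      using X unfolding in_closure_of by blast
    then obtain i where i: "coset \<kappa> (projP \<alpha> y) = coset \<kappa> i" "dist (projP \<alpha> X) i < e / 2"
      and Q: "dist (projQ \<alpha> X) (projQ \<alpha> y) < e / 2"
      by (auto simp: V_def modp_def)
    then obtain k :: int where k: "i = projP \<alpha> y + of_int k *\<^sub>R p0 \<kappa>" by (auto simp: coset_eq_iff)
    define y' where "y' = y + of_int k *\<^sub>R p0 \<kappa>"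
    have "y' - X = (i - projP \<alpha> X) + (projQ \<alpha> y - projQ \<alpha> X)"
      by (simp add: y'_def k projQ_def)
    then have "dist y' X \<le> dist (projP \<alpha> X) i + dist (projQ \<alpha> X) (projQ \<alpha> y)"
      by (metis dist_commute dist_norm norm_triangle_ineq)
    then have "dist y' X < e" using i(2) Q by simp
    moreover have "y' \<in> S" unfolding y'_def by (rule inv[OF y(1)])
    ultimately show "\<exists>y\<in>S. dist y X < e" by blast
  qed
qed

context noise_system
begin

lemma modp_mem_attractor_Y:
  assumes \<omega>: "\<omega> \<in> \<Omega>"
  shows "modp \<alpha> \<kappa> X \<in> attractor_Y \<alpha> \<kappa> Y (absorbing \<alpha> \<kappa> nrm R0) \<omega> \<longleftrightarrow> X \<in> att \<omega>"
proof -
  have "(\<Union>\<tau>\<in>{t..}. induced \<alpha> \<kappa> (Y \<tau> (theta (- \<tau>) \<omega>)) ` absorbing \<alpha> \<kappa> nrm R0 (theta (- \<tau>) \<omega>))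
      = modp \<alpha> \<kappa> ` tail \<omega> t" if t: "t > 0" for t
  proof -
    have "induced \<alpha> \<kappa> (Y \<tau> (theta (- \<tau>) \<omega>)) ` absorbing \<alpha> \<kappa> nrm R0 (theta (- \<tau>) \<omega>)
        = modp \<alpha> \<kappa> ` img \<omega> \<tau>" if "\<tau> \<in> {t..}" for \<tau>
    proof -
      have "induced \<alpha> \<kappa> (Y \<tau> (theta (- \<tau>) \<omega>)) (modp \<alpha> \<kappa> y) = modp \<alpha> \<kappa> (Y \<tau> (theta (- \<tau>) \<omega>) y)" for y
        using that t by (intro induced_modp[OF pos(1)] Y_translate[OF \<omega>]) auto
      then show ?thesis by (simp add: absorbing_def img_def slab_def image_image)
    qed
    then show ?thesis unfolding tail_def by auto
  qed
  then have "modp \<alpha> \<kappa> X \<in> attractor_Y \<alpha> \<kappa> Y (absorbing \<alpha> \<kappa> nrm R0) \<omega>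
      \<longleftrightarrow> (\<forall>t\<in>{0<..}. modp \<alpha> \<kappa> X \<in> Emod_top \<alpha> \<kappa> closure_of (modp \<alpha> \<kappa> ` tail \<omega> t))"
    by (simp add: attractor_Y_def)
  also have "\<dots> \<longleftrightarrow> X \<in> att \<omega>"
    unfolding att_def INT_iff
    by (intro ball_cong refl closure_of_modp_image[OF pos(1)] tail_translate[OF \<omega>]) auto
  finally show ?thesis .
qed

lemma attractor_phi_eq:
  assumes \<omega>: "\<omega> \<in> \<Omega>"
  shows "attractor_phi \<alpha> \<kappa> \<epsilon> Y (absorbing \<alpha> \<kappa> nrm R0) \<omega> = (\<lambda>x. x + (0, ou \<epsilon> \<omega>)) ` att \<omega>"
proof (intro equalityI subsetI)
  fix x assume "x \<in> attractor_phi \<alpha> \<kappa> \<epsilon> Y (absorbing \<alpha> \<kappa> nrm R0) \<omega>"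
  then obtain y where y: "modp \<alpha> \<kappa> x = modp \<alpha> \<kappa> (y + (0, ou \<epsilon> \<omega>))" "y \<in> att \<omega>"
    by (auto simp: attractor_phi_def attractor_Phi_def modp_mem_attractor_Y[OF \<omega>])
  then obtain k :: int where "x = y + (0, ou \<epsilon> \<omega>) + of_int k *\<^sub>R p0 \<kappa>"
    using modp_eq_iff[OF pos(1)] by metis
  then have "x = (y + of_int k *\<^sub>R p0 \<kappa>) + (0, ou \<epsilon> \<omega>)" by simp
  then show "x \<in> (\<lambda>x. x + (0, ou \<epsilon> \<omega>)) ` att \<omega>"
    using att_translate[OF \<omega> y(2)] by blast
next
  fix x assume "x \<in> (\<lambda>x. x + (0, ou \<epsilon> \<omega>)) ` att \<omega>"
  then show "x \<in> attractor_phi \<alpha> \<kappa> \<epsilon> Y (absorbing \<alpha> \<kappa> nrm R0) \<omega>"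
    using modp_mem_attractor_Y[OF \<omega>] unfolding attractor_phi_def attractor_Phi_def by blast
qed

end


section \<open>Measurability of the forcing and convergence of Euler polygons\<close>

text \<open>A function that is measurable in its first argument and continuous in its second is
  jointly measurable, being the limit of functions of a discretised second argument.\<close>

lemma borel_measurable_caratheodory:
  fixes f :: "'a \<Rightarrow> real \<Rightarrow> real"
  assumes meas: "\<And>s. (\<lambda>x. f x s) \<in> borel_measurable M"
    and cont: "\<And>x. x \<in> space M \<Longrightarrow> continuous_on UNIV (f x)"
  shows "case_prod f \<in> borel_measurable (M \<Otimes>\<^sub>M lborel)"
proof -
  define d where "d = (\<lambda>n s. real_of_int \<lfloor>s * real (Suc n)\<rfloor> / real (Suc n))"
  have "(\<lambda>p. f (fst p) (real_of_int \<lfloor>snd p * real (Suc n)\<rfloor> / real (Suc n))) \<in> borel_measurable (M \<Otimes>\<^sub>M lborel)" for n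
  proof (rule measurable_compose_countable[where f = "\<lambda>i p. f (fst p) (real_of_int i / real (Suc n))"])
    show "(\<lambda>p. f (fst p) (real_of_int i / real (Suc n))) \<in> borel_measurable (M \<Otimes>\<^sub>M lborel)" for i
      by (rule measurable_compose[OF measurable_fst meas])
    have "(\<lambda>p. snd p * real (Suc n)) \<in> borel_measurable (M \<Otimes>\<^sub>M (lborel :: real measure))"
      using measurable_snd[of M "lborel :: real measure"] by (simp add: borel_measurable_times)
    from measurable_compose[OF this measurable_real_floor]
    show "(\<lambda>p. \<lfloor>snd p * real (Suc n)\<rfloor>) \<in> measurable (M \<Otimes>\<^sub>M lborel) (count_space UNIV)" .
  qed
  then have 1: "(\<lambda>p. f (fst p) (d n (snd p))) \<in> borel_measurable (M \<Otimes>\<^sub>M lborel)" for n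
    by (simp only: d_def)
  have "\<bar>d n s - s\<bar> \<le> 1 / real (Suc n)" for n s
  proof -
    have "\<bar>real_of_int \<lfloor>s * real (Suc n)\<rfloor> - s * real (Suc n)\<bar> \<le> 1" by linarith
    then have "\<bar>real_of_int \<lfloor>s * real (Suc n)\<rfloor> - s * real (Suc n)\<bar> / real (Suc n) \<le> 1 / real (Suc n)"
      by (intro divide_right_mono) auto
    moreover have "d n s - s = (real_of_int \<lfloor>s * real (Suc n)\<rfloor> - s * real (Suc n)) / real (Suc n)"
      unfolding d_def by (simp add: diff_divide_distrib del: of_nat_Suc)
    ultimately show ?thesis by (simp add: abs_divide del: of_nat_Suc)
  qed
  then have "(\<lambda>n. d n s - s) \<longlonglongrightarrow> 0" for s
    by (intro Lim_null_comparison[OF _ LIMSEQ_inverse_real_of_nat]) (auto simp: inverse_eq_divide)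
  then have d: "(\<lambda>n. d n s) \<longlonglongrightarrow> s" for s by (simp add: LIM_zero_iff)
  have 2: "(\<lambda>n. f (fst p) (d n (snd p))) \<longlonglongrightarrow> case_prod f p"
    if p: "p \<in> space (M \<Otimes>\<^sub>M (lborel :: real measure))" for p
  proof -
    have "isCont (f (fst p)) (snd p)"
      using cont[of "fst p"] p by (auto simp: space_pair_measure continuous_on_eq_continuous_at)
    from isCont_tendsto_compose[OF this d] show ?thesis by (simp add: case_prod_beta)
  qed
  show ?thesis by (rule borel_measurable_LIMSEQ_metric[OF 1 2])
qed

lemma wiener_evaluation_measurable:
  assumes W: "two_sided_wiener W"
  shows "(\<lambda>w. w s) \<in> borel_measurable W"
proof (rule borel_measurableI)
  fix U :: "real set" assume "open U"
  have W': "space W = C0" "sets W = sigma_sets C0 {U. openin compact_open_C0 U}"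
    using W by (auto simp: two_sided_wiener_def)
  have "(\<lambda>w. w s) -` U \<inter> space W = {w \<in> C0. w ` {s} \<subseteq> U}" by (auto simp: W')
  moreover have "openin compact_open_C0 {w \<in> C0. w ` {s} \<subseteq> U}"
    unfolding compact_open_C0_def using \<open>open U\<close>
    by (intro topology_generated_by_Basis) (blast intro: compact_sing)
  ultimately show "(\<lambda>w. w s) -` U \<inter> space W \<in> sets W"
    by (auto simp: W' intro: sigma_sets.Basic)
qed

lemma ou_theta_measurable:
  fixes \<epsilon> :: "real ^ 'i::finite"
  assumes W: "two_sided_wiener W"
  shows "(\<lambda>\<omega>. ou \<epsilon> (theta t \<omega>)) \<in> borel_measurable (PiM UNIV (\<lambda>_. W))"
proof -
  let ?F = "PiM (UNIV :: 'i set) (\<lambda>_. W)"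
  have ev: "(\<lambda>\<omega>. \<omega> j s) \<in> borel_measurable ?F" for j s
    using measurable_compose[OF measurable_component_singleton[of j UNIV "\<lambda>_. W"]
        wiener_evaluation_measurable[OF W, of s]] by simp
  have path: "continuous_on UNIV (\<omega> j)" if "\<omega> \<in> space ?F" for \<omega> j
  proof -
    have "\<omega> j \<in> space W" using that by (auto simp: space_PiM)
    moreover have "space W = C0" using W[unfolded two_sided_wiener_def] by (elim conjE)
    ultimately show ?thesis by (simp add: C0_def)
  qed
  have int: "(\<lambda>\<omega>. LINT s:{..0}|lborel. exp s * theta t \<omega> j s) \<in> borel_measurable ?F" for j
  proof -
    have joint: "case_prod (\<lambda>\<omega> s. exp s * (\<omega> j (s + t) - \<omega> j t)) \<in> borel_measurable (?F \<Otimes>\<^sub>M lborel)"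
    proof (rule borel_measurable_caratheodory)
      show "(\<lambda>\<omega>. exp s * (\<omega> j (s + t) - \<omega> j t)) \<in> borel_measurable ?F" for s
        by (intro borel_measurable_times borel_measurable_diff ev borel_measurable_const)
      show "continuous_on UNIV (\<lambda>s. exp s * (\<omega> j (s + t) - \<omega> j t))" if "\<omega> \<in> space ?F" for \<omega>
      proof -
        have "continuous_on UNIV (\<lambda>s. \<omega> j (s + t))"
          using continuous_on_compose[OF continuous_on_add[OF continuous_on_id continuous_on_const[of _ t]]
              continuous_on_subset[OF path[OF that, of j] subset_UNIV]] by (simp add: o_def)
        then show ?thesis
          by (intro continuous_on_mult continuous_on_diff continuous_on_exp continuous_on_id continuous_on_const)
      qed
    qed
    have "(\<lambda>p. indicat_real {..0} (snd p)) \<in> borel_measurable (?F \<Otimes>\<^sub>M (lborel :: real measure))"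
      by (rule measurable_compose[OF measurable_snd]) simp
    from borel_measurable_scaleR[OF this joint]
    have "case_prod (\<lambda>\<omega> s. indicat_real {..0} s *\<^sub>R (exp s * (\<omega> j (s + t) - \<omega> j t)))
        \<in> borel_measurable (?F \<Otimes>\<^sub>M lborel)"
      by (simp only: split_def)
    from lborel.borel_measurable_lebesgue_integral[OF this] show ?thesis
      unfolding set_lebesgue_integral_def theta_def .
  qed
  show ?thesis
  proof (rule borel_measurable_euclidean_space[THEN iffD2], rule ballI)
    fix b :: "real ^ 'i" assume "b \<in> Basis"
    then obtain j where b: "b = axis j 1" by (auto simp: Basis_vec_def)
    have "(\<lambda>\<omega>. - (\<epsilon> $ j) * (LINT s:{..0}|lborel. exp s * theta t \<omega> j s)) \<in> borel_measurable ?F"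
      by (intro borel_measurable_times borel_measurable_const int)
    then show "(\<lambda>\<omega>. ou \<epsilon> (theta t \<omega>) \<bullet> b) \<in> borel_measurable ?F"
      by (simp add: b inner_axis ou_def)
  qed
qed

text \<open>The \<^term>\<open>k\<close>-th vertex of the Euler polygon with step \<^term>\<open>h\<close> started at time zero.\<close>

primrec euler :: "(real \<Rightarrow> 'a::real_normed_vector \<Rightarrow> 'a) \<Rightarrow> 'a \<Rightarrow> real \<Rightarrow> nat \<Rightarrow> 'a" where
  "euler F x h 0 = x"
| "euler F x h (Suc k) = euler F x h k + h *\<^sub>R F (real k * h) (euler F x h k)"

text \<open>\<^term>\<open>e\<close> bounds the local error per unit of time; the factor \<^term>\<open>(1 + h * L) ^ k\<close> accounts
  for its propagation.\<close>

lemma euler_error: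
  fixes X :: "real \<Rightarrow> 'a::real_normed_vector"
  assumes h: "0 \<le> h" and L: "0 \<le> L" and e: "0 \<le> e"
    and lip: "\<And>t x y. norm (F t x - F t y) \<le> L * norm (x - y)"
    and step: "\<And>k. k < n \<Longrightarrow>
      norm (X (real (Suc k) * h) - X (real k * h) - h *\<^sub>R F (real k * h) (X (real k * h))) \<le> h * e"
    and k: "k \<le> n"
  shows "norm (euler F (X 0) h k - X (real k * h)) \<le> real k * h * e * (1 + h * L) ^ k"
  using k
proof (induction k)
  case (Suc k)
  let ?t = "real k * h" and ?E = "euler F (X 0) h k"
  let ?d = "F ?t ?E - F ?t (X ?t)" and ?s = "X (real (Suc k) * h) - X ?t - h *\<^sub>R F ?t (X ?t)"
  have eq: "euler F (X 0) h (Suc k) - X (real (Suc k) * h) = (?E - X ?t) + h *\<^sub>R ?d - ?s"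
    by (simp add: algebra_simps)
  have "norm (euler F (X 0) h (Suc k) - X (real (Suc k) * h))
      \<le> norm (?E - X ?t) + norm (h *\<^sub>R ?d) + norm ?s"
    unfolding eq
    using norm_triangle_ineq4[of "(?E - X ?t) + h *\<^sub>R ?d" ?s] norm_triangle_ineq[of "?E - X ?t" "h *\<^sub>R ?d"]
    by linarith
  also have "norm (h *\<^sub>R ?d) = h * norm ?d" using h by simp
  also have "norm (?E - X ?t) + h * norm ?d + norm ?s \<le> norm (?E - X ?t) + h * (L * norm (?E - X ?t)) + h * e"
    using step[of k] Suc.prems by (intro add_mono mult_left_mono lip h order_refl) simp
  also have "\<dots> = (1 + h * L) * norm (?E - X ?t) + h * e" by (simp add: algebra_simps)
  also have "\<dots> \<le> (1 + h * L) * (real k * h * e * (1 + h * L) ^ k) + h * e * (1 + h * L) ^ Suc k"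
  proof (intro add_mono mult_left_mono)
    show "norm (?E - X ?t) \<le> real k * h * e * (1 + h * L) ^ k" using Suc by simp
    show "0 \<le> 1 + h * L" using h L by simp
    have "1 \<le> (1 + h * L) ^ Suc k" using h L by (intro one_le_power) simp
    then have "h * e * 1 \<le> h * e * (1 + h * L) ^ Suc k" using h e by (intro mult_left_mono) simp_all
    then show "h * e \<le> h * e * (1 + h * L) ^ Suc k" by simp
  qed
  also have "\<dots> = real (Suc k) * h * e * (1 + h * L) ^ Suc k" by (simp add: algebra_simps)
  finally show ?case .
qed simp

lemma euler_converges:
  fixes X :: "real \<Rightarrow> 'a::real_normed_vector"
  assumes T: "0 \<le> T" and L: "0 \<le> L"
    and der: "\<And>t. t \<in> {0..T} \<Longrightarrow> (X has_vector_derivative F t (X t)) (at t within {0..T})"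
    and lip: "\<And>t x y. norm (F t x - F t y) \<le> L * norm (x - y)"
    and cont: "continuous_on {0..T} (\<lambda>t. F t (X t))"
  shows "(\<lambda>n. euler F (X 0) (T / real (Suc n)) (Suc n)) \<longlonglongrightarrow> X T"
proof (rule LIMSEQ_I)
  fix c :: real assume c: "0 < c"
  define s where "s = (T + 1) * exp (L * T)"
  have s: "0 < s" using T by (simp add: s_def)
  define e where "e = c / (2 * s)"
  have e: "0 < e" using c s by (simp add: e_def)
  have "uniformly_continuous_on {0..T} (\<lambda>t. F t (X t))"
    by (rule compact_uniformly_continuous[OF cont]) simp
  then obtain d where d: "0 < d"
    "\<And>s t. s \<in> {0..T} \<Longrightarrow> t \<in> {0..T} \<Longrightarrow> dist t s < d \<Longrightarrow> dist (F t (X t)) (F s (X s)) < e"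
    using e unfolding uniformly_continuous_on_def by metis
  obtain N :: nat where N: "T / d < real N" using reals_Archimedean2 by blast
  show "\<exists>N. \<forall>n\<ge>N. norm (euler F (X 0) (T / real (Suc n)) (Suc n) - X T) < c"
  proof (intro exI[of _ N] allI impI)
    fix n assume n: "N \<le> n"
    define h where "h = T / real (Suc n)"
    have h: "0 \<le> h" using T by (simp add: h_def)
    have nh: "real (Suc n) * h = T" by (simp add: h_def)
    have "T / d < real (Suc n)" using N n by linarith
    then have hd: "h < d" using d(1) by (simp add: h_def field_simps)
    have "norm (X (real (Suc k) * h) - X (real k * h) - h *\<^sub>R F (real k * h) (X (real k * h))) \<le> h * e"
      if k: "k < Suc n" for k
    proof -
      let ?t = "real k * h" and ?u = "real (Suc k) * h"
      have tu: "?u = ?t + h" by (simp add: algebra_simps)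
      have u: "?u \<le> T" unfolding nh[symmetric] using k h by (intro mult_right_mono) auto
      have sub: "{?t..?u} \<subseteq> {0..T}" using u h by (auto intro: order_trans)
      have "norm (X ?u - X ?t - (?u - ?t) *\<^sub>R F ?t (X ?t)) \<le> norm (?u - ?t) * e"
      proof (rule vector_differentiable_bound_linearization[where S = "{?t..?u}" and f' = "\<lambda>t. F t (X t)"])
        show "(X has_vector_derivative F x (X x)) (at x within {?t..?u})" if "x \<in> {?t..?u}" for x
          using has_vector_derivative_within_subset[OF der sub] that sub by blast
        show "closed_segment ?t ?u \<subseteq> {?t..?u}" using h tu by (simp add: closed_segment_eq_real_ivl)
        show "?t \<in> {?t..?u}" using h tu by simp
        show "norm (F x (X x) - F ?t (X ?t)) \<le> e" if "x \<in> {?t..?u}" for x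
        proof -
          have "dist x ?t < d" using that tu hd by (auto simp: dist_real_def)
          then have "dist (F x (X x)) (F ?t (X ?t)) < e"
            using subsetD[OF sub that] subsetD[OF sub, of ?t] h tu by (intro d(2)) simp_all
          then show ?thesis by (simp add: dist_norm)
        qed
      qed
      moreover have "?u - ?t = h" by (simp add: algebra_simps)
      ultimately show ?thesis using h by (simp only: real_norm_def abs_of_nonneg)
    qed
    from euler_error[where F = F and X = X and n = "Suc n" and k = "Suc n", OF h L less_imp_le[OF e] lip this]
    have "norm (euler F (X 0) h (Suc n) - X T) \<le> T * e * (1 + h * L) ^ Suc n"
      unfolding nh by simp
    also have "\<dots> \<le> T * e * exp (h * L) ^ Suc n"
      using h L T e by (intro mult_left_mono power_mono exp_ge_add_one_self) simp_all
    also have "exp (h * L) ^ Suc n = exp (real (Suc n) * (h * L))"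
      by (simp only: exp_of_nat_mult)
    also have "real (Suc n) * (h * L) = L * T"
      unfolding nh[symmetric] by (simp only: mult_ac)
    finally have "norm (euler F (X 0) h (Suc n) - X T) \<le> T * e * exp (L * T)" .
    also have "\<dots> \<le> e * s" using e by (simp add: s_def algebra_simps)
    also have "\<dots> = c / 2" using s by (simp add: e_def)
    finally show "norm (euler F (X 0) (T / real (Suc n)) (Suc n) - X T) < c"
      using c by (simp add: h_def)
  qed
qed


section \<open>Measurability of the attractor\<close>

context damped_system
begin

lemma continuous_g: "continuous_on UNIV g"
proof (rule lipschitz_on_continuous_on[OF lipschitz_onI])
  show "0 \<le> c2" by (rule c2)
  show "dist (g x) (g y) \<le> c2 * dist x y" for x y using g_lipschitz by (simp add: dist_real_def)
qed

lemma continuous_vf: "continuous_on UNIV (\<lambda>p. vf (fst p) (snd p))"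
proof -
  have A: "continuous_on UNIV (\<lambda>p :: (real ^ 'i) \<times> 'i phase. A *v fst (snd p))"
    by (intro bounded_linear.continuous_on[OF matrix_vector_mul_bounded_linear]
        continuous_on_fst continuous_on_snd continuous_on_id)
  have "continuous_on UNIV (\<lambda>p :: (real ^ 'i) \<times> 'i phase. g (fst (snd p) $ j))" for j
    by (rule continuous_on_compose2[OF continuous_g, where f = "\<lambda>p. fst (snd p) $ j"])
       (intro continuous_on_component continuous_on_fst continuous_on_snd continuous_on_id, simp)
  then have G: "continuous_on UNIV (\<lambda>p :: (real ^ 'i) \<times> 'i phase. \<chi> j. g (fst (snd p) $ j))"
    by (intro continuous_on_vec_lambda)
  show ?thesis
    unfolding vfield_def Let_def
    by (intro continuous_on_Pair continuous_on_add continuous_on_diff continuous_on_minus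
        continuous_on_scaleR continuous_on_const A G continuous_on_fst continuous_on_snd continuous_on_id)
qed

lemma vf_lipschitz:
  obtains L where "0 \<le> L" "\<And>z x y. norm (vf z x - vf z y) \<le> L * norm (x - y)"
proof -
  have "bounded_linear gen"
    by (intro linear_conv_bounded_linear[THEN iffD1] linearI)
       (simp_all add: gen_def matrix_vector_right_distrib matrix_vector_mult_scaleR algebra_simps)
  then obtain C where C: "0 < C" "\<And>x. norm (gen x) \<le> norm x * C"
    using bounded_linear.pos_bounded by blast
  have "norm (vf z x - vf z y) \<le> (C + \<bar>\<beta>\<bar> * c2) * norm (x - y)" for z x y
  proof -
    have "norm (vf z x - vf z y) \<le> norm (gen (x - y)) + norm (nonlin (fst x) - nonlin (fst y))"
      unfolding vf_diff by (rule norm_triangle_ineq)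
    also have "\<dots> \<le> norm (x - y) * C + \<bar>\<beta>\<bar> * c2 * norm (fst (x - y))"
      using C(2) norm_nonlin_diff by (intro add_mono) simp_all
    also have "\<dots> \<le> norm (x - y) * C + \<bar>\<beta>\<bar> * c2 * norm (x - y)"
    proof -
      have "norm (fst (x - y)) \<le> norm (x - y)"
        by (metis Product_Vector.norm_fst_le prod.collapse)
      then show ?thesis using c2 by (intro add_left_mono mult_left_mono) simp_all
    qed
    finally show ?thesis by (simp add: algebra_simps)
  qed
  then show thesis using that[of "C + \<bar>\<beta>\<bar> * c2"] C(1) c2 by simp
qed

end

context noise_system
begin

text \<open>Solution values depend measurably on the noise: they are limits of Euler polygons, whose
  vertices depend continuously on finitely many values of the stationary process.\<close>

lemma Y_measurable:
  assumes sp: "space M = \<Omega>" and meas: "\<And>t. (\<lambda>\<omega>. ou \<epsilon> (theta t \<omega>)) \<in> borel_measurable M"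
    and cont: "\<And>\<omega>. \<omega> \<in> \<Omega> \<Longrightarrow> continuous_on UNIV (\<lambda>t. ou \<epsilon> (theta t \<omega>))"
    and T: "0 \<le> T"
  shows "(\<lambda>\<omega>. Y T (theta (- T) \<omega>) y) \<in> borel_measurable M"
proof (rule borel_measurable_LIMSEQ_metric)
  have pair: "(\<lambda>\<omega>. vf (u \<omega>) (x \<omega>)) \<in> borel_measurable M"
    if "u \<in> borel_measurable M" "x \<in> borel_measurable M" for u x
    by (rule borel_measurable_continuous_Pair[OF that continuous_vf])
  have "(\<lambda>\<omega>. euler (\<lambda>t. vf (past \<omega> T t)) y h k) \<in> borel_measurable M" for h k
  proof (induction k)
    case (Suc k)
    have "(\<lambda>\<omega>. past \<omega> T t) \<in> borel_measurable M" for t unfolding past_def by (rule meas)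
    then show ?case
      by (simp only: euler.simps) (intro borel_measurable_add borel_measurable_scaleR borel_measurable_const Suc pair)
  qed simp
  then show "(\<lambda>\<omega>. euler (\<lambda>t. vf (past \<omega> T t)) y (T / real (Suc n)) (Suc n)) \<in> borel_measurable M" for n .
next
  fix \<omega> assume "\<omega> \<in> space M"
  then have \<omega>: "\<omega> \<in> \<Omega>" using sp by simp
  define X where "X = (\<lambda>t. Y t (theta (- T) \<omega>) y)"
  have X: "solves (past \<omega> T) T X" unfolding X_def by (rule Y_solves_full[OF \<omega> T])
  obtain L where L: "0 \<le> L" "\<And>z x y. norm (vf z x - vf z y) \<le> L * norm (x - y)"
    using vf_lipschitz by blast
  have contX: "continuous_on {0..T} X"
    unfolding continuous_on_eq_continuous_within
    using has_vector_derivative_continuous X[unfolded solves_def] by blast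
  have contp: "continuous_on {0..T} (past \<omega> T)"
    unfolding past_def
    by (rule continuous_on_compose2[OF cont[OF \<omega>], where f = "\<lambda>t. t - T"])
       (intro continuous_on_diff continuous_on_id continuous_on_const, simp)
  have "continuous_on {0..T} (\<lambda>t. vf (past \<omega> T t) (X t))"
    using continuous_on_compose2[OF continuous_vf continuous_on_Pair[OF contp contX]] by simp
  from euler_converges[where F = "\<lambda>t. vf (past \<omega> T t)", OF T L(1) X[unfolded solves_def, rule_format] L(2) this]
  show "(\<lambda>n. euler (\<lambda>t. vf (past \<omega> T t)) y (T / real (Suc n)) (Suc n)) \<longlonglongrightarrow> Y T (theta (- T) \<omega>) y"
    by (simp add: X_def Y_zero[OF theta_mem[OF \<omega>]])
qed

lemma nrm_INF_le:
  assumes "y \<in> S"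
  shows "(INF y\<in>S. nrm (x - y)) \<le> nrm (x - y)"
  by (rule cINF_lower[OF _ assms]) (auto intro: bdd_belowI[of _ 0])

lemma nrm_scaleR: "nrm (c *\<^sub>R X) = \<bar>c\<bar> * nrm X"
  by (simp add: normE_def B.scaleR_left B.scaleR_right real_sqrt_mult flip: mult.assoc)

lemma nrm_diff_le_sqrt_err:
  assumes \<omega>: "\<omega> \<in> \<Omega>" and T: "0 < T" and x: "x \<in> img \<omega> T" and y: "y \<in> att \<omega>"
    and h: "hcoord \<alpha> x = hcoord \<alpha> y"
  shows "nrm (x - y) \<le> sqrt (err \<omega> T)"
proof -
  have "x \<in> closure (tail \<omega> T)"
    using x closure_subset[of "tail \<omega> T"] unfolding tail_def by auto
  moreover have "y \<in> closure (tail \<omega> T)" using y T unfolding att_def by auto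
  ultimately have "cone (x - y) (x - y) \<le> err \<omega> T"
    by (rule closure_tail_cone[OF \<omega> less_imp_le[OF T]])
  moreover have "P (x - y) = 0" "Q (x - y) = x - y" using h by (simp_all add: P_eq Q_eq)
  ultimately have "B (x - y) (x - y) \<le> err \<omega> T" by (simp add: cone_def B.zero_left)
  then show ?thesis unfolding normE_def by (rule real_sqrt_le_mono)
qed

text \<open>Flowing from time \<^term>\<open>- T\<close> to the present, the rational points of the neutral line
  approximate the attractor. The attractor and the image of the line meet the same
  fibres over \<^const>\<open>E1\<close>, and in a common fibre their points have distance at most
  \<^term>\<open>sqrt (err \<omega> T)\<close>; rational points suffice by continuity in the initial value.\<close>

lemma dist_att_approx:
  assumes \<omega>: "\<omega> \<in> \<Omega>" and T: "0 < T"
  defines "pt \<equiv> \<lambda>s. Y T (theta (- T) \<omega>) (s *\<^sub>R eta0)"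
  shows "\<bar>(INF q::rat. nrm (x - pt (of_rat q))) - (INF y\<in>att \<omega>. nrm (x - y))\<bar> \<le> sqrt (err \<omega> T)"
proof -
  have pt: "pt s \<in> img \<omega> T" for s
    using eta0_in_slab[OF theta_mem[OF \<omega>]] by (simp add: pt_def img_def)
  define I where "I = (INF q::rat. nrm (x - pt (of_rat q)))"
  define J where "J = (INF y\<in>att \<omega>. nrm (x - y))"
  have I: "I \<le> nrm (x - pt (of_rat q))" for q
    unfolding I_def by (rule cINF_lower) (auto intro: bdd_belowI[of _ 0])
  have J: "J \<le> nrm (x - y)" if "y \<in> att \<omega>" for y
    unfolding J_def by (rule nrm_INF_le[OF that])
  have ne: "att \<omega> \<noteq> {}" using att_exists[OF \<omega>] by blast
  have "J - sqrt (err \<omega> T) \<le> I"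
    unfolding I_def
  proof (rule cINF_greatest)
    fix q :: rat
    obtain y where y: "y \<in> att \<omega>" "hcoord \<alpha> y = hcoord \<alpha> (pt (of_rat q))" using att_exists[OF \<omega>] .
    show "J - sqrt (err \<omega> T) \<le> nrm (x - pt (of_rat q))"
      using J[OF y(1)] nrm_diff_triangle[of x y "pt (of_rat q)"]
        nrm_diff_le_sqrt_err[OF \<omega> T pt y(1) y(2)[symmetric]] by linarith
  qed simp
  moreover have "I - sqrt (err \<omega> T) \<le> J + \<eta>" if \<eta>: "0 < \<eta>" for \<eta>
  proof -
    have "I - sqrt (err \<omega> T) - \<eta> \<le> J"
      unfolding J_def
    proof (rule cINF_greatest[OF ne])
      fix y assume y: "y \<in> att \<omega>"
      obtain s where s: "hcoord \<alpha> (pt s) = hcoord \<alpha> y"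
        unfolding pt_def using Y_line_surj[OF \<omega> less_imp_le[OF T]] .
      define c where "c = exp (Lip * T) * nrm eta0"
      have c: "0 \<le> c" by (simp add: c_def)
      obtain q where q: "s < of_rat q" "of_rat q < s + \<eta> / (c + 1)"
        using of_rat_dense[of s "s + \<eta> / (c + 1)"] \<eta> c by auto
      have "nrm (pt s - pt (of_rat q)) \<le> exp (Lip * T) * nrm (s *\<^sub>R eta0 - of_rat q *\<^sub>R eta0)"
        unfolding pt_def by (rule Y_lipschitz[OF \<omega> less_imp_le[OF T]])
      also have "\<dots> = c * \<bar>s - of_rat q\<bar>"
        by (simp add: c_def nrm_scaleR flip: scaleR_left_diff_distrib)
      also have "\<dots> \<le> c * (\<eta> / (c + 1))" using q c by (intro mult_left_mono) auto
      also have "\<dots> \<le> \<eta>" using c \<eta> by (simp add: field_simps)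
      finally have 1: "nrm (pt s - pt (of_rat q)) \<le> \<eta>" .
      show "I - sqrt (err \<omega> T) - \<eta> \<le> nrm (x - y)"
        using I[of q] 1 nrm_diff_triangle[of x "pt (of_rat q)" "pt s"] nrm_diff_triangle[of x "pt s" y]
          nrm_diff_le_sqrt_err[OF \<omega> T pt y s] nrm_minus_commute[of "pt s" y]
        by linarith
    qed
    then show ?thesis by simp
  qed
  then have "I - sqrt (err \<omega> T) \<le> J" by (rule field_le_epsilon)
  ultimately show ?thesis unfolding I_def[symmetric] J_def[symmetric] by linarith
qed

lemma attractor_random_set:
  assumes sp: "space M = \<Omega>" and meas: "\<And>t. (\<lambda>\<omega>. ou \<epsilon> (theta t \<omega>)) \<in> borel_measurable M"
    and cont: "\<And>\<omega>. \<omega> \<in> \<Omega> \<Longrightarrow> continuous_on UNIV (\<lambda>t. ou \<epsilon> (theta t \<omega>))"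
  shows "random_set M nrm (attractor_phi \<alpha> \<kappa> \<epsilon> Y (absorbing \<alpha> \<kappa> nrm R0))"
  unfolding random_set_def
proof
  fix x :: "'i phase"
  define z where "z = (\<lambda>\<omega>. (0, ou \<epsilon> (theta 0 \<omega>)) :: 'i phase)"
  define D where "D = (\<lambda>n \<omega>. INF q::rat. nrm (x - z \<omega> -
    Y (real (Suc n)) (theta (- real (Suc n)) \<omega>) (of_rat q *\<^sub>R eta0)))"
  have nrm_meas: "nrm \<in> borel_measurable borel"
    by (rule borel_measurable_continuous_onI) (rule continuous_nrm[OF continuous_on_id])
  have "D n \<in> borel_measurable M" for n
    unfolding D_def
  proof (rule borel_measurable_cINF_real)
    fix q :: rat
    have "(\<lambda>\<omega>. x - z \<omega> - Y (real (Suc n)) (theta (- real (Suc n)) \<omega>) (of_rat q *\<^sub>R eta0)) \<in> borel_measurable M"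
    proof (intro borel_measurable_diff borel_measurable_const)
      show "z \<in> borel_measurable M"
        unfolding z_def by (rule borel_measurable_Pair[OF borel_measurable_const meas])
      show "(\<lambda>\<omega>. Y (real (Suc n)) (theta (- real (Suc n)) \<omega>) (of_rat q *\<^sub>R eta0)) \<in> borel_measurable M"
        by (rule Y_measurable[OF sp meas cont of_nat_0_le_iff])
    qed
    from measurable_compose[OF this nrm_meas]
    show "(\<lambda>\<omega>. nrm (x - z \<omega> - Y (real (Suc n)) (theta (- real (Suc n)) \<omega>) (of_rat q *\<^sub>R eta0)))
        \<in> borel_measurable M" .
  qed simp
  then show "(\<lambda>\<omega>. INF y\<in>attractor_phi \<alpha> \<kappa> \<epsilon> Y (absorbing \<alpha> \<kappa> nrm R0) \<omega>. nrm (x - y)) \<in> borel_measurable M"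
  proof (rule borel_measurable_LIMSEQ_metric)
    fix \<omega> assume "\<omega> \<in> space M"
    then have \<omega>: "\<omega> \<in> \<Omega>" using sp by simp
    have z: "z \<omega> = (0, ou \<epsilon> \<omega>)" by (simp add: z_def theta_zero omega_zero[OF \<omega>])
    have eq: "(INF y\<in>attractor_phi \<alpha> \<kappa> \<epsilon> Y (absorbing \<alpha> \<kappa> nrm R0) \<omega>. nrm (x - y))
        = (INF y\<in>att \<omega>. nrm (x - z \<omega> - y))"
    proof -
      have "x - (y + z \<omega>) = x - z \<omega> - y" for y by (simp add: diff_diff_eq add.commute)
      then show ?thesis by (simp only: attractor_phi_eq[OF \<omega>] image_image z)
    qed
    have "((\<lambda>n. err \<omega> (real (Suc n))) \<longlonglongrightarrow> 0)"
      by (rule filterlim_compose[OF err_tendsto])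
         (rule filterlim_compose[OF filterlim_real_sequentially filterlim_Suc])
    then have "(\<lambda>n. sqrt (err \<omega> (real (Suc n)))) \<longlonglongrightarrow> 0"
      using tendsto_real_sqrt[of "\<lambda>n. err \<omega> (real (Suc n))" 0] by simp
    note sqrt_err = this
    have dist: "norm (D n \<omega> - (INF y\<in>att \<omega>. nrm (x - z \<omega> - y))) \<le> sqrt (err \<omega> (real (Suc n)))" for n
      unfolding D_def real_norm_def by (rule dist_att_approx[OF \<omega>]) simp
    have "(\<lambda>n. D n \<omega> - (INF y\<in>att \<omega>. nrm (x - z \<omega> - y))) \<longlonglongrightarrow> 0"
      by (rule Lim_null_comparison[OF always_eventually[OF allI[OF dist]] sqrt_err])
    then show "(\<lambda>n. D n \<omega>) \<longlonglongrightarrow> (INF y\<in>attractor_phi \<alpha> \<kappa> \<epsilon> Y (absorbing \<alpha> \<kappa> nrm R0) \<omega>. nrm (x - y))"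
      unfolding eq by (rule LIM_zero_cancel)
  qed
qed

lemma attractor_random_horizontal_curve:
  assumes sp: "space M = \<Omega>" and meas: "\<And>t. (\<lambda>\<omega>. ou \<epsilon> (theta t \<omega>)) \<in> borel_measurable M"
    and cont: "\<And>\<omega>. \<omega> \<in> \<Omega> \<Longrightarrow> continuous_on UNIV (\<lambda>t. ou \<epsilon> (theta t \<omega>))"
  shows "random_horizontal_curve M nrm \<alpha> \<kappa> (attractor_phi \<alpha> \<kappa> \<epsilon> Y (absorbing \<alpha> \<kappa> nrm R0))"
proof -
  let ?l = "attractor_phi \<alpha> \<kappa> \<epsilon> Y (absorbing \<alpha> \<kappa> nrm R0)"
  have "\<forall>\<omega>\<in>space M. \<exists>\<Phi>. \<Phi> \<in> E1 \<rightarrow> E2 \<alpha> \<and> ?l \<omega> = {p + \<Phi> p | p. p \<in> E1} \<and>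
      (\<forall>p1\<in>E1. \<forall>p2\<in>E1. nrm (\<Phi> p1 - \<Phi> p2) \<le> nrm (p1 - p2)) \<and> (\<forall>p\<in>E1. \<Phi> (p + p0 \<kappa>) = \<Phi> p)"
  proof
    fix \<omega> assume "\<omega> \<in> space M"
    then have \<omega>: "\<omega> \<in> \<Omega>" using sp by simp
    note l = attractor_phi_eq[OF \<omega>]
    have 1: "cone (x - y) (x - y) \<le> 0" if m: "x \<in> ?l \<omega>" "y \<in> ?l \<omega>" for x y
    proof -
      obtain x' y' where "x' \<in> att \<omega>" "y' \<in> att \<omega>" "x = x' + (0, ou \<epsilon> \<omega>)" "y = y' + (0, ou \<epsilon> \<omega>)"
        using m unfolding l by blast
      then show ?thesis using att_cone[OF \<omega>, of x' y'] by (simp only: add_diff_cancel_right)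
    qed
    have 2: "\<exists>x\<in>?l \<omega>. hcoord \<alpha> x = s" for s
    proof -
      obtain x where "x \<in> att \<omega>" "hcoord \<alpha> x = s - hcoord \<alpha> (0, ou \<epsilon> \<omega>)" using att_exists[OF \<omega>] .
      then have "x + (0, ou \<epsilon> \<omega>) \<in> ?l \<omega>" "hcoord \<alpha> (x + (0, ou \<epsilon> \<omega>)) = s" by (simp_all add: l)
      then show ?thesis by blast
    qed
    have 3: "x + p0 \<kappa> \<in> ?l \<omega>" if m: "x \<in> ?l \<omega>" for x
    proof -
      obtain y where y: "y \<in> att \<omega>" "x = y + (0, ou \<epsilon> \<omega>)" using m unfolding l by blast
      have "y + p0 \<kappa> \<in> att \<omega>" using att_translate[OF \<omega> y(1), of 1] by simp
      moreover have "x + p0 \<kappa> = (y + p0 \<kappa>) + (0, ou \<epsilon> \<omega>)" by (simp only: y(2) add.assoc add.commute add.left_commute)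
      ultimately show ?thesis unfolding l by blast
    qed
    show "\<exists>\<Phi>. \<Phi> \<in> E1 \<rightarrow> E2 \<alpha> \<and> ?l \<omega> = {p + \<Phi> p | p. p \<in> E1} \<and>
      (\<forall>p1\<in>E1. \<forall>p2\<in>E1. nrm (\<Phi> p1 - \<Phi> p2) \<le> nrm (p1 - p2)) \<and> (\<forall>p\<in>E1. \<Phi> (p + p0 \<kappa>) = \<Phi> p)"
    proof (rule cone_set_is_graph[OF 1 2 3])
      fix \<Phi> :: "'i phase \<Rightarrow> 'i phase"
      assume *: "\<Phi> \<in> E1 \<rightarrow> E2 \<alpha>" "?l \<omega> = {p + \<Phi> p | p. p \<in> E1}"
        "\<forall>p1\<in>E1. \<forall>p2\<in>E1. nrm (\<Phi> p1 - \<Phi> p2) \<le> nrm (p1 - p2)" "\<forall>p\<in>E1. \<Phi> (p + p0 \<kappa>) = \<Phi> p"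
      show "\<exists>\<Phi>. \<Phi> \<in> E1 \<rightarrow> E2 \<alpha> \<and> ?l \<omega> = {p + \<Phi> p | p. p \<in> E1} \<and>
        (\<forall>p1\<in>E1. \<forall>p2\<in>E1. nrm (\<Phi> p1 - \<Phi> p2) \<le> nrm (p1 - p2)) \<and> (\<forall>p\<in>E1. \<Phi> (p + p0 \<kappa>) = \<Phi> p)"
        by (intro exI[of _ \<Phi>] conjI *)
    qed
  qed
  from bchoice[OF this] obtain \<Phi> where \<Phi>: "\<forall>\<omega>\<in>space M. \<Phi> \<omega> \<in> E1 \<rightarrow> E2 \<alpha> \<and> ?l \<omega> = {p + \<Phi> \<omega> p | p. p \<in> E1} \<and>
      (\<forall>p1\<in>E1. \<forall>p2\<in>E1. nrm (\<Phi> \<omega> p1 - \<Phi> \<omega> p2) \<le> nrm (p1 - p2)) \<and>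
      (\<forall>p\<in>E1. \<Phi> \<omega> (p + p0 \<kappa>) = \<Phi> \<omega> p)"
    by (elim exE)
  show ?thesis
    unfolding random_horizontal_curve_def
    by (rule conjI, rule attractor_random_set[OF assms], assumption, rule exI[of _ \<Phi>], rule \<Phi>)
qed

end


section \<open>The random attractor\<close>

theorem corollary5p4:
  fixes N d :: nat
    and \<alpha> K \<beta> \<delta> \<kappa> c1 c2 a L_F a1 a2 M1 \<gamma> :: real
    and f \<epsilon> :: "real ^ ('n::finite ^ 'd::finite)"
    and A :: "real ^ ('n ^ 'd) ^ ('n ^ 'd)"
    and lam :: "nat \<Rightarrow> real"
    and g g' :: "real \<Rightarrow> real"
    and W :: "(real \<Rightarrow> real) measure"
    and F M :: "('n ^ 'd \<Rightarrow> real \<Rightarrow> real) measure"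
    and \<Omega> :: "('n ^ 'd \<Rightarrow> real \<Rightarrow> real) set"
    and nrm :: "('n ^ 'd) phase \<Rightarrow> real"
    and Y :: "real \<Rightarrow> ('n ^ 'd \<Rightarrow> real \<Rightarrow> real) \<Rightarrow> ('n ^ 'd) phase \<Rightarrow> ('n ^ 'd) phase"
    and r R0 :: "('n ^ 'd \<Rightarrow> real \<Rightarrow> real) \<Rightarrow> real"
  assumes dims: "N = CARD('n)" "d = CARD('d)" "N \<ge> 2" "d \<ge> 1"
    and params: "\<alpha> > 0" "K > 0" "0 < \<delta>" "\<delta> \<le> 1"
    and matrix: "coupling_matrix A lam"
    and g_C1: "\<And>x. (g has_real_derivative g' x) (at x)" "continuous_on UNIV g'"
    and g_bounds: "c1 > 0" "c2 > 0" "\<And>x. \<bar>g x\<bar> \<le> c1" "\<And>x. \<bar>g' x\<bar> \<le> c2"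
    and g_periodic: "\<kappa> > 0" "\<And>x. g (x + \<kappa>) = g x"
    and g_smallest_period: "\<And>p. 0 < p \<Longrightarrow> (\<And>x. g (x + p) = g x) \<Longrightarrow> \<kappa> \<le> p"
    and wiener: "two_sided_wiener W"
    and F_def: "F = PiM UNIV (\<lambda>_. W)"
    and Omega: "good_noise_set F \<epsilon> \<Omega>"
    and M_def: "M = restrict_space F \<Omega>"
    and solution: "is_solution_map \<Omega> A K \<alpha> \<beta> f \<epsilon> g Y"
    and nrm_def: "nrm = normE A K \<alpha> \<delta> (lam 1)"
    and a_def: "a = \<alpha> / 2 - \<bar>\<alpha> / 2 - \<delta> * K * lam 1 / \<alpha>\<bar>"
    and L_F_def: "L_F = 2 * c2 * \<bar>\<beta>\<bar> / \<alpha>"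
    and M1: "M1 > 0" "\<And>x. nrm x \<le> M1 * norm x"
    and a1_def: "a1 = M1 * sqrt (3 * \<alpha>\<^sup>2 - 6 * \<alpha> + 4)"
    and a2_def: "a2 = M1 * sqrt (3 * (norm f)\<^sup>2 + 3 * \<beta>\<^sup>2 * c1\<^sup>2 * real (N ^ d))"
    and r_tempered: "tempered M r"
    and r_bounds:
      "\<And>t \<omega>. \<omega> \<in> \<Omega> \<Longrightarrow> norm (ou \<epsilon> (theta t \<omega>)) \<le> exp (a / 2 * \<bar>t\<bar>) * r \<omega>"
      "\<And>t \<omega>. \<omega> \<in> \<Omega> \<Longrightarrow> exp (- (a / 2) * \<bar>t\<bar>) * r \<omega> \<le> r (theta t \<omega>)"
      "\<And>t \<omega>. \<omega> \<in> \<Omega> \<Longrightarrow> r (theta t \<omega>) \<le> exp (a / 2 * \<bar>t\<bar>) * r \<omega>"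
    and R0_def: "\<And>\<omega>. R0 \<omega> = 4 * a1 / a * r \<omega> + 2 * a2 / a"
    and gap: "a > 4 * L_F"
    and gamma: "0 < \<gamma>" "\<gamma> < a / 2"
      "2 * c2 * \<bar>\<beta>\<bar> / \<alpha> * (1 / \<gamma> + 1 / (a - 2 * \<gamma>)) < 1"
  shows "random_horizontal_curve M nrm \<alpha> \<kappa>
           (attractor_phi \<alpha> \<kappa> \<epsilon> Y (absorbing \<alpha> \<kappa> nrm R0))"
proof -
  have CARD: "CARD('n ^ 'd) = N ^ d" using dims by simp
  have "2 \<le> N ^ d" using dims self_le_power[of N d] by linarith
  then have card: "2 \<le> CARD('n ^ 'd)" by (simp only: CARD)
  have sym: "transpose A = A" and one: "A *v vec 1 = 0" and lam1: "lam 1 > 0"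
    using matrix unfolding coupling_matrix_def by blast+
  have spW: "space W = C0" using wiener[unfolded two_sided_wiener_def] by (elim conjE)
  have \<Omega>: "\<Omega> \<in> sets F" "\<And>t. theta t ` \<Omega> = \<Omega>"
    "\<And>\<omega> j. \<omega> \<in> \<Omega> \<Longrightarrow> continuous_on UNIV (\<lambda>t. ou \<epsilon> (theta t \<omega>) $ j)"
    using Omega unfolding good_noise_set_def by simp_all
  have sub: "\<Omega> \<subseteq> space F" using \<Omega>(1) by (rule sets.sets_into_space)
  have spM: "space M = \<Omega>" using sub by (simp add: M_def space_restrict_space Int_absorb2)
  interpret ph: phase_norm A K \<alpha> \<delta> "lam 1"
  proof
    show "(A *v x) \<bullet> y = x \<bullet> (A *v y)" for x y by (rule symmetric_matrix_inner[OF sym])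
    show "A *v 1 = 0" using one by simp
    show "lam 1 * (x \<bullet> x) \<le> x \<bullet> (A *v x)" if "x \<bullet> 1 = 0" for x
      by (rule coupling_spectral_gap[OF matrix card]) (use that in simp)
  qed (rule lam1 params)+
  interpret ds: damped_system A K \<alpha> \<delta> "lam 1" \<beta> f g c1 c2 M1 \<kappa>
  proof
    show "\<bar>g x - g y\<bar> \<le> c2 * \<bar>x - y\<bar>" for x y
      using field_differentiable_bound[of UNIV g g' c2 x y] g_C1(1) g_bounds(4) by simp
    show "4 * (2 * c2 * \<bar>\<beta>\<bar> / \<alpha>) < \<alpha> / 2 - \<bar>\<alpha> / 2 - \<delta> * K * lam 1 / \<alpha>\<bar>"
      using gap unfolding a_def L_F_def .
    show "normE A K \<alpha> \<delta> (lam 1) x \<le> M1 * norm x" for x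
      using M1(2) unfolding nrm_def .
    show "0 \<le> c2" using g_bounds(2) by simp
  qed (rule g_bounds g_periodic M1(1))+
  have a: "ds.rate = a" by (simp only: ds.rate_def a_def)
  interpret sys: noise_system A K \<alpha> \<delta> "lam 1" \<beta> f g c1 c2 M1 \<kappa> \<Omega> \<epsilon> Y r
  proof
    show "theta t \<omega> \<in> \<Omega>" if "\<omega> \<in> \<Omega>" for t \<omega> using \<Omega>(2) that by blast
    show "\<omega> j 0 = 0" if "\<omega> \<in> \<Omega>" for \<omega> j
    proof -
      have "\<omega> \<in> space F" using that sub by blast
      then have "\<omega> j \<in> C0" unfolding F_def space_PiM spW by (rule PiE_mem) simp
      then show ?thesis by (simp add: C0_def)
    qed
    show "is_solution_map \<Omega> A K \<alpha> \<beta> f \<epsilon> g Y" by (rule solution)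
    show "0 \<le> r \<omega>" if "\<omega> \<in> \<Omega>" for \<omega>
      using r_tempered that unfolding tempered_def spM by (simp add: less_imp_le)
    show "norm (ou \<epsilon> (theta t \<omega>)) \<le> exp (ds.rate / 2 * \<bar>t\<bar>) * r \<omega>" if "\<omega> \<in> \<Omega>" for t \<omega>
      unfolding a by (rule r_bounds(1)[OF that])
    show "r (theta t \<omega>) \<le> exp (ds.rate / 2 * \<bar>t\<bar>) * r \<omega>" if "\<omega> \<in> \<Omega>" for t \<omega>
      unfolding a by (rule r_bounds(3)[OF that])
  qed
  have "R0 = sys.R0"
  proof
    have "real CARD('n ^ 'd) = real (N ^ d)" by (simp only: CARD)
    then show "R0 \<omega> = sys.R0 \<omega>" for \<omega>
      by (simp only: R0_def sys.R0_def ds.a1_def ds.a2_def a1_def a2_def a)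
  qed
  moreover have "(\<lambda>\<omega>. ou \<epsilon> (theta t \<omega>)) \<in> borel_measurable M" for t
    unfolding M_def F_def by (rule measurable_restrict_space1[OF ou_theta_measurable[OF wiener]])
  moreover have "continuous_on UNIV (\<lambda>t. ou \<epsilon> (theta t \<omega>))" if "\<omega> \<in> \<Omega>" for \<omega>
  proof -
    have "continuous_on UNIV (\<lambda>t. \<chi> j. ou \<epsilon> (theta t \<omega>) $ j)"
      by (rule continuous_on_vec_lambda) (rule \<Omega>(3)[OF that])
    then show ?thesis by simp
  qed
  ultimately show ?thesis
    using sys.attractor_random_horizontal_curve[OF spM] unfolding nrm_def by simp
qed

end
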